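(* Let $q$ be a (conservative stable) $Q$-function on the nonempty Borel space $S$. Consider the following condition (D): there exist a monotone nondecreasing sequence $(\tilde S_n)\subseteq\mathcal B([0,\infty)\times S)$ and a $[0,\infty)$-valued measurable function $V$ on $[0,\infty)\times S$ such that (i) $\tilde S_n\uparrow[0,\infty)\times S$ as $n\uparrow\infty$; (ii) for each $n=1,2,\dots$, $\sup_{x\in S_n,\,t\ge0}q_x(t)<\infty$, where $S_n$ denotes the projection of $\tilde S_n$ on $S$; (iii) $\inf_{(t,x)\in([0,\infty)\times S)\setminus\tilde S_n}V(t,x)\uparrow\infty$ as $n\uparrow\infty$; (iv) for some $\alpha\in(0,\infty)$, $$\int_0^\infty\int_S V(t+v,y)\,e^{-\alpha t-\int_0^t q_x(s+v)ds}\,\tilde q(dy|x,t+v)\,dt\le V(v,x)\quad\forall x\in S,\ v\in[0,\infty).$$ Then the following hold. (a) If condition (D) is satisfied, then the nonhomogeneous Markov pure jump process $(X_t)$ with transition function $P_q$ is nonexplosive. (b) Suppose that $S$ is a locally compact separable metric space; that $\sup_{x\in\Gamma,\,t\ge0}q_x(t)<\infty$ for each compact $\Gamma\subseteq S$; and that, for some $\alpha\in(0,\infty)$, the transition probability $p^\alpha$ is weakly Feller, i.e. $(v,x)\in[0,\infty)\times S\mapsto\int_S\int_0^\infty f(t,y)\,p^\alpha(dt\times dy|v,x)$ is continuous for each bounded continuous function $f$ on $[0,\infty)\times S$. If $(X_t)$ is nonexplosive, then condition (D) holds, where one can take $\tilde S_n=T_n\times S_n$ with $T_n\subseteq[0,\infty)$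 and $S_n\subseteq S$ compact sets such that $\sup_{(t,x)\in T_n\times S_n}V(t,x)<\infty$.
   Context: $S$ is a nonempty Borel space with Borel $\sigma$-algebra $\mathcal B(S)$; measurability means Borel measurability; the infimum over the empty set is $+\infty$. A (conservative stable) $Q$-function on $S$ is a Borel-measurable signed kernel $q(dy|x,s)$ on $\mathcal B(S)$ from $S\times[0,\infty)$ such that (1) $0\le q(\Gamma|x,s)<\infty$ whenever $x\notin\Gamma\in\mathcal B(S)$, (2) $q(S|x,s)=0$ for all $(x,s)$, (3) $\sup_{s\ge0}q(S\setminus\{x\}|x,s)<\infty$ for each $x\in S$. Put $\tilde q(\Gamma|x,s):=q(\Gamma\setminus\{x\}|x,s)$ and $q_x(s):=-q(\{x\}|x,s)$. The $q$-transition function is $P_q:=\sum_{n\ge0}P_q^{(n)}$, where for $0\le s\le t<\infty$, $P_q^{(0)}(s,x,t,\Gamma)=\delta_x(\Gamma)e^{-\int_s^tq_x(v)dv}$ and $P_q^{(n+1)}(s,x,t,\Gamma)=\int_s^te^{-\int_s^uq_x(v)dv}\left(\int_SP_q^{(n)}(u,z,t,\Gamma)\tilde q(dz|x,u)\right)du$. The Markov pure jump process $(X_t)$ with transition function $P_q$ and initial state $x\in S$ (law $\mathbb P^q_x$): $x_0=x$, $t_0=0$, and, given the past up to the jump moment $t_n<\infty$ with post-jump state $x_n\in S$, the next pair $(t_{n+1},x_{n+1})$ has conditional law $e^{-\int_{t_n}^tq_{x_n}(v)dv}\tilde q(dy|x_n,t)\,dt$ on $(t_n,\infty)\times S$, the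 remaining mass being put on $t_{n+1}=\infty$, $x_{n+1}=x_\infty$, where $x_\infty\notin S$ is an isolated cemetery point; $X_t=x_n$ for $t_n\le t<t_{n+1}$ and $X_t=x_\infty$ for $t\ge t_\infty:=\lim_nt_n$. The process is nonexplosive if $\mathbb P_x^q(t_\infty=\infty)=1$ for all $x\in S$. For $\alpha\in(0,\infty)$ and an isolated point $\Delta\notin S$, $p^\alpha$ is the transition probability on $([0,\infty)\times S)\cup\{(\infty,\Delta)\}$ given, for $x\in S$, $v\in[0,\infty)$, $\Gamma_1\in\mathcal B([0,\infty))$, $\Gamma_2\in\mathcal B(S)$, by $p^\alpha(\Gamma_1\times\Gamma_2|v,x)=\int_{\Gamma_1\cap(v,\infty)}e^{-\int_0^{t-v}(\alpha+q_x(s+v))ds}\tilde q(\Gamma_2|x,t)dt$, $p^\alpha(\{(\infty,\Delta)\}|v,x)=1-\int_0^\infty e^{-\alpha t-\int_0^tq_x(s+v)ds}q_x(t+v)dt$, and $p^\alpha(\{(\infty,\Delta)\}|\infty,\Delta)=1$. *)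

theory Defs
  imports "HOL-Probability.Probability"
begin

text \<open>
  A Borel space is represented by a Borel subset \<open>S\<close> of a Polish type, with the subspace topology.
\<close>

abbreviation borel_on :: "'a::topological_space set \<Rightarrow> 'a measure" where
  "borel_on X \<equiv> restrict_space borel X"


section \<open>Q-functions\<close>

text \<open>
  Real values lose no generality below: a signed measure that gives the whole space the finite
  value 0 takes only finite values.
\<close>

definition signed_measure_on :: "'a measure \<Rightarrow> ('a set \<Rightarrow> real) \<Rightarrow> bool" where
  "signed_measure_on M \<mu> \<longleftrightarrow> \<mu> {} = 0 \<and>
     (\<forall>A. range A \<subseteq> sets M \<longrightarrow> disjoint_family A \<longrightarrow> (\<lambda>i::nat. \<mu> (A i)) sums \<mu> (\<Union>i. A i))"

text \<open>\<open>q x s \<Gamma>\<close> stands for \<open>q(\<Gamma>|x,s)\<close>.\<close>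

definition Q_function :: "'a::polish_space set \<Rightarrow> ('a \<Rightarrow> real \<Rightarrow> 'a set \<Rightarrow> real) \<Rightarrow> bool" where
  "Q_function S q \<longleftrightarrow>
     (\<forall>x\<in>S. \<forall>s\<ge>0. signed_measure_on (borel_on S) (q x s)) \<and>
     (\<forall>\<Gamma>\<in>sets (borel_on S). (\<lambda>(x, s). q x s \<Gamma>) \<in> borel_measurable (borel_on (S \<times> {0..}))) \<and>
     (\<forall>x\<in>S. \<forall>s\<ge>0. \<forall>\<Gamma>\<in>sets (borel_on S). x \<notin> \<Gamma> \<longrightarrow> 0 \<le> q x s \<Gamma>) \<and>
     (\<forall>x\<in>S. \<forall>s\<ge>0. q x s S = 0) \<and>
     (\<forall>x\<in>S. (SUP s\<in>{0..}. ereal (q x s (S - {x}))) < \<infinity>)"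

definition q_jump :: "'a::polish_space set \<Rightarrow> ('a \<Rightarrow> real \<Rightarrow> 'a set \<Rightarrow> real) \<Rightarrow> 'a \<Rightarrow> real \<Rightarrow> 'a measure" where
  "q_jump S q x s = measure_of S (sets (borel_on S)) (\<lambda>\<Gamma>. ennreal (q x s (\<Gamma> - {x})))"

definition q_rate :: "('a \<Rightarrow> real \<Rightarrow> 'a set \<Rightarrow> real) \<Rightarrow> 'a \<Rightarrow> real \<Rightarrow> real" where
  "q_rate q x s = - q x s {x}"


section \<open>The transition function of a Q-function\<close>

text \<open>
  \<open>Pq\<close> is the transition function of \<open>jump_process\<close> below. That process is given by the
  conditional laws of its jumps, and nonexplosion refers to its jump times only.
\<close>

primrec Pq_iter ::
    "'a::polish_space set \<Rightarrow> ('a \<Rightarrow> real \<Rightarrow> 'a set \<Rightarrow> real) \<Rightarrow> nat \<Rightarrow> real \<Rightarrow> 'a \<Rightarrow> real \<Rightarrow> 'a set \<Rightarrow> ennreal" where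
  "Pq_iter S q 0 s x t \<Gamma> = indicator \<Gamma> x * ennreal (exp (- (LBINT v:{s..t}. q_rate q x v)))"
| "Pq_iter S q (Suc n) s x t \<Gamma> =
     (\<integral>\<^sup>+u\<in>{s..t}. ennreal (exp (- (LBINT v:{s..u}. q_rate q x v))) *
        (\<integral>\<^sup>+z. Pq_iter S q n u z t \<Gamma> \<partial>q_jump S q x u) \<partial>lborel)"

definition Pq :: "'a::polish_space set \<Rightarrow> ('a \<Rightarrow> real \<Rightarrow> 'a set \<Rightarrow> real) \<Rightarrow> real \<Rightarrow> 'a \<Rightarrow> real \<Rightarrow> 'a set \<Rightarrow> ennreal" where
  "Pq S q s x t \<Gamma> = (\<Sum>n. Pq_iter S q n s x t \<Gamma>)"


section \<open>The jump process\<close>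

text \<open>
  \<open>with_cemetery N c\<close> carries \<open>N\<close> over to the copy \<open>Some\<close> of its space and puts the mass \<open>c\<close> on
  the isolated point \<open>None\<close>.
\<close>

definition with_cemetery :: "'b measure \<Rightarrow> ennreal \<Rightarrow> 'b option measure" where
  "with_cemetery N c =
     measure_of (insert None (Some ` space N))
       {A. A \<subseteq> insert None (Some ` space N) \<and> Some -` A \<in> sets N}
       (\<lambda>A. emeasure N (Some -` A) + c * indicator A None)"

text \<open>
  States are \<open>Some (t, x)\<close> with \<open>t \<in> [0,\<infinity>)\<close>, \<open>x \<in> S\<close>, or \<open>None\<close>; the latter stands for
  \<open>(\<infinity>, x\<^sub>\<infinity>)\<close> and for \<open>(\<infinity>, \<Delta>)\<close>.
\<close>

definition jump_states :: "'a::polish_space set \<Rightarrow> (real \<times> 'a) option measure" where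
  "jump_states S = with_cemetery (borel_on ({0..} \<times> S)) 0"

text \<open>The measure \<open>w(t) q~(dy|x,t) dt\<close> on \<open>(v,\<infinity>) \<times> S\<close>.\<close>

definition jump_measure ::
    "'a::polish_space set \<Rightarrow> ('a \<Rightarrow> real \<Rightarrow> 'a set \<Rightarrow> real) \<Rightarrow> 'a \<Rightarrow> (real \<Rightarrow> real) \<Rightarrow> real \<Rightarrow> (real \<times> 'a) measure" where
  "jump_measure S q x w v =
     measure_of ({0..} \<times> S) (sets (borel_on ({0..} \<times> S)))
       (\<lambda>A. \<integral>\<^sup>+t\<in>{v<..}. ennreal (w t) * emeasure (q_jump S q x t) {y \<in> S. (t, y) \<in> A} \<partial>lborel)"

definition jump_kernel ::
    "'a::polish_space set \<Rightarrow> ('a \<Rightarrow> real \<Rightarrow> 'a set \<Rightarrow> real) \<Rightarrow> (real \<times> 'a) option \<Rightarrow> (real \<times> 'a) option measure" where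
  "jump_kernel S q z = (case z of
       None \<Rightarrow> return (jump_states S) None
     | Some (s, x) \<Rightarrow>
         let N = jump_measure S q x (\<lambda>t. exp (- (LBINT v:{s..t}. q_rate q x v))) s
         in with_cemetery N (1 - emeasure N (space N)))"

definition jump_chain_step ::
    "'a::polish_space set \<Rightarrow> ('a \<Rightarrow> real \<Rightarrow> 'a set \<Rightarrow> real) \<Rightarrow> 'a \<Rightarrow> nat \<Rightarrow> (nat \<Rightarrow> (real \<times> 'a) option) \<Rightarrow> (real \<times> 'a) option measure" where
  "jump_chain_step S q x n \<omega> = (case n of
       0 \<Rightarrow> return (jump_states S) (Some (0, x))
     | Suc m \<Rightarrow> jump_kernel S q (\<omega> m))"

text \<open>The law of the sequence of the pairs \<open>(t\<^sub>n, x\<^sub>n)\<close>, by the theorem of Ionescu-Tulcea.\<close>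

definition jump_law ::
    "'a::polish_space set \<Rightarrow> ('a \<Rightarrow> real \<Rightarrow> 'a set \<Rightarrow> real) \<Rightarrow> 'a \<Rightarrow> (nat \<Rightarrow> (real \<times> 'a) option) measure" where
  "jump_law S q x =
     projective_family.lim UNIV
       (Ionescu_Tulcea.CI (jump_chain_step S q x) (\<lambda>_. jump_states S)) (\<lambda>_. jump_states S)"

definition jump_time :: "(nat \<Rightarrow> (real \<times> 'a) option) \<Rightarrow> nat \<Rightarrow> ereal" where
  "jump_time \<omega> n = (case \<omega> n of None \<Rightarrow> \<infinity> | Some (t, x) \<Rightarrow> ereal t)"

definition explosion_time :: "(nat \<Rightarrow> (real \<times> 'a) option) \<Rightarrow> ereal" where
  "explosion_time \<omega> = lim (jump_time \<omega>)"

definition jump_process :: "real \<Rightarrow> (nat \<Rightarrow> (real \<times> 'a) option) \<Rightarrow> 'a option" where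
  "jump_process t \<omega> =
     (if \<exists>n. jump_time \<omega> n \<le> ereal t \<and> ereal t < jump_time \<omega> (Suc n)
      then map_option snd (\<omega> (LEAST n. jump_time \<omega> n \<le> ereal t \<and> ereal t < jump_time \<omega> (Suc n)))
      else None)"

definition nonexplosive :: "'a::polish_space set \<Rightarrow> ('a \<Rightarrow> real \<Rightarrow> 'a set \<Rightarrow> real) \<Rightarrow> bool" where
  "nonexplosive S q \<longleftrightarrow>
     (\<forall>x\<in>S. measure (jump_law S q x) {\<omega> \<in> space (jump_law S q x). explosion_time \<omega> = \<infinity>} = 1)"


section \<open>The weak Feller property\<close>

definition p_alpha ::
    "'a::polish_space set \<Rightarrow> ('a \<Rightarrow> real \<Rightarrow> 'a set \<Rightarrow> real) \<Rightarrow> real \<Rightarrow> (real \<times> 'a) option \<Rightarrow> (real \<times> 'a) option measure" where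
  "p_alpha S q \<alpha> z = (case z of
       None \<Rightarrow> return (jump_states S) None
     | Some (v, x) \<Rightarrow>
         with_cemetery
           (jump_measure S q x (\<lambda>t. exp (- (LBINT s:{0..t - v}. \<alpha> + q_rate q x (s + v)))) v)
           (ennreal (1 - (LBINT t:{0..}.
              exp (- \<alpha> * t - (LBINT s:{0..t}. q_rate q x (s + v))) * q_rate q x (t + v)))))"

definition weakly_Feller :: "'a::polish_space set \<Rightarrow> ((real \<times> 'a) option \<Rightarrow> (real \<times> 'a) option measure) \<Rightarrow> bool" where
  "weakly_Feller S p \<longleftrightarrow>
     (\<forall>f :: real \<times> 'a \<Rightarrow> real.
        continuous_on ({0..} \<times> S) f \<longrightarrow> bounded (f ` ({0..} \<times> S)) \<longrightarrow>
        continuous_on ({0..} \<times> S) (\<lambda>(v, x). LINT z:range Some|p (Some (v, x)). f (the z)))"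


section \<open>The drift condition\<close>

definition drift_condition ::
    "'a::polish_space set \<Rightarrow> ('a \<Rightarrow> real \<Rightarrow> 'a set \<Rightarrow> real) \<Rightarrow> (nat \<Rightarrow> (real \<times> 'a) set) \<Rightarrow> (real \<times> 'a \<Rightarrow> real) \<Rightarrow> bool" where
  "drift_condition S q St V \<longleftrightarrow>
     (\<forall>n. St n \<in> sets (borel_on ({0..} \<times> S))) \<and> incseq St \<and>
     V \<in> borel_measurable (borel_on ({0..} \<times> S)) \<and> (\<forall>z\<in>{0..} \<times> S. 0 \<le> V z) \<and>
     (\<Union>n. St n) = {0..} \<times> S \<and>
     (\<forall>n. (SUP (x, t)\<in>(snd ` St n) \<times> {0..}. ereal (q_rate q x t)) < \<infinity>) \<and>
     incseq (\<lambda>n. INF z\<in>{0..} \<times> S - St n. ereal (V z)) \<and>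
     (\<lambda>n. INF z\<in>{0..} \<times> S - St n. ereal (V z)) \<longlonglongrightarrow> \<infinity> \<and>
     (\<exists>\<alpha>>0. \<forall>x\<in>S. \<forall>v\<ge>0.
        (\<integral>\<^sup>+t\<in>{0..}. (\<integral>\<^sup>+y. ennreal (V (t + v, y)) *
             ennreal (exp (- \<alpha> * t - (LBINT s:{0..t}. q_rate q x (s + v)))) \<partial>q_jump S q x (t + v)) \<partial>lborel)
          \<le> ennreal (V (v, x)))"

end

theory Submission
  imports Defs
begin

text \<open>
  Let \<open>K\<close> be the operator \<open>f \<mapsto> \<integral>f dp\<^sup>\<alpha>\<close> (\<open>step \<alpha>\<close> below). The expectation of \<open>exp (- \<alpha> t\<^sub>n)\<close> under the law
  started at \<open>(0, x)\<close> is \<open>K\<^sup>n 1 (0, x)\<close>, so the process is nonexplosive iff \<open>K\<^sup>n 1 (0, x)\<close> tends to 0 for all \<open>x\<close>.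

  (a) Given \<open>e > 0\<close> choose \<open>n\<close> with \<open>1 \<le> e V\<close> off \<open>St n\<close>. On \<open>St n\<close> the rates are bounded, hence \<open>K 1 \<le> r < 1\<close>
  there, and \<open>K V \<le> V\<close> gives \<open>K\<^sup>m 1 \<le> r\<^sup>m + e V\<close> by induction on \<open>m\<close>.

  (b) Exhaust the state space by compact sets \<open>C n\<close> and let \<open>U n\<close> be the least function with \<open>K U \<le> U\<close> above a
  continuous cutoff \<open>f n\<close> of the complement of \<open>C n\<close>. Then \<open>U n \<le> (\<Sum>i<N. K\<^sup>i (f n)) + K\<^sup>N 1\<close> for all \<open>N\<close>. By the
  Feller property both terms are continuous, and Dini's theorem makes them small on compact sets, so that a
  sum of suitable \<open>U n\<close> is finite, locally bounded, and tends to infinity off the compact sets.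
\<close>

section \<open>Adjoining the cemetery\<close>

text \<open>The link between the law and K is that \<open>exp (- \<alpha> t)\<close> is
  multiplicative in time: discounting the next jump time under the undiscounted kernel is the
  present discount times one application of K. The discounts decrease almost surely to the discount
  at the explosion time, whose mean vanishes exactly when there is no explosion.

  Three obstacles shape the rest. The set \<open>\<Gamma> - {x}\<close> in the jump measure moves
  with \<open>x\<close>, so joint measurability of the kernel is not contained in the definition of
  a Q-function. Rates are merely measurable in time, so mass bounds cannot come from differentiating
  exponentials. Nonexplosion concerns initial time 0, whereas (b) needs decay at every
  \<open>(v, x)\<close>.

  The number r in (a) is \<open>k / (k + \<alpha>)\<close>: with rates at most k, a jump precedes an
  independent killing clock of rate \<alpha> with at most this probability. In (b) cutoffs replace
  indicators because the Feller property speaks of continuous functions; the functions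
  \<open>U n\<close> themselves need not be continuous, and only their finite bounds are handed to
  Dini. Taking the k-th summand at most \<open>2^-k\<close> on the k-th compact set makes the sum
  locally bounded.\<close>

lemma sigma_algebra_with_cemetery:
  "sigma_algebra (insert None (Some ` space N))
     {A. A \<subseteq> insert None (Some ` space N) \<and> Some -` A \<in> sets N}"
proof (unfold sigma_algebra_iff2, intro conjI ballI allI impI)
  fix A assume "A \<in> {A. A \<subseteq> insert None (Some ` space N) \<and> Some -` A \<in> sets N}"
  moreover have "Some -` insert None (Some ` space N) = space N" by auto
  ultimately show "insert None (Some ` space N) - A \<in> {A. A \<subseteq> insert None (Some ` space N) \<and> Some -` A \<in> sets N}"
    by (auto simp: vimage_Diff)
next
  fix A :: "nat \<Rightarrow> 'a option set"
  assume "range A \<subseteq> {A. A \<subseteq> insert None (Some ` space N) \<and> Some -` A \<in> sets N}"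
  then show "(\<Union>i. A i) \<in> {A. A \<subseteq> insert None (Some ` space N) \<and> Some -` A \<in> sets N}"
    by (auto simp: vimage_UN)
qed auto

lemma space_with_cemetery [simp]: "space (with_cemetery N c) = insert None (Some ` space N)"
  unfolding with_cemetery_def by (rule space_measure_of) auto

lemma sets_with_cemetery:
  "sets (with_cemetery N c) = {A. A \<subseteq> insert None (Some ` space N) \<and> Some -` A \<in> sets N}"
  unfolding with_cemetery_def
  by (rule sigma_algebra.sets_measure_of_eq[OF sigma_algebra_with_cemetery])

lemma emeasure_with_cemetery:
  assumes "A \<in> sets (with_cemetery N c)"
  shows "emeasure (with_cemetery N c) A = emeasure N (Some -` A) + c * indicator A None"
proof -
  let ?\<A> = "{A. A \<subseteq> insert None (Some ` space N) \<and> Some -` A \<in> sets N}"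
  let ?\<mu> = "\<lambda>A. emeasure N (Some -` A) + c * indicator A None"
  have "countably_additive ?\<A> ?\<mu>"
  proof (rule countably_additiveI)
    fix A :: "nat \<Rightarrow> 'a option set"
    assume A: "range A \<subseteq> ?\<A>" and disj: "disjoint_family A"
    have "disjoint_family (\<lambda>i. Some -` A i)"
      using disj unfolding disjoint_family_on_def by blast
    then have "(\<Sum>i. emeasure N (Some -` A i)) = emeasure N (\<Union>i. Some -` A i)"
      using A by (intro suminf_emeasure) auto
    moreover have "(\<Sum>i. indicator (A i) None) = (indicator (\<Union>i. A i) None :: ennreal)"
      by (rule suminf_indicator[OF disj])
    ultimately show "(\<Sum>i. ?\<mu> (A i)) = ?\<mu> (\<Union>i. A i)"
      by (simp add: suminf_add[symmetric] vimage_UN)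
  qed
  moreover have "positive ?\<A> ?\<mu>"
    by (simp add: positive_def)
  ultimately show ?thesis
    unfolding with_cemetery_def using assms
    by (intro emeasure_measure_of_sigma[OF sigma_algebra_with_cemetery])
       (auto simp: sets_with_cemetery)
qed

lemma sets_with_cemetery_cong:
  "sets N = sets N' \<Longrightarrow> sets (with_cemetery N c) = sets (with_cemetery N' c')"
  using sets_eq_imp_space_eq[of N N'] by (simp add: sets_with_cemetery)

lemma measurable_Some_with_cemetery [measurable]: "Some \<in> N \<rightarrow>\<^sub>M with_cemetery N c"
proof (rule measurableI)
  fix A assume "A \<in> sets (with_cemetery N c)"
  then have "Some -` A \<in> sets N" by (simp add: sets_with_cemetery)
  then show "Some -` A \<inter> space N \<in> sets N"
    by (metis sets.sets_into_space Int_absorb2)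
qed auto

text \<open>\<open>None\<close> is an isolated measurable point and the rest is a copy of
  \<open>N\<close>, so the two pieces impose separate conditions.\<close>

lemma measurable_with_cemetery_iff:
  "f \<in> with_cemetery N c \<rightarrow>\<^sub>M L \<longleftrightarrow> f None \<in> space L \<and> (\<lambda>z. f (Some z)) \<in> N \<rightarrow>\<^sub>M L"
proof (intro iffI conjI)
  assume f: "f \<in> with_cemetery N c \<rightarrow>\<^sub>M L"
  show "f None \<in> space L"
    using measurable_space[OF f, of None] by simp
  show "(\<lambda>z. f (Some z)) \<in> N \<rightarrow>\<^sub>M L"
    by (rule measurable_compose[OF measurable_Some_with_cemetery f])
next
  assume f: "f None \<in> space L \<and> (\<lambda>z. f (Some z)) \<in> N \<rightarrow>\<^sub>M L"
  show "f \<in> with_cemetery N c \<rightarrow>\<^sub>M L"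
  proof (rule measurableI)
    fix z assume "z \<in> space (with_cemetery N c)"
    then show "f z \<in> space L"
      using f by (auto dest: measurable_space)
  next
    fix A assume "A \<in> sets L"
    then have "(\<lambda>z. f (Some z)) -` A \<inter> space N \<in> sets N"
      using f by (auto intro: measurable_sets)
    moreover have "Some -` (f -` A \<inter> space (with_cemetery N c)) = (\<lambda>z. f (Some z)) -` A \<inter> space N"
      by auto
    ultimately show "f -` A \<inter> space (with_cemetery N c) \<in> sets (with_cemetery N c)"
      by (auto simp: sets_with_cemetery)
  qed
qed

lemma nn_integral_with_cemetery:
  assumes "f \<in> borel_measurable (with_cemetery N c)"
  shows "(\<integral>\<^sup>+z. f z \<partial>with_cemetery N c) = (\<integral>\<^sup>+z. f (Some z) \<partial>N) + c * f None"
  using assms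
proof (induction rule: borel_measurable_induct)
  case (cong f g)
  have "(\<integral>\<^sup>+z. f z \<partial>with_cemetery N c) = (\<integral>\<^sup>+z. g z \<partial>with_cemetery N c)"
    by (rule nn_integral_cong) (rule cong)
  moreover have "(\<integral>\<^sup>+z. f (Some z) \<partial>N) = (\<integral>\<^sup>+z. g (Some z) \<partial>N)"
    by (rule nn_integral_cong) (simp add: cong)
  moreover have "f None = g None"
    by (simp add: cong)
  ultimately show ?case using cong by simp
next
  case (set A)
  have "(\<integral>\<^sup>+z. indicator A (Some z) \<partial>N) = (\<integral>\<^sup>+z. indicator (Some -` A) z \<partial>N)"
    by (intro nn_integral_cong) (simp add: indicator_def)
  also have "\<dots> = emeasure N (Some -` A)"
    using set by (simp add: sets_with_cemetery)
  finally show ?case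
    using set by (simp add: emeasure_with_cemetery)
next
  case (mult u a)
  then have "(\<lambda>z. u (Some z)) \<in> borel_measurable N"
    by (simp add: measurable_with_cemetery_iff)
  with mult show ?case
    by (simp add: nn_integral_cmult distrib_left mult_ac)
next
  case (add u v)
  then have "(\<lambda>z. u (Some z)) \<in> borel_measurable N" "(\<lambda>z. v (Some z)) \<in> borel_measurable N"
    by (simp_all add: measurable_with_cemetery_iff)
  with add show ?case
    by (simp add: nn_integral_add distrib_left add_ac)
next
  case (seq U)
  then have U: "\<And>i. (\<lambda>z. U i (Some z)) \<in> borel_measurable N"
    by (simp add: measurable_with_cemetery_iff)
  have inc: "incseq (\<lambda>i z. U i (Some z))"
    using seq(3) by (auto simp: incseq_def le_fun_def)
  have inc': "incseq (\<lambda>i. c * U i None)"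
    using seq(3) by (auto simp: incseq_def le_fun_def intro!: mult_left_mono)
  have inc'': "incseq (\<lambda>i. \<integral>\<^sup>+z. U i (Some z) \<partial>N)"
    using inc by (auto simp: incseq_def le_fun_def intro!: nn_integral_mono)
  have "(\<integral>\<^sup>+z. (SUP i. U i) z \<partial>with_cemetery N c) = (SUP i. \<integral>\<^sup>+z. U i z \<partial>with_cemetery N c)"
    using seq by (simp add: nn_integral_monotone_convergence_SUP image_comp)
  also have "\<dots> = (SUP i. (\<integral>\<^sup>+z. U i (Some z) \<partial>N) + c * U i None)"
    using seq by simp
  also have "\<dots> = (SUP i. \<integral>\<^sup>+z. U i (Some z) \<partial>N) + (SUP i. c * U i None)"
    by (rule ennreal_SUP_add[OF inc'' inc'])
  also have "\<dots> = (\<integral>\<^sup>+z. (SUP i. U i) (Some z) \<partial>N) + c * (SUP i. U i) None"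
    using U inc by (simp add: nn_integral_monotone_convergence_SUP image_comp SUP_mult_left_ennreal)
  finally show ?case
    by (simp add: image_comp)
qed

text \<open>Restricting to \<open>range Some\<close> discards the atom, so \<open>c\<close>
  disappears. If the integral is infinite, both sides take the default value 0, so no integrability
  is required.\<close>

lemma set_integral_range_Some_with_cemetery:
  fixes f :: "'b \<Rightarrow> real"
  assumes f: "f \<in> borel_measurable N" and nonneg: "\<And>z. z \<in> space N \<Longrightarrow> 0 \<le> f z"
  shows "(LINT z:range Some|with_cemetery N c. f (the z)) = enn2real (\<integral>\<^sup>+z. ennreal (f z) \<partial>N)"
proof -
  have "(\<lambda>z. indicator (range Some) z *\<^sub>R f (the z)) \<in> borel_measurable (with_cemetery N c)"
    using f by (simp add: measurable_with_cemetery_iff)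
  then show ?thesis
    unfolding set_lebesgue_integral_def using nonneg
    by (subst integral_eq_nn_integral)
       (auto simp: nn_integral_with_cemetery indicator_def intro!: AE_I2 arg_cong[where f=enn2real])
qed

text \<open>Sending the missing mass to \<open>None\<close> completes a subprobability kernel to a
  probability kernel, as the Ionescu-Tulcea construction requires. \<open>with_cemetery M 0\<close>
  only names the target sigma-algebra.\<close>

lemma measurable_with_cemetery_kernel:
  assumes N: "N \<in> L \<rightarrow>\<^sub>M subprob_algebra M"
  shows "(\<lambda>z. with_cemetery (N z) (1 - emeasure (N z) (space (N z)))) \<in> L \<rightarrow>\<^sub>M prob_algebra (with_cemetery M 0)"
proof -
  let ?W = "\<lambda>z. with_cemetery (N z) (1 - emeasure (N z) (space (N z)))"
  note [measurable] = N
  have sets_N: "sets (N z) = sets M" and space_N: "space (N z) = space M"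
    and sub: "emeasure (N z) (space M) \<le> 1" if "z \<in> space L" for z
    using subprob_measurableD[OF N that] subprob_space.emeasure_space_le_1[OF subprob_space_kernel[OF N that]]
    by auto
  have sets_W: "sets (?W z) = sets (with_cemetery M 0)" if "z \<in> space L" for z
    by (rule sets_with_cemetery_cong) (rule sets_N[OF that])
  have prob: "prob_space (?W z)" if "z \<in> space L" for z
  proof
    have "Some -` insert None (Some ` space (N z)) = space (N z)"
      by auto
    then have "emeasure (?W z) (space (?W z)) = emeasure (N z) (space (N z)) + (1 - emeasure (N z) (space (N z)))"
      using emeasure_with_cemetery[OF sets.top, of "N z" "1 - emeasure (N z) (space (N z))"] by simp
    then show "emeasure (?W z) (space (?W z)) = 1"
      by (simp only: space_N[OF that] add_diff_inverse_ennreal[OF sub[OF that]])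
  qed
  have "?W \<in> L \<rightarrow>\<^sub>M subprob_algebra (with_cemetery M 0)"
  proof (rule measurable_subprob_algebra)
    fix A assume A: "A \<in> sets (with_cemetery M 0)"
    then have [measurable]: "Some -` A \<in> sets M"
      by (simp add: sets_with_cemetery)
    have [measurable]: "(\<lambda>z. emeasure (N z) (space (N z))) \<in> borel_measurable L"
      by measurable
    have "(\<lambda>z. emeasure (N z) (Some -` A) + (1 - emeasure (N z) (space (N z))) * indicator A None) \<in> borel_measurable L"
      by measurable
    then show "(\<lambda>z. emeasure (?W z) A) \<in> borel_measurable L"
      by (rule measurable_cong[THEN iffD1, rotated]) (simp add: emeasure_with_cemetery sets_W A)
  qed (simp_all add: sets_W prob prob_space_imp_subprob_space)
  then show ?thesis
    by (auto simp: prob_algebra_def measurable_restrict_space2_iff prob)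
qed

section \<open>Jump measures of a Q-function\<close>

text \<open>The identity is measurable in both directions, and both spaces have the same points;
  hence the sigma-algebras coincide.\<close>

lemma sets_restrict_space_pair:
  "sets (restrict_space (M \<Otimes>\<^sub>M N) (A \<times> B)) = sets (restrict_space M A \<Otimes>\<^sub>M restrict_space N B)"
    (is "sets ?L = sets ?R")
proof -
  have space: "space ?L = space ?R"
    by (auto simp: space_restrict_space space_pair_measure)
  have fst: "fst \<in> ?R \<rightarrow>\<^sub>M M" and snd: "snd \<in> ?R \<rightarrow>\<^sub>M N"
    by (auto intro!: measurable_compose[OF measurable_fst measurable_restrict_space1[OF measurable_ident, unfolded id_def]]
      measurable_compose[OF measurable_snd measurable_restrict_space1[OF measurable_ident, unfolded id_def]])
  have "(\<lambda>z. (fst z, snd z)) \<in> ?R \<rightarrow>\<^sub>M M \<Otimes>\<^sub>M N"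
    by (rule measurable_Pair[OF fst snd])
  then have id1: "(\<lambda>z. z) \<in> ?R \<rightarrow>\<^sub>M ?L"
    by (intro measurable_restrict_space2) (auto simp: space_pair_measure space_restrict_space)
  have "fst \<in> ?L \<rightarrow>\<^sub>M restrict_space M A" "snd \<in> ?L \<rightarrow>\<^sub>M restrict_space N B"
    by (auto intro!: measurable_restrict_space2[OF _ measurable_restrict_space1] simp: space_restrict_space)
  then have "(\<lambda>z. (fst z, snd z)) \<in> ?L \<rightarrow>\<^sub>M ?R"
    by (rule measurable_Pair)
  then have id2: "(\<lambda>z. z) \<in> ?L \<rightarrow>\<^sub>M ?R"
    by simp
  show ?thesis
  proof (intro equalityI subsetI)
    fix X assume X: "X \<in> sets ?L"
    then have "(\<lambda>z. z) -` X \<inter> space ?R \<in> sets ?R" by (rule measurable_sets[OF id1])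
    then show "X \<in> sets ?R" using sets.sets_into_space[OF X] by (simp add: space Int_absorb2)
  next
    fix X assume X: "X \<in> sets ?R"
    then have "(\<lambda>z. z) -` X \<inter> space ?L \<in> sets ?L" by (rule measurable_sets[OF id2])
    then show "X \<in> sets ?L" using sets.sets_into_space[OF X] by (simp add: space Int_absorb2)
  qed
qed

text \<open>Second countability makes the Borel sigma-algebra of a product the product one.
  Q-functions are measurable with respect to the former, while kernel arguments and Fubini work with
  the latter.\<close>

lemma sets_borel_on_Times:
  fixes A :: "'b::second_countable_topology set" and B :: "'c::second_countable_topology set"
  shows "sets (borel_on (A \<times> B)) = sets (borel_on A \<Otimes>\<^sub>M borel_on B)"
  by (subst borel_prod[symmetric]) (rule sets_restrict_space_pair)

locale Q_kernel =
  fixes S :: "'a::polish_space set" and q :: "'a \<Rightarrow> real \<Rightarrow> 'a set \<Rightarrow> real"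
  assumes S: "S \<in> sets borel" and Q: "Q_function S q"
begin

abbreviation T where "T \<equiv> borel_on {0::real..}"
abbreviation E where "E \<equiv> borel_on S"
abbreviation B where "B \<equiv> borel_on ({0::real..} \<times> S)"

lemma sets_B [measurable_cong]: "sets B = sets (T \<Otimes>\<^sub>M E)"
  by (rule sets_borel_on_Times)

lemma space_B [simp]: "space B = {0..} \<times> S"
  by (simp add: space_restrict_space)

lemma sets_E: "\<Gamma> \<in> sets E \<longleftrightarrow> \<Gamma> \<subseteq> S \<and> \<Gamma> \<in> sets borel"
  using S by (auto simp: sets_restrict_space_iff)

lemma Diff_sets_E: "\<Gamma> \<in> sets E \<Longrightarrow> \<Gamma> - {x} \<in> sets E"
  by (auto simp: sets_E)

context
  fixes x :: 'a and s :: real assumes x: "x \<in> S" and s: "0 \<le> s"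
begin

lemma q_sums:
  assumes "range A \<subseteq> sets E" "disjoint_family A"
  shows "(\<lambda>i::nat. q x s (A i)) sums q x s (\<Union>i. A i)"
  using Q x s assms unfolding Q_function_def signed_measure_on_def by blast

lemma q_empty [simp]: "q x s {} = 0"
  using Q x s unfolding Q_function_def signed_measure_on_def by blast

lemma q_nonneg: "\<Gamma> \<in> sets E \<Longrightarrow> x \<notin> \<Gamma> \<Longrightarrow> 0 \<le> q x s \<Gamma>"
  using Q x s unfolding Q_function_def by blast

lemma q_whole: "q x s S = 0"
  using Q x s unfolding Q_function_def by blast

lemma q_Un:
  assumes "\<Gamma> \<in> sets E" "\<Gamma>' \<in> sets E" "\<Gamma> \<inter> \<Gamma>' = {}"
  shows "q x s (\<Gamma> \<union> \<Gamma>') = q x s \<Gamma> + q x s \<Gamma>'"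
proof -
  have "(\<lambda>i. q x s (binaryset \<Gamma> \<Gamma>' i)) sums q x s (\<Union>i. binaryset \<Gamma> \<Gamma>' i)"
    using assms by (intro q_sums) (auto simp: range_binaryset_eq disjoint_family_on_def binaryset_def)
  moreover have "(\<lambda>i. q x s (binaryset \<Gamma> \<Gamma>' i)) sums (q x s \<Gamma> + q x s \<Gamma>')"
    by (rule binaryset_sums) simp
  ultimately show ?thesis
    by (simp add: UN_binaryset_eq sums_unique2)
qed

text \<open>Conservativeness \<open>q_whole\<close> carries the mass at \<open>x\<close> over to the
  complement, which makes the rate the total mass of the jump measure.\<close>

lemma q_rate_eq: "q_rate q x s = q x s (S - {x})"
proof -
  have "q x s ({x} \<union> (S - {x})) = q x s {x} + q x s (S - {x})"
    using x S by (intro q_Un) (auto simp: sets_E)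
  moreover have "{x} \<union> (S - {x}) = S" using x by auto
  ultimately show ?thesis by (simp add: q_rate_def q_whole)
qed

lemma q_rate_nonneg: "0 \<le> q_rate q x s"
  unfolding q_rate_eq using S by (intro q_nonneg) (auto simp: sets_E)

text \<open>\<open>measure_of\<close> falls back to the zero measure unless its argument is a
  measure, so countable additivity has to be shown. Away from \<open>x\<close> the signed measure is
  nonnegative, so \<open>ennreal\<close> truncates nothing.\<close>

lemma emeasure_q_jump:
  assumes "\<Gamma> \<in> sets E" shows "emeasure (q_jump S q x s) \<Gamma> = ennreal (q x s (\<Gamma> - {x}))"
proof (rule emeasure_measure_of[OF q_jump_def])
  show "sets E \<subseteq> Pow S" by (auto simp: sets_E)
  show "\<Gamma> \<in> sets (q_jump S q x s)"
    using assms sets.sets_measure_of_eq[of E] by (simp add: q_jump_def space_restrict_space)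
  show "positive (sets (q_jump S q x s)) (\<lambda>\<Gamma>. ennreal (q x s (\<Gamma> - {x})))"
    by (simp add: positive_def)
  show "countably_additive (sets (q_jump S q x s)) (\<lambda>\<Gamma>. ennreal (q x s (\<Gamma> - {x})))"
  proof (rule countably_additiveI)
    fix A :: "nat \<Rightarrow> 'a set" assume A: "range A \<subseteq> sets (q_jump S q x s)" and disj: "disjoint_family A"
    have A': "A i \<in> sets E" for i
      using A sets.sets_measure_of_eq[of E] by (auto simp: q_jump_def space_restrict_space)
    have "(\<lambda>i. q x s (A i - {x})) sums q x s (\<Union>i. A i - {x})"
      using disj by (intro q_sums) (auto simp: disjoint_family_on_def Diff_sets_E A')
    then have "(\<Sum>i. ennreal (q x s (A i - {x}))) = ennreal (q x s (\<Union>i. A i - {x}))"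
      by (rule suminf_ennreal_eq[rotated]) (auto intro!: q_nonneg Diff_sets_E A')
    then show "(\<Sum>i. ennreal (q x s (A i - {x}))) = ennreal (q x s (\<Union> (range A) - {x}))"
      by (simp only: UN_simps(6))
  qed
qed

end

section \<open>Joint measurability of jump measures and rates in time and state\<close>

lemma sets_q_jump [measurable_cong]: "sets (q_jump S q x s) = sets E"
  using sets.sets_measure_of_eq[of E] by (simp add: q_jump_def space_restrict_space)

lemma space_q_jump [simp]: "space (q_jump S q x s) = S"
  using sets_eq_imp_space_eq[OF sets_q_jump] by (simp add: space_restrict_space)

lemma borel_measurable_q: 
  assumes "\<Gamma> \<in> sets E" shows "(\<lambda>(t, x). q x t \<Gamma>) \<in> borel_measurable B"
proof -
  have "(\<lambda>(x, t). q x t \<Gamma>) \<in> borel_measurable (borel_on (S \<times> {0..}))"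
    using Q assms unfolding Q_function_def by blast
  then have "(\<lambda>(x, t). q x t \<Gamma>) \<in> borel_measurable (E \<Otimes>\<^sub>M T)"
    by (simp cong: measurable_cong_sets add: sets_borel_on_Times)
  then have "(\<lambda>(t, x). q x t \<Gamma>) \<in> borel_measurable (T \<Otimes>\<^sub>M E)"
    by measurable
  then show ?thesis
    by (simp cong: measurable_cong_sets add: sets_B)
qed

text \<open>Measurability of \<open>q\<close> is given for a fixed set, but
  \<open>\<Gamma> - {x}\<close> varies with \<open>x\<close>. Let \<open>J n x\<close> list which of
  the first \<open>n\<close> basis sets contain \<open>x\<close>, and remove their intersection from
  \<open>\<Gamma>\<close>. For each \<open>n\<close> only finitely many sets \<open>D j\<close>
  occur, each on a measurable set of states; none contains \<open>x\<close>, and they increase to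
  \<open>\<Gamma> - {x}\<close>.\<close>

lemma borel_measurable_emeasure_q_jump:
  assumes \<Gamma>: "\<Gamma> \<in> sets E"
  shows "(\<lambda>(t, x). emeasure (q_jump S q x t) \<Gamma>) \<in> borel_measurable B"
proof -
  obtain \<B> :: "'a set set" where \<B>: "countable \<B>" "topological_basis \<B>"
    using ex_countable_basis by blast
  have ne: "\<B> \<noteq> {}"
    using topological_basisE[OF \<B>(2) open_UNIV UNIV_I] by blast
  define U where "U = from_nat_into \<B>"
  define J where "J n x = {i\<in>{..<n}. x \<in> U i}" for n x
  define D where "D j = \<Gamma> - (\<Inter>i\<in>j. U i)" for j
  have open_U: "open (U i)" for i
    unfolding U_def using \<B>(2) from_nat_into[OF ne] by (auto simp: topological_basis_open)
  have D_sets: "D j \<in> sets E" if "finite j" for j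
  proof -
    have "(\<Inter>i\<in>j. U i) \<in> sets borel"
      using that open_U by (intro borel_open open_INT) auto
    then show ?thesis using \<Gamma> by (auto simp: sets_E D_def)
  qed
  have J_meas: "J n \<in> E \<rightarrow>\<^sub>M count_space (Pow {..<n})" for n
  proof (subst measurable_count_space_eq2, simp, intro conjI ballI)
    fix j assume "j \<in> Pow {..<n}"
    then have "J n x = j \<longleftrightarrow> (\<forall>i\<in>{..<n}. x \<in> U i \<longleftrightarrow> i \<in> j)" for x
      unfolding J_def by blast
    then have "J n -` {j} = (\<Inter>i\<in>{..<n}. {x. x \<in> U i \<longleftrightarrow> i \<in> j})"
      by blast
    moreover have "{x. x \<in> U i \<longleftrightarrow> i \<in> j} \<in> sets borel" for i
      using borel_open[OF open_U[of i]] by (cases "i \<in> j") (auto simp: Collect_neg_eq)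
    then have "(\<Inter>i\<in>{..<n}. {x. x \<in> U i \<longleftrightarrow> i \<in> j}) \<in> sets borel"
      by (intro sets.countable_INT'') auto
    ultimately show "J n -` {j} \<inter> space E \<in> sets E"
      using S by (simp add: sets_E space_restrict_space)
  qed (auto simp: J_def)
  have "(\<lambda>z. q (snd z) (fst z) (D (J n (snd z)))) \<in> borel_measurable B" for n
  proof (rule measurable_compose_countable'[where I="Pow {..<n}" and f="\<lambda>j z. q (snd z) (fst z) (D j)"])
    fix j :: "nat set" assume "j \<in> Pow {..<n}"
    then have "finite j" by (auto intro: finite_subset)
    then show "(\<lambda>z. q (snd z) (fst z) (D j)) \<in> borel_measurable B"
      using borel_measurable_q[OF D_sets, of j] by (simp add: split_beta')
  next
    have "snd \<in> B \<rightarrow>\<^sub>M E"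
      by (simp cong: measurable_cong_sets add: sets_B)
    then show "(\<lambda>z. J n (snd z)) \<in> B \<rightarrow>\<^sub>M count_space (Pow {..<n})"
      by (rule measurable_compose[OF _ J_meas])
  qed (simp add: countable_finite)
  then have meas: "(\<lambda>z. ennreal (q (snd z) (fst z) (D (J n (snd z))))) \<in> borel_measurable B" for n
    by measurable
  have eq: "emeasure (q_jump S q x t) \<Gamma> = (SUP n. ennreal (q x t (D (J n x))))" if x: "x \<in> S" and t: "0 \<le> t" for x t
  proof -
    have "D (J n x) - {x} = D (J n x)" for n
      by (auto simp: D_def J_def)
    then have 1: "ennreal (q x t (D (J n x))) = emeasure (q_jump S q x t) (D (J n x))" for n
      using emeasure_q_jump[OF x t D_sets, of "J n x"] by (simp add: J_def)
    have "(\<Union>n. D (J n x)) = \<Gamma> - {x}"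
    proof (intro equalityI subsetI)
      \<comment> \<open>T1 separation yields a basis set \<open>U i\<close> containing
        \<open>x\<close> but not \<open>y\<close>; its index enters at stage
        \<open>Suc i\<close>.\<close>
      fix y assume y: "y \<in> \<Gamma> - {x}"
      then obtain W where "open W" "x \<in> W" "y \<notin> W"
        using t1_space[of x y] by auto
      then obtain b where "b \<in> \<B>" "x \<in> b" "y \<notin> b"
        using topological_basisE[OF \<B>(2)] by blast
      then obtain i where "x \<in> U i" "y \<notin> U i"
        unfolding U_def using from_nat_into_surj[OF \<B>(1)] by metis
      then have "y \<in> D (J (Suc i) x)"
        using y by (auto simp: D_def J_def)
      then show "y \<in> (\<Union>n. D (J n x))" by blast
    qed (auto simp: D_def J_def)
    moreover have "incseq (\<lambda>n. D (J n x))"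
      by (force simp: incseq_def D_def J_def)
    ultimately have "(SUP n. emeasure (q_jump S q x t) (D (J n x))) = emeasure (q_jump S q x t) (\<Gamma> - {x})"
      using SUP_emeasure_incseq[of "\<lambda>n. D (J n x)" "q_jump S q x t"] D_sets
      by (simp add: sets_q_jump J_def image_subset_iff)
    moreover have "emeasure (q_jump S q x t) (\<Gamma> - {x}) = emeasure (q_jump S q x t) \<Gamma>"
      using emeasure_q_jump[OF x t] \<Gamma> Diff_sets_E by simp
    ultimately show ?thesis using 1 by simp
  qed
  have "(\<lambda>z. SUP n. ennreal (q (snd z) (fst z) (D (J n (snd z))))) \<in> borel_measurable B"
    using meas by (intro borel_measurable_SUP) auto
  then show ?thesis
    by (rule measurable_cong[THEN iffD1, rotated]) (auto simp: eq)
qed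

lemma emeasure_q_jump_space:
  assumes "x \<in> S" "0 \<le> s" shows "emeasure (q_jump S q x s) S = ennreal (q_rate q x s)"
  using emeasure_q_jump[OF assms] S by (simp add: sets_E q_rate_eq[OF assms])

text \<open>The singleton \<open>{x}\<close> moves with \<open>x\<close> as well, so the rate is
  read off as the total mass of the jump measure.\<close>

lemma borel_measurable_q_rate: "(\<lambda>(t, x). q_rate q x t) \<in> borel_measurable B"
proof -
  have "(\<lambda>z. enn2real (emeasure (q_jump S q (snd z) (fst z)) S)) \<in> borel_measurable B"
    using borel_measurable_emeasure_q_jump[of S] S
    by (intro borel_measurable_enn2real) (simp add: sets_E split_beta')
  then show ?thesis
    by (rule measurable_cong[THEN iffD1, rotated])
       (auto simp: emeasure_q_jump_space q_rate_nonneg)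
qed

text \<open>Dividing by one plus the rate turns the jump measures into a subprobability kernel.\<close>

lemma borel_measurable_nn_integral_q_jump:
  assumes f: "(\<lambda>(z, y). f z y) \<in> borel_measurable (B \<Otimes>\<^sub>M E)"
  shows "(\<lambda>(t, x). \<integral>\<^sup>+y. f (t, x) y \<partial>q_jump S q x t) \<in> borel_measurable B"
proof -
  define c where "c z = 1 + q_rate q (snd z) (fst z)" for z
  define L where "L z = scale_measure (ennreal (inverse (c z))) (q_jump S q (snd z) (fst z))" for z
  have c: "(\<lambda>z. ennreal (c z)) \<in> borel_measurable B" "(\<lambda>z. ennreal (inverse (c z))) \<in> borel_measurable B"
    using borel_measurable_q_rate unfolding c_def split_beta' by measurable
  have "L \<in> B \<rightarrow>\<^sub>M subprob_algebra E"
  proof (rule measurable_subprob_algebra)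
    fix z assume z: "z \<in> space B"
    then have "emeasure (L z) S = ennreal (inverse (c z) * q_rate q (snd z) (fst z))"
      using q_rate_nonneg[of "snd z" "fst z"]
      by (auto simp: L_def emeasure_q_jump_space ennreal_mult c_def)
    also have "\<dots> \<le> 1"
      using z q_rate_nonneg[of "snd z" "fst z"] by (auto simp: c_def field_simps)
    finally show "subprob_space (L z)"
      using z by (intro subprob_spaceI) (auto simp: L_def space_scale_measure)
  next
    fix \<Gamma> assume "\<Gamma> \<in> sets E"
    then show "(\<lambda>z. emeasure (L z) \<Gamma>) \<in> borel_measurable B"
      using c borel_measurable_emeasure_q_jump[of \<Gamma>] by (simp add: L_def split_beta')
  qed (simp add: L_def sets_q_jump)
  from nn_integral_measurable_subprob_algebra2[OF f this] c(1)
  have "(\<lambda>z. ennreal (c z) * (\<integral>\<^sup>+y. f z y \<partial>L z)) \<in> borel_measurable B"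
    by measurable
  then show ?thesis
  proof (rule measurable_cong[THEN iffD1, rotated])
    fix z assume z: "z \<in> space B"
    have "(\<lambda>y. f z y) \<in> borel_measurable E"
      using measurable_compose[OF measurable_Pair1'[OF z] f] by simp
    then have "(\<integral>\<^sup>+y. f z y \<partial>L z) = ennreal (inverse (c z)) * (\<integral>\<^sup>+y. f z y \<partial>q_jump S q (snd z) (fst z))"
      unfolding L_def by (intro nn_integral_scale_measure) (simp cong: measurable_cong_sets add: sets_q_jump)
    moreover have "ennreal (c z) * ennreal (inverse (c z)) = 1"
      using z q_rate_nonneg[of "snd z" "fst z"] 
      by (auto simp: c_def ennreal_mult[symmetric] simp del: ennreal_plus)
    ultimately show "ennreal (c z) * (\<integral>\<^sup>+y. f z y \<partial>L z) = (case z of (t, x) \<Rightarrow> \<integral>\<^sup>+y. f (t, x) y \<partial>q_jump S q x t)"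
      by (simp add: split_beta' mult.assoc[symmetric])
  qed
qed

lemma q_rate_bounded:
  assumes "x \<in> S"
  obtains C where "0 \<le> C" "\<And>s. 0 \<le> s \<Longrightarrow> q_rate q x s \<le> C"
proof -
  have "(SUP s\<in>{0..}. ereal (q x s (S - {x}))) < \<infinity>"
    using Q assms unfolding Q_function_def by blast
  then obtain C where C: "(SUP s\<in>{0..}. ereal (q x s (S - {x}))) < ereal C"
    using ereal_dense2 by blast
  have *: "q_rate q x s \<le> C" if "0 \<le> s" for s
  proof -
    have "ereal (q x s (S - {x})) \<le> (SUP s\<in>{0..}. ereal (q x s (S - {x})))"
      using that by (intro SUP_upper) auto
    from this C have "ereal (q x s (S - {x})) < ereal C" by (rule le_less_trans)
    then show ?thesis by (simp add: q_rate_eq[OF assms that])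
  qed
  show ?thesis
    by (rule that[of C]) (use * q_rate_nonneg[OF assms, of 0] in \<open>force+\<close>)
qed

end

section \<open>The total hazard\<close>

lemma set_integrable_bounded_Icc:
  fixes a :: "real \<Rightarrow> real"
  assumes "a \<in> borel_measurable borel" and "\<And>u. \<bar>a u\<bar> \<le> M"
  shows "set_integrable lborel {s..t} a"
proof -
  have "integrable lborel (\<lambda>u. indicator {s..t} u *\<^sub>R M)"
    by (intro integrable_scaleR_left integrable_real_indicator) (auto simp: emeasure_lborel_Icc_eq)
  then show ?thesis
    unfolding set_integrable_def
    by (rule Bochner_Integration.integrable_bound)
       (use assms in \<open>auto simp: indicator_def intro: order_trans[OF assms(2) abs_ge_self]\<close>)
qed

lemma set_integral_Icc_split:
  fixes a :: "real \<Rightarrow> real"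
  assumes "a \<in> borel_measurable borel" and "\<And>u. \<bar>a u\<bar> \<le> M" and "s \<le> t" "t \<le> r"
  shows "(LBINT u:{s..r}. a u) = (LBINT u:{s..t}. a u) + (LBINT u:{t..r}. a u)"
proof -
  have int: "set_integrable lborel {p..p'} a" for p p'
    by (rule set_integrable_bounded_Icc[OF assms(1,2)])
  have "(LBINT u:{s..t} \<union> {t..r}. a u) = (LBINT u:{s..t}. a u) + (LBINT u:{t..r}. a u)"
  proof (rule set_integral_Un_AE)
    show "AE x in lborel. \<not> (x \<in> {s..t} \<and> x \<in> {t..r})"
      using AE_lborel_singleton[of t] by eventually_elim auto
  qed (use int in auto)
  moreover have "{s..t} \<union> {t..r} = {s..r}" using assms by auto
  ultimately show ?thesis by simp
qed

lemma nn_integral_exp_neg_Ici: "(\<integral>\<^sup>+s\<in>{c..}. ennreal (exp (- s)) \<partial>lborel) = ennreal (exp (- c))"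
proof -
  have "(\<integral>\<^sup>+s. ennreal (exp (- s)) * indicator {c..} s \<partial>lborel) = ennreal (0 - (- exp (- c)))"
  proof (rule nn_integral_FTC_atLeast)
    show "((\<lambda>s::real. - exp (- s)) \<longlongrightarrow> 0) at_top"
      by real_asymp
  qed (auto intro!: derivative_eq_intros)
  then show ?thesis by simp
qed

text \<open>Layer cake: writing \<open>exp (- I t)\<close> as the integral of \<open>exp (- s)\<close> over \<open>s \<ge> I t\<close>
  avoids differentiating the indefinite integral \<open>I\<close> of a function that is merely measurable.\<close>

lemma nn_integral_hazard_le_1:
  fixes a :: "real \<Rightarrow> real"
  assumes meas [measurable]: "a \<in> borel_measurable borel" and nonneg: "\<And>u. 0 \<le> a u" and bound: "\<And>u. a u \<le> M"
  shows "(\<integral>\<^sup>+t\<in>{v..}. ennreal (a t * exp (- (LBINT u:{v..t}. a u))) \<partial>lborel) \<le> 1"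
proof -
  define I where "I t = (LBINT u:{v..t}. a u)" for t
  have abs: "\<bar>a u\<bar> \<le> M" for u using nonneg bound by simp
  have nn: "ennreal (LBINT u:{s..t}. a u) = (\<integral>\<^sup>+u\<in>{s..t}. ennreal (a u) \<partial>lborel)" for s t
    using set_integrable_bounded_Icc[OF meas abs, of s t] nonneg
    by (simp add: nn_integral_set_ennreal set_lebesgue_integral_def set_integrable_def mult.commute
        nn_integral_eq_integral[symmetric])
  have M: "0 \<le> M" using nonneg[of 0] bound[of 0] by linarith
  have increment: "0 \<le> (LBINT u:{s..t}. a u)" "(LBINT u:{s..t}. a u) \<le> M * (t - s)" if "s \<le> t" for s t
  proof -
    show "0 \<le> (LBINT u:{s..t}. a u)"
      unfolding set_lebesgue_integral_def using nonneg by (intro integral_nonneg_AE) auto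
    have "(LBINT u:{s..t}. a u) \<le> (LBINT u:{s..t}. M)"
      by (rule set_integral_mono[OF set_integrable_bounded_Icc[OF meas abs] set_integrable_bounded_Icc[of _ M]])
        (use M bound in auto)
    then show "(LBINT u:{s..t}. a u) \<le> M * (t - s)"
      using that by (simp add: set_lebesgue_integral_def mult.commute)
  qed
  have I_v: "I v = 0"
    using increment[of v v] by (simp add: I_def)
  \<comment> \<open>The bound \<open>M\<close> on the hazard makes \<open>I\<close>
    Lipschitz.\<close>
  have cont: "continuous_on {v..} I"
  proof (rule lipschitz_on_continuous_on[of M], rule lipschitz_onI)
    fix s t assume st: "s \<in> {v..}" "t \<in> {v..}"
    have *: "dist (I s) (I t) \<le> M * dist s t" if "s \<le> t" "v \<le> s" for s t
      using set_integral_Icc_split[OF meas abs that(2,1)] increment[OF that(1)] that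
      by (auto simp: I_def dist_real_def)
    show "dist (I s) (I t) \<le> M * dist s t"
      using *[of s t] *[of t s] st by (cases "s \<le> t") (auto simp: dist_commute)
  qed (fact M)
  have I_meas [measurable]: "I \<in> borel_measurable borel"
  proof -
    have "(\<lambda>t. \<integral>u. indicator {v..t} u *\<^sub>R a u \<partial>lborel) \<in> borel_measurable borel"
      by (intro lborel.borel_measurable_lebesgue_integral) (simp add: indicator_def measurable_split_conv)
    then show ?thesis by (simp add: I_def[abs_def] set_lebesgue_integral_def)
  qed
  \<comment> \<open>Inside the bounded window \<open>G n\<close> the sublevel set of the continuous
    \<open>I\<close> is compact and so has a greatest point \<open>m\<close>. The mass of
    \<open>a\<close> on it is at most the mass up to \<open>m\<close>, which is
    \<open>I m \<le> s\<close>; the windows then grow to the half-line.\<close>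
  have level: "(\<integral>\<^sup>+t. ennreal (a t) * indicator {t\<in>{v..}. I t \<le> s} t \<partial>lborel) \<le> ennreal s" if s: "0 \<le> s" for s
  proof -
    define G where "G n = {t\<in>{v..v + real n}. I t \<le> s}" for n
    have G_sets [measurable]: "G n \<in> sets borel" for n
      unfolding G_def by measurable
    have "(\<Union>n. G n) = {t\<in>{v..}. I t \<le> s}"
    proof (intro equalityI subsetI)
      fix t assume "t \<in> {t\<in>{v..}. I t \<le> s}"
      moreover obtain n where "t - v \<le> real n" using real_arch_simple by blast
      ultimately show "t \<in> (\<Union>n. G n)" by (auto simp: G_def intro!: exI[of _ n])
    qed (auto simp: G_def)
    then have "(\<integral>\<^sup>+t. ennreal (a t) * indicator {t\<in>{v..}. I t \<le> s} t \<partial>lborel) = emeasure (density lborel a) (\<Union>n. G n)"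
      by (simp add: emeasure_density)
    also have "\<dots> = (SUP n. emeasure (density lborel a) (G n))"
      by (intro SUP_emeasure_incseq[symmetric]) (auto simp: incseq_def G_def)
    also have "\<dots> \<le> ennreal s"
    proof (rule SUP_least)
      fix n
      have "closed ({v..v + real n} \<inter> I -` {..s})"
        by (intro continuous_closed_preimage continuous_on_subset[OF cont]) auto
      moreover have "G n = {v..v + real n} \<inter> I -` {..s}" by (auto simp: G_def)
      moreover have "bounded (G n)"
        by (rule bounded_subset[of "{v..v + real n}"]) (auto simp: G_def)
      ultimately have "compact (G n)" by (simp add: compact_eq_bounded_closed)
      moreover have "v \<in> G n" using I_v s by (auto simp: G_def)
      ultimately obtain m where m: "m \<in> G n" "\<And>t. t \<in> G n \<Longrightarrow> t \<le> m"
        using compact_attains_sup[of "G n"] by auto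
      have "emeasure (density lborel a) (G n) = (\<integral>\<^sup>+t\<in>G n. ennreal (a t) \<partial>lborel)"
        by (simp add: emeasure_density)
      also have "\<dots> \<le> (\<integral>\<^sup>+t\<in>{v..m}. ennreal (a t) \<partial>lborel)"
        using m(2) by (intro nn_integral_mono) (auto simp: indicator_def G_def)
      also have "\<dots> = ennreal (I m)"
        by (simp add: nn I_def)
      also have "\<dots> \<le> ennreal s"
        using m by (auto simp: G_def intro: ennreal_leI)
      finally show "emeasure (density lborel a) (G n) \<le> ennreal s" .
    qed
    finally show ?thesis .
  qed
  have "(\<integral>\<^sup>+t\<in>{v..}. ennreal (a t * exp (- I t)) \<partial>lborel)
      = (\<integral>\<^sup>+t. (\<integral>\<^sup>+s. ennreal (exp (- s)) * (ennreal (a t) * indicator {t\<in>{v..}. I t \<le> s} t) \<partial>lborel) \<partial>lborel)"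
  proof (rule nn_integral_cong)
    fix t :: real
    have "(\<integral>\<^sup>+s. ennreal (exp (- s)) * (ennreal (a t) * indicator {t\<in>{v..}. I t \<le> s} t) \<partial>lborel)
      = (\<integral>\<^sup>+s. ennreal (a t) * indicator {v..} t * (ennreal (exp (- s)) * indicator {I t..} s) \<partial>lborel)"
      by (intro nn_integral_cong) (auto simp: indicator_def mult_ac)
    also have "\<dots> = ennreal (a t) * indicator {v..} t * ennreal (exp (- I t))"
      by (subst nn_integral_cmult) (auto simp: nn_integral_exp_neg_Ici)
    finally show "ennreal (a t * exp (- I t)) * indicator {v..} t
      = (\<integral>\<^sup>+s. ennreal (exp (- s)) * (ennreal (a t) * indicator {t\<in>{v..}. I t \<le> s} t) \<partial>lborel)"
      using nonneg by (simp add: ennreal_mult mult_ac)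
  qed
  also have "\<dots> = (\<integral>\<^sup>+s. (\<integral>\<^sup>+t. ennreal (exp (- s)) * (ennreal (a t) * indicator {t\<in>{v..}. I t \<le> s} t) \<partial>lborel) \<partial>lborel)"
    by (intro lborel_pair.Fubini') (simp add: indicator_def measurable_split_conv)
  \<comment> \<open>By \<open>level\<close> the inner integral is at most
    \<open>s * exp (- s)\<close>, a Gamma integrand of total mass 1. Negative \<open>s\<close>
    contribute nothing because \<open>I\<close> is nonnegative.\<close>
  also have "\<dots> \<le> (\<integral>\<^sup>+s. ennreal (s ^ 1 * exp (- s)) * indicator {0..} s \<partial>lborel)"
  proof (rule nn_integral_mono)
    fix s :: real
    have *: "(\<integral>\<^sup>+t. ennreal (exp (- s)) * (ennreal (a t) * indicator {t\<in>{v..}. I t \<le> s} t) \<partial>lborel)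
        = ennreal (exp (- s)) * (\<integral>\<^sup>+t. ennreal (a t) * indicator {t\<in>{v..}. I t \<le> s} t \<partial>lborel)"
      by (intro nn_integral_cmult) measurable
    show "(\<integral>\<^sup>+t. ennreal (exp (- s)) * (ennreal (a t) * indicator {t\<in>{v..}. I t \<le> s} t) \<partial>lborel)
        \<le> ennreal (s ^ 1 * exp (- s)) * indicator {0..} s"
    proof (cases "0 \<le> s")
      case True
      then show ?thesis
        unfolding * using mult_left_mono[OF level[OF True], of "ennreal (exp (- s))"]
        by (simp add: ennreal_mult mult.commute)
    next
      case False
      then have "\<not> I t \<le> s" if "v \<le> t" for t
        using increment(1)[OF that] by (simp add: I_def)
      then have "{t\<in>{v..}. I t \<le> s} = {}" by auto
      then show ?thesis by simp
    qed
  qed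
  also have "\<dots> = 1"
    by (subst nn_intergal_power_times_exp_Ici) simp
  finally show ?thesis by (simp add: I_def)
qed

section \<open>The jump kernel\<close>

context Q_kernel
begin

lemma fst_B [measurable]: "fst \<in> B \<rightarrow>\<^sub>M borel" and snd_B [measurable]: "snd \<in> B \<rightarrow>\<^sub>M E"
  by (auto simp: sets_B cong: measurable_cong_sets
      intro: measurable_compose[OF measurable_fst measurable_restrict_space1[OF measurable_ident, unfolded id_def]])

lemma measurable_max_B [measurable (raw)]:
  assumes "f \<in> L \<rightarrow>\<^sub>M borel" "g \<in> L \<rightarrow>\<^sub>M E"
  shows "(\<lambda>z. (max 0 (f z), g z)) \<in> L \<rightarrow>\<^sub>M B"
proof -
  have "(\<lambda>z. max 0 (f z)) \<in> L \<rightarrow>\<^sub>M T"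
    using assms(1) by (intro measurable_restrict_space2) auto
  then have "(\<lambda>z. (max 0 (f z), g z)) \<in> L \<rightarrow>\<^sub>M T \<Otimes>\<^sub>M E"
    using assms(2) by (rule measurable_Pair)
  then show ?thesis
    by (simp add: sets_B cong: measurable_cong_sets)
qed

text \<open>Rates and jump measures are constrained at nonnegative times only; evaluating them at
  \<open>max 0 t\<close> makes them measurable in \<open>t\<close> on the whole line.\<close>

lemma borel_measurable_q_rate_max [measurable (raw)]:
  assumes [measurable]: "f \<in> L \<rightarrow>\<^sub>M borel" "g \<in> L \<rightarrow>\<^sub>M E"
  shows "(\<lambda>z. q_rate q (g z) (max 0 (f z))) \<in> borel_measurable L"
  using measurable_compose[OF measurable_max_B[OF assms] borel_measurable_q_rate] by simp

lemma borel_measurable_nn_integral_q_jump_max [measurable (raw)]: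
  assumes [measurable]: "f \<in> borel_measurable B" "g \<in> L \<rightarrow>\<^sub>M borel" "h \<in> L \<rightarrow>\<^sub>M E"
  shows "(\<lambda>z. \<integral>\<^sup>+y. f (max 0 (g z), y) \<partial>q_jump S q (h z) (max 0 (g z))) \<in> borel_measurable L"
proof -
  have "(\<lambda>(z, y). f (fst z, y)) \<in> borel_measurable (B \<Otimes>\<^sub>M E)"
  proof -
    have "(\<lambda>p. (fst (fst p), snd p)) \<in> B \<Otimes>\<^sub>M E \<rightarrow>\<^sub>M B"
      by (simp add: sets_B cong: measurable_cong_sets)
    then show ?thesis
      using measurable_compose[OF _ assms(1)] by (simp add: split_beta')
  qed
  from measurable_compose[OF measurable_max_B[OF assms(2,3)] borel_measurable_nn_integral_q_jump[OF this]]
  show ?thesis by simp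
qed

section \<open>Weighted jump measures and integration against them\<close>

lemma LBINT_q_rate_max:
  assumes "0 \<le> v" shows "(LBINT u:{v..t}. q_rate q x u) = (LBINT u:{v..t}. q_rate q x (max 0 u))"
  using assms by (intro set_lebesgue_integral_cong) auto

text \<open>For \<open>\<alpha> = 0\<close> this is the survival function of the holding time in
  state \<open>snd z\<close> entered at time \<open>fst z\<close>; a positive \<alpha> adds
  independent killing at rate \<alpha>. One formula thus serves both \<open>jump_kernel\<close> and
  \<open>p_alpha\<close>.\<close>

definition weight :: "real \<Rightarrow> real \<times> 'a \<Rightarrow> real \<Rightarrow> real" where
  "weight \<alpha> z t = exp (- (\<alpha> * (t - fst z) + (LBINT u:{fst z..t}. q_rate q (snd z) (max 0 u))))"

lemma weight_pos [simp]: "0 < weight \<alpha> z t"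
  by (simp add: weight_def)

lemma borel_measurable_weight [measurable (raw)]:
  assumes [measurable]: "f \<in> L \<rightarrow>\<^sub>M B" "g \<in> L \<rightarrow>\<^sub>M borel"
  shows "(\<lambda>p. weight \<alpha> (f p) (g p)) \<in> borel_measurable L"
proof -
  have "(\<lambda>p. \<integral>u. indicator {fst (f p)..g p} u *\<^sub>R q_rate q (snd (f p)) (max 0 u) \<partial>lborel) \<in> borel_measurable L"
    by (intro lborel.borel_measurable_lebesgue_integral)
       (simp add: indicator_def measurable_split_conv)
  then show ?thesis
    by (simp add: weight_def set_lebesgue_integral_def)
qed

text \<open>The cemetery part of the kernels is left out: the functions integrated below count as
  zero there.\<close>

definition jump :: "real \<Rightarrow> real \<times> 'a \<Rightarrow> (real \<times> 'a) measure" where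
  "jump \<alpha> z = jump_measure S q (snd z) (weight \<alpha> z) (fst z)"

lemma sets_jump_measure: "sets (jump_measure S q x w v) = sets B"
  using sets.sets_measure_of_eq[of B] by (simp add: jump_measure_def)

lemma section_sets: "A \<in> sets B \<Longrightarrow> 0 \<le> t \<Longrightarrow> {y \<in> S. (t, y) \<in> A} \<in> sets E"
proof -
  assume "A \<in> sets B" "0 \<le> t"
  then have "Pair t -` A \<in> sets E"
    using sets_Pair1 by (auto simp: sets_B)
  moreover have "Pair t -` A = {y \<in> S. (t, y) \<in> A}"
    using sets.sets_into_space[OF \<open>A \<in> sets B\<close>] by auto
  ultimately show ?thesis by simp
qed

lemma nn_integral_indicator_q_jump:
  "A \<in> sets B \<Longrightarrow> 0 \<le> t \<Longrightarrow> (\<integral>\<^sup>+y. indicator A (t, y) \<partial>q_jump S q x t) = emeasure (q_jump S q x t) {y \<in> S. (t, y) \<in> A}"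
proof -
  assume "A \<in> sets B" "0 \<le> t"
  have "(\<integral>\<^sup>+y. indicator A (t, y) \<partial>q_jump S q x t) = (\<integral>\<^sup>+y. indicator {y \<in> S. (t, y) \<in> A} y \<partial>q_jump S q x t)"
    by (intro nn_integral_cong) (auto simp: indicator_def)
  then show ?thesis
    using section_sets[OF \<open>A \<in> sets B\<close> \<open>0 \<le> t\<close>] by (simp add: sets_q_jump)
qed

context
  fixes x :: 'a and v :: real and w :: "real \<Rightarrow> real"
  assumes x: "x \<in> S" and v: "0 \<le> v" and w [measurable]: "w \<in> borel_measurable borel"
begin

lemma measurable_const_state [measurable]: "(\<lambda>_. x) \<in> L \<rightarrow>\<^sub>M E"
  using x by (simp add: space_restrict_space)

lemma jump_integrand_max:
  "(\<integral>\<^sup>+t\<in>{v<..}. ennreal (w t) * (\<integral>\<^sup>+y. f (t, y) \<partial>q_jump S q x t) \<partial>lborel) =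
   (\<integral>\<^sup>+t\<in>{v<..}. ennreal (w t) * (\<integral>\<^sup>+y. f (max 0 t, y) \<partial>q_jump S q x (max 0 t)) \<partial>lborel)"
  using v by (intro nn_integral_cong) (auto simp: indicator_def)

text \<open>As before \<open>measure_of\<close> demands countable additivity; the sum passes through
  the time integral and then through the inner one. Writing the mass of a section as an inner
  integral of the indicator makes it measurable in \<open>t\<close>.\<close>

lemma emeasure_jump_measure:
  assumes A: "A \<in> sets B"
  shows "emeasure (jump_measure S q x w v) A =
    (\<integral>\<^sup>+t\<in>{v<..}. ennreal (w t) * (\<integral>\<^sup>+y. indicator A (t, y) \<partial>q_jump S q x t) \<partial>lborel)"
proof -
  let ?\<mu> = "\<lambda>A. \<integral>\<^sup>+t\<in>{v<..}. ennreal (w t) * emeasure (q_jump S q x t) {y \<in> S. (t, y) \<in> A} \<partial>lborel"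
  have eq: "?\<mu> A = (\<integral>\<^sup>+t\<in>{v<..}. ennreal (w t) * (\<integral>\<^sup>+y. indicator A (t, y) \<partial>q_jump S q x t) \<partial>lborel)" if "A \<in> sets B" for A
    using v that by (intro nn_integral_cong) (auto simp: indicator_def nn_integral_indicator_q_jump[unfolded indicator_def])
  have "countably_additive (sets B) ?\<mu>"
  proof (rule countably_additiveI)
    fix A :: "nat \<Rightarrow> (real \<times> 'a) set" assume A: "range A \<subseteq> sets B" and disj: "disjoint_family A" and UN: "(\<Union>i. A i) \<in> sets B"
    then have [measurable]: "A i \<in> sets B" for i by auto
    have "(\<Sum>i. ?\<mu> (A i)) = (\<Sum>i. \<integral>\<^sup>+t\<in>{v<..}. ennreal (w t) * (\<integral>\<^sup>+y. indicator (A i) (max 0 t, y) \<partial>q_jump S q x (max 0 t)) \<partial>lborel)"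
      by (simp add: eq jump_integrand_max)
    also have "\<dots> = (\<integral>\<^sup>+t. (\<Sum>i. ennreal (w t) * (\<integral>\<^sup>+y. indicator (A i) (max 0 t, y) \<partial>q_jump S q x (max 0 t)) * indicator {v<..} t) \<partial>lborel)"
      by (intro nn_integral_suminf[symmetric]) measurable
    also have "\<dots> = ?\<mu> (\<Union>i. A i)"
    proof (intro nn_integral_cong)
      fix t :: real
      have 1: "(\<lambda>y. indicator (A i) (t, y) :: ennreal) \<in> borel_measurable (q_jump S q x t)" if "0 \<le> t" for i
      proof -
        have "(\<lambda>y. (max 0 t, y)) \<in> E \<rightarrow>\<^sub>M B" by measurable
        then have "(\<lambda>y. indicator (A i) (max 0 t, y) :: ennreal) \<in> borel_measurable E"
          by (rule measurable_compose) measurable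
        with that show ?thesis by (simp cong: measurable_cong_sets add: sets_q_jump)
      qed
      have "(\<Sum>i. \<integral>\<^sup>+y. indicator (A i) (t, y) \<partial>q_jump S q x t) = (\<integral>\<^sup>+y. indicator (\<Union>i. A i) (t, y) \<partial>q_jump S q x t)" if "0 \<le> t"
        using 1[OF that] suminf_indicator[OF disj]
        by (subst nn_integral_suminf[symmetric]) auto
      then show "(\<Sum>i. ennreal (w t) * (\<integral>\<^sup>+y. indicator (A i) (max 0 t, y) \<partial>q_jump S q x (max 0 t)) * indicator {v<..} t)
         = ennreal (w t) * emeasure (q_jump S q x t) {y \<in> S. (t, y) \<in> (\<Union>i. A i)} * indicator {v<..} t"
        using v nn_integral_indicator_q_jump[OF UN, of t x]
        by (auto simp: indicator_def[of "{v<..}"])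
    qed
    finally show "(\<Sum>i. ?\<mu> (A i)) = ?\<mu> (\<Union>i. A i)" .
  qed
  moreover have "positive (sets B) ?\<mu>"
    by (simp add: positive_def)
  ultimately have "emeasure (jump_measure S q x w v) A = ?\<mu> A"
    using A sets.sets_into_space[of _ B]
    by (intro emeasure_measure_of[OF jump_measure_def]) (auto simp: sets_jump_measure)
  then show ?thesis using eq[OF A] by simp
qed

text \<open>Induction on \<open>f\<close>, moving constants, sums and suprema through both
  integrals. Measurability of the inner integral in \<open>t\<close> is available on the whole line
  only after the rewriting by \<open>jump_integrand_max\<close>.\<close>

lemma nn_integral_jump_measure:
  assumes "f \<in> borel_measurable B"
  shows "(\<integral>\<^sup>+z. f z \<partial>jump_measure S q x w v) =
    (\<integral>\<^sup>+t\<in>{v<..}. ennreal (w t) * (\<integral>\<^sup>+y. f (t, y) \<partial>q_jump S q x t) \<partial>lborel)"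
  using assms
proof (induction rule: borel_measurable_induct)
  case (cong f g)
  have sp: "space (jump_measure S q x w v) = space B"
    by (rule sets_eq_imp_space_eq[OF sets_jump_measure])
  have "(\<integral>\<^sup>+z. f z \<partial>jump_measure S q x w v) = (\<integral>\<^sup>+z. g z \<partial>jump_measure S q x w v)"
    by (intro nn_integral_cong cong) (simp add: sp)
  moreover have "(\<integral>\<^sup>+t\<in>{v<..}. ennreal (w t) * (\<integral>\<^sup>+y. f (t, y) \<partial>q_jump S q x t) \<partial>lborel)
    = (\<integral>\<^sup>+t\<in>{v<..}. ennreal (w t) * (\<integral>\<^sup>+y. g (t, y) \<partial>q_jump S q x t) \<partial>lborel)"
  proof (rule nn_integral_cong)
    fix t :: real
    have "(\<integral>\<^sup>+y. f (t, y) \<partial>q_jump S q x t) = (\<integral>\<^sup>+y. g (t, y) \<partial>q_jump S q x t)" if "v < t"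
      using that v by (intro nn_integral_cong cong) auto
    then show "ennreal (w t) * (\<integral>\<^sup>+y. f (t, y) \<partial>q_jump S q x t) * indicator {v<..} t
      = ennreal (w t) * (\<integral>\<^sup>+y. g (t, y) \<partial>q_jump S q x t) * indicator {v<..} t"
      by (auto simp: indicator_def)
  qed
  ultimately show ?case using cong by simp
next
  case (set A)
  then show ?case
    using emeasure_jump_measure[of A] by (simp add: sets_jump_measure)
next
  case (mult u a)
  have [measurable]: "u \<in> borel_measurable B" by fact
  have u: "(\<lambda>y. u (t, y)) \<in> borel_measurable (q_jump S q x t)" if "0 \<le> t" for t
  proof -
    have "(\<lambda>y. u (max 0 t, y)) \<in> borel_measurable E" by measurable
    with that show ?thesis by (simp cong: measurable_cong_sets add: sets_q_jump)
  qed
  have "(\<integral>\<^sup>+z. a * u z \<partial>jump_measure S q x w v) = a * (\<integral>\<^sup>+z. u z \<partial>jump_measure S q x w v)"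
    using mult by (intro nn_integral_cmult) (simp cong: measurable_cong_sets add: sets_jump_measure)
  also have "\<dots> = (\<integral>\<^sup>+t. a * (ennreal (w t) * (\<integral>\<^sup>+y. u (max 0 t, y) \<partial>q_jump S q x (max 0 t)) * indicator {v<..} t) \<partial>lborel)"
    unfolding mult.IH jump_integrand_max by (intro nn_integral_cmult[symmetric]) measurable
  also have "\<dots> = (\<integral>\<^sup>+t\<in>{v<..}. ennreal (w t) * (\<integral>\<^sup>+y. a * u (t, y) \<partial>q_jump S q x t) \<partial>lborel)"
    using v by (intro nn_integral_cong) (auto simp: indicator_def nn_integral_cmult u mult_ac)
  finally show ?case .
next
  case (add u u')
  have [measurable]: "u \<in> borel_measurable B" "u' \<in> borel_measurable B" by fact+
  have u: "(\<lambda>y. u (t, y)) \<in> borel_measurable (q_jump S q x t)" "(\<lambda>y. u' (t, y)) \<in> borel_measurable (q_jump S q x t)" if "0 \<le> t" for t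
  proof -
    have "(\<lambda>y. u (max 0 t, y)) \<in> borel_measurable E" "(\<lambda>y. u' (max 0 t, y)) \<in> borel_measurable E" by measurable
    with that show "(\<lambda>y. u (t, y)) \<in> borel_measurable (q_jump S q x t)" "(\<lambda>y. u' (t, y)) \<in> borel_measurable (q_jump S q x t)"
      by (simp_all cong: measurable_cong_sets add: sets_q_jump)
  qed
  have "(\<integral>\<^sup>+z. u' z + u z \<partial>jump_measure S q x w v) = (\<integral>\<^sup>+z. u' z \<partial>jump_measure S q x w v) + (\<integral>\<^sup>+z. u z \<partial>jump_measure S q x w v)"
    using add by (intro nn_integral_add) (simp_all cong: measurable_cong_sets add: sets_jump_measure)
  also have "\<dots> = (\<integral>\<^sup>+t. ennreal (w t) * (\<integral>\<^sup>+y. u' (max 0 t, y) \<partial>q_jump S q x (max 0 t)) * indicator {v<..} t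
      + ennreal (w t) * (\<integral>\<^sup>+y. u (max 0 t, y) \<partial>q_jump S q x (max 0 t)) * indicator {v<..} t \<partial>lborel)"
    unfolding add.IH jump_integrand_max by (intro nn_integral_add[symmetric]) measurable
  also have "\<dots> = (\<integral>\<^sup>+t\<in>{v<..}. ennreal (w t) * (\<integral>\<^sup>+y. u' (t, y) + u (t, y) \<partial>q_jump S q x t) \<partial>lborel)"
    using v by (intro nn_integral_cong) (auto simp: indicator_def nn_integral_add u distrib_left)
  finally show ?case .
next
  case (seq U)
  have [measurable]: "U i \<in> borel_measurable B" for i by fact
  have u: "(\<lambda>y. U i (t, y)) \<in> borel_measurable (q_jump S q x t)" if "0 \<le> t" for i t
  proof -
    have "(\<lambda>y. U i (max 0 t, y)) \<in> borel_measurable E" by measurable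
    with that show ?thesis by (simp cong: measurable_cong_sets add: sets_q_jump)
  qed
  have inc: "incseq (\<lambda>i y. U i (t, y))" for t
    using \<open>incseq U\<close> by (auto simp: incseq_def le_fun_def)
  have "(\<integral>\<^sup>+z. (SUP i. U i) z \<partial>jump_measure S q x w v) = (SUP i. \<integral>\<^sup>+z. U i z \<partial>jump_measure S q x w v)"
    using nn_integral_monotone_convergence_SUP[OF \<open>incseq U\<close>, of "jump_measure S q x w v"]
    by (simp cong: measurable_cong_sets add: sets_jump_measure image_comp)
  also have "\<dots> = (\<integral>\<^sup>+t. (SUP i. ennreal (w t) * (\<integral>\<^sup>+y. U i (max 0 t, y) \<partial>q_jump S q x (max 0 t)) * indicator {v<..} t) \<partial>lborel)"
    unfolding seq.IH jump_integrand_max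
    by (intro nn_integral_monotone_convergence_SUP[symmetric])
       (auto simp: incseq_def le_fun_def intro!: mult_right_mono mult_left_mono nn_integral_mono incseqD[OF inc, THEN le_funD])
  also have "\<dots> = (\<integral>\<^sup>+t\<in>{v<..}. ennreal (w t) * (\<integral>\<^sup>+y. (SUP i. U i) (t, y) \<partial>q_jump S q x t) \<partial>lborel)"
  proof (rule nn_integral_cong)
    fix t :: real
    have "(\<integral>\<^sup>+y. (SUP i. U i) (t, y) \<partial>q_jump S q x t) = (SUP i. \<integral>\<^sup>+y. U i (t, y) \<partial>q_jump S q x t)" if "v < t"
      using u inc[of t] v that
      by (simp add: image_comp nn_integral_monotone_convergence_SUP)
    then show "(SUP i. ennreal (w t) * (\<integral>\<^sup>+y. U i (max 0 t, y) \<partial>q_jump S q x (max 0 t)) * indicator {v<..} t)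
      = ennreal (w t) * (\<integral>\<^sup>+y. (SUP i. U i) (t, y) \<partial>q_jump S q x t) * indicator {v<..} t"
      using v by (auto simp: indicator_def SUP_mult_left_ennreal)
  qed
  finally show ?case .
qed

end

end

text \<open>Serves to identify the weight of \<open>p_alpha\<close> with
  \<open>weight \<alpha>\<close>: before \<open>v\<close> the former is constantly 1, since its
  interval of integration is empty, and the two need not agree there.\<close>

lemma jump_measure_cong:
  "(\<And>t. v < t \<Longrightarrow> w t = w' t) \<Longrightarrow> jump_measure S q x w v = jump_measure S q x w' v"
  unfolding jump_measure_def
  by (intro arg_cong[where f="measure_of _ _"] ext nn_integral_cong) (simp add: indicator_def)

context Q_kernel
begin

section \<open>Mass bounds, measurability and discounting for the jump kernel\<close>

lemma sets_jump [measurable_cong]: "sets (jump \<alpha> z) = sets B"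
  by (simp add: jump_def sets_jump_measure)

lemma space_jump [simp]: "space (jump \<alpha> z) = {0..} \<times> S"
  using sets_eq_imp_space_eq[OF sets_jump] by simp

lemma weight_nonneg [simp]: "0 \<le> weight \<alpha> z t"
  by (simp add: weight_def)

lemma borel_measurable_weight_time:
  "z \<in> {0..} \<times> S \<Longrightarrow> weight \<alpha> z \<in> borel_measurable borel"
  by (rule borel_measurable_weight[where f="\<lambda>_. z" and g="\<lambda>t. t"]) (auto simp: measurable_ident_sets)

lemma q_rate_max_bounds:
  assumes "x \<in> S"
  obtains C where "0 \<le> C" "\<And>s. \<bar>q_rate q x (max 0 s)\<bar> \<le> C"
proof -
  obtain C where "0 \<le> C" "\<And>s. 0 \<le> s \<Longrightarrow> q_rate q x s \<le> C"
    using q_rate_bounded[OF assms] by blast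
  then show ?thesis
    using that[of C] q_rate_nonneg[OF assms] by auto
qed

lemma borel_measurable_q_rate_max_time: "x \<in> S \<Longrightarrow> (\<lambda>u. q_rate q x (max 0 u)) \<in> borel_measurable borel"
  by (intro borel_measurable_q_rate_max) (auto simp: space_restrict_space)

lemma LBINT_const_add_q_rate:
  assumes x: "x \<in> S" and st: "s \<le> t"
  shows "(LBINT u:{s..t}. \<alpha> + q_rate q x (max 0 u)) = \<alpha> * (t - s) + (LBINT u:{s..t}. q_rate q x (max 0 u))"
proof -
  obtain C where C: "0 \<le> C" "\<And>s. \<bar>q_rate q x (max 0 s)\<bar> \<le> C"
    using q_rate_max_bounds[OF x] by blast
  have "(LBINT u:{s..t}. \<alpha> + q_rate q x (max 0 u)) = (LBINT u:{s..t}. \<alpha>) + (LBINT u:{s..t}. q_rate q x (max 0 u))"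
    by (intro set_integral_add(2) set_integrable_bounded_Icc[OF borel_measurable_q_rate_max_time[OF x] C(2)]
        set_integrable_bounded_Icc[where M="\<bar>\<alpha>\<bar>"]) auto
  moreover have "(LBINT u:{s..t}. \<alpha>) = \<alpha> * (t - s)"
    using st by (simp add: set_lebesgue_integral_def mult.commute)
  ultimately show ?thesis by simp
qed

lemma nn_integral_jump:
  assumes z: "z \<in> {0..} \<times> S" and f: "f \<in> borel_measurable B"
  shows "(\<integral>\<^sup>+y. f y \<partial>jump \<alpha> z) =
    (\<integral>\<^sup>+t\<in>{fst z<..}. ennreal (weight \<alpha> z t) * (\<integral>\<^sup>+y. f (t, y) \<partial>q_jump S q (snd z) t) \<partial>lborel)"
  unfolding jump_def using z f borel_measurable_weight_time[OF z]
  by (intro nn_integral_jump_measure) auto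

lemma nn_integral_jump_max:
  assumes z: "z \<in> {0..} \<times> S" and f: "f \<in> borel_measurable B"
  shows "(\<integral>\<^sup>+y. f y \<partial>jump \<alpha> z) =
    (\<integral>\<^sup>+t\<in>{fst z<..}. ennreal (weight \<alpha> z t) * (\<integral>\<^sup>+y. f (max 0 t, y) \<partial>q_jump S q (snd z) (max 0 t)) \<partial>lborel)"
  unfolding nn_integral_jump[OF assms]
  using z by (intro nn_integral_cong) (auto simp: indicator_def)

text \<open>From time \<open>fst z\<close> on, \<open>weight \<alpha> z\<close> is the survival
  function for the hazard \<open>\<alpha> + q\<close>, so the integrand is the density of the
  earlier of killing and jump.\<close>

lemma nn_integral_total_rate_le_1:
  assumes \<alpha>: "0 \<le> \<alpha>" and z: "z \<in> {0..} \<times> S"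
  shows "(\<integral>\<^sup>+t\<in>{fst z..}. ennreal ((\<alpha> + q_rate q (snd z) (max 0 t)) * weight \<alpha> z t) \<partial>lborel) \<le> 1"
proof -
  have x: "snd z \<in> S" using z by auto
  obtain C where C: "0 \<le> C" "\<And>s. \<bar>q_rate q (snd z) (max 0 s)\<bar> \<le> C"
    using q_rate_max_bounds[OF x] by blast
  define a where "a u = \<alpha> + q_rate q (snd z) (max 0 u)" for u
  have "weight \<alpha> z t = exp (- (LBINT u:{fst z..t}. a u))" if "fst z \<le> t" for t
    by (simp add: weight_def a_def LBINT_const_add_q_rate[OF x that])
  then have "(\<integral>\<^sup>+t\<in>{fst z..}. ennreal ((\<alpha> + q_rate q (snd z) (max 0 t)) * weight \<alpha> z t) \<partial>lborel)
    = (\<integral>\<^sup>+t\<in>{fst z..}. ennreal (a t * exp (- (LBINT u:{fst z..t}. a u))) \<partial>lborel)"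
    by (intro nn_integral_cong) (auto simp: a_def indicator_def)
  also have "\<dots> \<le> 1"
  proof (rule nn_integral_hazard_le_1)
    show "a \<in> borel_measurable borel"
      unfolding a_def using borel_measurable_q_rate_max_time[OF x] by measurable
    show "0 \<le> a u" for u
      unfolding a_def using \<alpha> q_rate_nonneg[OF x, of "max 0 u"] by simp
    show "a u \<le> \<alpha> + C" for u
      unfolding a_def using C(2)[of u] by simp
  qed
  finally show ?thesis .
qed

lemma emeasure_jump_space:
  assumes z: "z \<in> {0..} \<times> S"
  shows "emeasure (jump \<alpha> z) ({0..} \<times> S) = (\<integral>\<^sup>+t\<in>{fst z<..}. ennreal (q_rate q (snd z) (max 0 t) * weight \<alpha> z t) \<partial>lborel)"
proof -
  have "emeasure (jump \<alpha> z) ({0..} \<times> S) = (\<integral>\<^sup>+y. 1 \<partial>jump \<alpha> z)"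
    by simp
  also have "\<dots> = (\<integral>\<^sup>+t\<in>{fst z<..}. ennreal (q_rate q (snd z) (max 0 t) * weight \<alpha> z t) \<partial>lborel)"
    unfolding nn_integral_jump_max[OF z borel_measurable_const]
    using z q_rate_nonneg[of "snd z"]
    by (intro nn_integral_cong) (auto simp: emeasure_q_jump_space ennreal_mult' mult.commute)
  finally show ?thesis .
qed

lemma emeasure_jump_le_1:
  assumes "0 \<le> \<alpha>" "z \<in> {0..} \<times> S"
  shows "emeasure (jump \<alpha> z) ({0..} \<times> S) \<le> 1"
  unfolding emeasure_jump_space[OF assms(2)]
  using assms(1)
  by (intro order_trans[OF _ nn_integral_total_rate_le_1[OF assms]] nn_integral_mono)
     (auto simp: indicator_def intro!: ennreal_leI mult_right_mono)

text \<open>Since \<open>r / (\<alpha> + r)\<close> increases in \<open>r\<close>, at every instant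
  jumps make up at most the share \<open>k / (k + \<alpha>)\<close> of the total hazard. As \<alpha>
  is positive, this share is below 1, the contraction needed where rates are bounded.\<close>

lemma emeasure_jump_le_ratio:
  assumes \<alpha>: "0 < \<alpha>" and z: "z \<in> {0..} \<times> S" and k: "0 \<le> k" "\<And>t. 0 \<le> t \<Longrightarrow> q_rate q (snd z) t \<le> k"
  shows "emeasure (jump \<alpha> z) ({0..} \<times> S) \<le> ennreal (k / (k + \<alpha>))"
proof -
  have le: "r \<le> k / (k + \<alpha>) * (\<alpha> + r)" if "r \<le> k" for r
  proof -
    have "\<alpha> * r \<le> \<alpha> * k" using that \<alpha> by (intro mult_left_mono) auto
    then show ?thesis using \<alpha> k by (simp add: field_simps)
  qed
  have x: "snd z \<in> S" using z by auto
  then have [measurable]: "(\<lambda>_. snd z) \<in> borel \<rightarrow>\<^sub>M E"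
    by (simp add: space_restrict_space)
  have [measurable]: "weight \<alpha> z \<in> borel_measurable borel"
    by (rule borel_measurable_weight_time[OF z])
  have "emeasure (jump \<alpha> z) ({0..} \<times> S) \<le>
    (\<integral>\<^sup>+t. ennreal (k / (k + \<alpha>)) * (ennreal ((\<alpha> + q_rate q (snd z) (max 0 t)) * weight \<alpha> z t) * indicator {fst z..} t) \<partial>lborel)"
    unfolding emeasure_jump_space[OF z]
  proof (intro nn_integral_mono)
    fix t :: real
    have "q_rate q (snd z) (max 0 t) * weight \<alpha> z t \<le> k / (k + \<alpha>) * ((\<alpha> + q_rate q (snd z) (max 0 t)) * weight \<alpha> z t)"
      using mult_right_mono[OF le[OF k(2)[of "max 0 t"]], of "weight \<alpha> z t"]
      by (simp add: less_imp_le mult.assoc)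
    moreover have "0 \<le> (\<alpha> + q_rate q (snd z) (max 0 t)) * weight \<alpha> z t"
      using \<alpha> q_rate_nonneg[OF x, of "max 0 t"] by (simp add: less_imp_le)
    ultimately show "ennreal (q_rate q (snd z) (max 0 t) * weight \<alpha> z t) * indicator {fst z<..} t
      \<le> ennreal (k / (k + \<alpha>)) * (ennreal ((\<alpha> + q_rate q (snd z) (max 0 t)) * weight \<alpha> z t) * indicator {fst z..} t)"
      using \<alpha> k by (auto simp: indicator_def ennreal_mult[symmetric] intro!: ennreal_leI)
  qed
  also have "\<dots> = ennreal (k / (k + \<alpha>)) * (\<integral>\<^sup>+t\<in>{fst z..}. ennreal ((\<alpha> + q_rate q (snd z) (max 0 t)) * weight \<alpha> z t) \<partial>lborel)"
    by (intro nn_integral_cmult) measurable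
  also have "\<dots> \<le> ennreal (k / (k + \<alpha>)) * 1"
    using \<alpha> by (intro mult_left_mono nn_integral_total_rate_le_1 z) auto
  finally show ?thesis by simp
qed

lemma measurable_jump [measurable]:
  assumes \<alpha>: "0 \<le> \<alpha>" shows "jump \<alpha> \<in> B \<rightarrow>\<^sub>M subprob_algebra B"
proof (rule measurable_subprob_algebra)
  fix z assume "z \<in> space B"
  then show "subprob_space (jump \<alpha> z)"
    using emeasure_jump_le_1[OF \<alpha>, of z] by (intro subprob_spaceI) auto
next
  fix A assume [measurable]: "A \<in> sets B"
  \<comment> \<open>The indicator of the moving half-line \<open>{fst z<..}\<close> is written as a
    conditional, which is jointly measurable in \<open>z\<close> and \<open>t\<close>.\<close>
  have "(\<lambda>z. \<integral>\<^sup>+t. ennreal (weight \<alpha> z t) * (\<integral>\<^sup>+y. indicator A (max 0 t, y) \<partial>q_jump S q (snd z) (max 0 t)) * (if fst z < t then 1 else 0) \<partial>lborel) \<in> borel_measurable B"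
    by measurable
  then show "(\<lambda>z. emeasure (jump \<alpha> z) A) \<in> borel_measurable B"
  proof (rule measurable_cong[THEN iffD1, rotated])
    fix z assume "z \<in> space B"
    then have z: "z \<in> {0..} \<times> S" by simp
    have "(\<integral>\<^sup>+y. indicator A y \<partial>jump \<alpha> z) = emeasure (jump \<alpha> z) A"
      by (simp add: sets_jump)
    then have "emeasure (jump \<alpha> z) A = (\<integral>\<^sup>+y. indicator A y \<partial>jump \<alpha> z)"
      by (rule sym)
    also have "\<dots> = (\<integral>\<^sup>+t. ennreal (weight \<alpha> z t) * (\<integral>\<^sup>+y. indicator A (max 0 t, y) \<partial>q_jump S q (snd z) (max 0 t)) * (if fst z < t then 1 else 0) \<partial>lborel)"
      unfolding nn_integral_jump_max[OF z borel_measurable_indicator[OF \<open>A \<in> sets B\<close>]]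
      by (intro nn_integral_cong) (simp add: indicator_def[of "{fst z<..}"])
    finally show "(\<integral>\<^sup>+t. ennreal (weight \<alpha> z t) * (\<integral>\<^sup>+y. indicator A (max 0 t, y) \<partial>q_jump S q (snd z) (max 0 t)) * (if fst z < t then 1 else 0) \<partial>lborel) = emeasure (jump \<alpha> z) A"
      by (rule sym)
  qed
qed (rule sets_jump)

lemma borel_measurable_nn_integral_jump:
  assumes "0 \<le> \<alpha>" "f \<in> borel_measurable B"
  shows "(\<lambda>z. \<integral>\<^sup>+y. f y \<partial>jump \<alpha> z) \<in> borel_measurable B"
  by (rule measurable_compose[OF measurable_jump[OF assms(1)] nn_integral_measurable_subprob_algebra[OF assms(2)]])

text \<open>The absolute discount at \<open>t\<close> factors into the discount at
  \<open>fst z\<close> and the one for the elapsed time, which \<open>weight \<alpha>\<close>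
  already contains. Hence the undiscounted chain produces powers of
  \<open>step \<alpha>\<close>.\<close>

lemma nn_integral_jump_discount:
  assumes z: "z \<in> {0..} \<times> S" and f [measurable]: "f \<in> borel_measurable B"
  shows "(\<integral>\<^sup>+y. ennreal (exp (- \<alpha> * fst y)) * f y \<partial>jump 0 z) = ennreal (exp (- \<alpha> * fst z)) * (\<integral>\<^sup>+y. f y \<partial>jump \<alpha> z)"
proof -
  have x: "(\<lambda>_. snd z) \<in> borel \<rightarrow>\<^sub>M E" using z by (auto simp: space_restrict_space)
  note [measurable] = x
  have [measurable]: "weight \<alpha> z \<in> borel_measurable borel"
    by (rule borel_measurable_weight_time[OF z])
  have "(\<integral>\<^sup>+y. ennreal (exp (- \<alpha> * fst y)) * f y \<partial>jump 0 z)
    = (\<integral>\<^sup>+t. ennreal (weight 0 z t) * (\<integral>\<^sup>+y. ennreal (exp (- \<alpha> * max 0 t)) * f (max 0 t, y) \<partial>q_jump S q (snd z) (max 0 t)) * indicator {fst z<..} t \<partial>lborel)"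
    by (subst nn_integral_jump_max[OF z]) simp_all
  also have "\<dots> = (\<integral>\<^sup>+t. ennreal (exp (- \<alpha> * fst z)) * (ennreal (weight \<alpha> z t) * (\<integral>\<^sup>+y. f (max 0 t, y) \<partial>q_jump S q (snd z) (max 0 t)) * indicator {fst z<..} t) \<partial>lborel)"
  proof (intro nn_integral_cong)
    fix t :: real
    have "weight 0 z t * exp (- \<alpha> * t) = exp (- \<alpha> * fst z) * weight \<alpha> z t"
      by (simp add: weight_def exp_add[symmetric] algebra_simps)
    then have w: "ennreal (weight 0 z t) * ennreal (exp (- \<alpha> * t)) = ennreal (exp (- \<alpha> * fst z)) * ennreal (weight \<alpha> z t)"
      by (simp add: ennreal_mult[symmetric] less_imp_le)
    have t: "max 0 t = t" if "fst z < t" using that z by auto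
    have "(\<lambda>y. f (max 0 t, y)) \<in> borel_measurable (q_jump S q (snd z) (max 0 t))"
    proof -
      have "(\<lambda>y. f (max 0 t, y)) \<in> borel_measurable E" by measurable
      then show ?thesis by (simp cong: measurable_cong_sets add: sets_q_jump)
    qed
    then show "ennreal (weight 0 z t) * (\<integral>\<^sup>+y. ennreal (exp (- \<alpha> * max 0 t)) * f (max 0 t, y) \<partial>q_jump S q (snd z) (max 0 t)) * indicator {fst z<..} t
      = ennreal (exp (- \<alpha> * fst z)) * (ennreal (weight \<alpha> z t) * (\<integral>\<^sup>+y. f (max 0 t, y) \<partial>q_jump S q (snd z) (max 0 t)) * indicator {fst z<..} t)"
      using w t by (auto simp: nn_integral_cmult indicator_def mult.assoc[symmetric])
  qed
  also have "\<dots> = ennreal (exp (- \<alpha> * fst z)) * (\<integral>\<^sup>+y. f y \<partial>jump \<alpha> z)"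
    unfolding nn_integral_jump_max[OF z f] by (intro nn_integral_cmult) measurable
  finally show ?thesis .
qed

text \<open>With probability \<open>weight 0 (0, x) v\<close> the process started at time \<open>0\<close> is still in \<open>x\<close> at
  time \<open>v\<close>; this transfers nonexplosion from initial time \<open>0\<close> to initial time \<open>v\<close>.\<close>

lemma nn_integral_jump_shift:
  assumes z: "(v, x) \<in> {0..} \<times> S" and f [measurable]: "f \<in> borel_measurable B"
  shows "ennreal (weight \<alpha> (0, x) v) * (\<integral>\<^sup>+y. f y \<partial>jump \<alpha> (v, x)) \<le> (\<integral>\<^sup>+y. f y \<partial>jump \<alpha> (0, x))"
proof -
  have x: "x \<in> S" and v: "0 \<le> v" using z by auto
  have [measurable]: "(\<lambda>_. x) \<in> borel \<rightarrow>\<^sub>M E" using x by (simp add: space_restrict_space)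
  have [measurable]: "weight \<alpha> (v, x) \<in> borel_measurable borel"
    by (rule borel_measurable_weight_time[OF z])
  obtain C where C: "0 \<le> C" "\<And>s. \<bar>q_rate q x (max 0 s)\<bar> \<le> C"
    using q_rate_max_bounds[OF x] by blast
  have w: "weight \<alpha> (0, x) t = weight \<alpha> (0, x) v * weight \<alpha> (v, x) t" if "v \<le> t" for t
    using set_integral_Icc_split[OF borel_measurable_q_rate_max_time[OF x] C(2) v that]
    by (simp add: weight_def exp_add[symmetric] algebra_simps)
  have "ennreal (weight \<alpha> (0, x) v) * (\<integral>\<^sup>+y. f y \<partial>jump \<alpha> (v, x))
    = (\<integral>\<^sup>+t. ennreal (weight \<alpha> (0, x) v) * (ennreal (weight \<alpha> (v, x) t) * (\<integral>\<^sup>+y. f (max 0 t, y) \<partial>q_jump S q x (max 0 t)) * indicator {v<..} t) \<partial>lborel)"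
    unfolding nn_integral_jump_max[OF z f] by (subst nn_integral_cmult) (simp_all del: times_divide_eq_right)
  also have "\<dots> \<le> (\<integral>\<^sup>+t\<in>{0<..}. ennreal (weight \<alpha> (0, x) t) * (\<integral>\<^sup>+y. f (max 0 t, y) \<partial>q_jump S q x (max 0 t)) \<partial>lborel)"
  proof (intro nn_integral_mono)
    fix t :: real
    let ?J = "\<integral>\<^sup>+y. f (max 0 t, y) \<partial>q_jump S q x (max 0 t)"
    show "ennreal (weight \<alpha> (0, x) v) * (ennreal (weight \<alpha> (v, x) t) * ?J * indicator {v<..} t)
      \<le> ennreal (weight \<alpha> (0, x) t) * ?J * indicator {0<..} t"
    proof (cases "v < t")
      case True
      then show ?thesis
        using v w[of t] by (simp add: ennreal_mult mult.assoc)
    qed simp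
  qed
  also have "\<dots> = (\<integral>\<^sup>+y. f y \<partial>jump \<alpha> (0, x))"
    using x by (subst nn_integral_jump_max[of "(0, x)"]) auto
  finally show ?thesis .
qed

section \<open>Agreement with \<open>jump_kernel\<close>, \<open>p_alpha\<close> and the drift
  integral\<close>

lemma jump_kernel_Some:
  assumes "z \<in> {0..} \<times> S"
  shows "jump_kernel S q (Some z) = with_cemetery (jump 0 z) (1 - emeasure (jump 0 z) (space (jump 0 z)))"
proof -
  have "(\<lambda>t. exp (- (LBINT v:{fst z..t}. q_rate q (snd z) v))) = weight 0 z"
    using assms by (auto simp: weight_def LBINT_q_rate_max)
  then show ?thesis
    by (simp add: jump_kernel_def jump_def Let_def split_beta')
qed

lemma LBINT_shift: "(LBINT s:{0..t}. f (s + v)) = (LBINT u:{v..t + v}. f u)" for f :: "real \<Rightarrow> real"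
  unfolding set_lebesgue_integral_def
  by (subst (2) lborel_integral_real_affine[where c=1 and t=v])
     (auto intro!: Bochner_Integration.integral_cong simp: indicator_def add.commute)

text \<open>Turns the integral in \<open>weakly_Feller\<close> into the operator under study:
  translating the inner integral by \<open>v\<close> produces \<open>weight \<alpha>\<close>, and
  \<open>range Some\<close> removes the cemetery.\<close>

lemma set_integral_p_alpha:
  fixes f :: "real \<times> 'a \<Rightarrow> real"
  assumes z: "(v, x) \<in> {0..} \<times> S" and f: "f \<in> borel_measurable B" "\<And>z. z \<in> {0..} \<times> S \<Longrightarrow> 0 \<le> f z"
  shows "(LINT y:range Some|p_alpha S q \<alpha> (Some (v, x)). f (the y)) = enn2real (\<integral>\<^sup>+y. ennreal (f y) \<partial>jump \<alpha> (v, x))"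
proof -
  have x: "x \<in> S" and v: "0 \<le> v" using z by auto
  have "exp (- (LBINT s:{0..t - v}. \<alpha> + q_rate q x (s + v))) = weight \<alpha> (v, x) t" if "v < t" for t
  proof -
    have "(LBINT s:{0..t - v}. \<alpha> + q_rate q x (s + v)) = (LBINT u:{v..t}. \<alpha> + q_rate q x u)"
      using LBINT_shift[of "t - v" "\<lambda>u. \<alpha> + q_rate q x u" v] by simp
    also have "\<dots> = (LBINT u:{v..t}. \<alpha> + q_rate q x (max 0 u))"
      using v by (intro set_lebesgue_integral_cong) auto
    also have "\<dots> = \<alpha> * (t - v) + (LBINT u:{v..t}. q_rate q x (max 0 u))"
      using that by (intro LBINT_const_add_q_rate[OF x]) simp
    finally show ?thesis by (simp add: weight_def)
  qed
  then have "jump_measure S q x (\<lambda>t. exp (- (LBINT s:{0..t - v}. \<alpha> + q_rate q x (s + v)))) v = jump \<alpha> (v, x)"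
    unfolding jump_def fst_conv snd_conv by (rule jump_measure_cong)
  moreover have "f \<in> borel_measurable (jump \<alpha> (v, x))"
    using f(1) by (simp cong: measurable_cong_sets add: sets_jump)
  note set_integral_range_Some_with_cemetery[OF this, unfolded space_jump, OF f(2)]
  ultimately show ?thesis
    by (simp add: p_alpha_def)
qed

text \<open>Passing from elapsed to absolute time turns inequality (iv) into
  \<open>step \<alpha> V \<le> V\<close>. The drift integral includes the endpoint \<open>v\<close>
  and \<open>jump\<close> excludes it; it is a null set.\<close>

lemma drift_integral_eq:
  assumes z: "(v, x) \<in> {0..} \<times> S" and V: "V \<in> borel_measurable B"
  shows "(\<integral>\<^sup>+t\<in>{0..}. (\<integral>\<^sup>+y. ennreal (V (t + v, y)) * ennreal (exp (- \<alpha> * t - (LBINT s:{0..t}. q_rate q x (s + v)))) \<partial>q_jump S q x (t + v)) \<partial>lborel)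
    = (\<integral>\<^sup>+y. ennreal (V y) \<partial>jump \<alpha> (v, x))" (is "?L = _")
proof -
  have x: "x \<in> S" and v: "0 \<le> v" using z by auto
  note [measurable] = V
  have [measurable]: "(\<lambda>_. x) \<in> borel \<rightarrow>\<^sub>M E" using x by (simp add: space_restrict_space)
  have [measurable]: "weight \<alpha> (v, x) \<in> borel_measurable borel"
    by (rule borel_measurable_weight_time[OF z])
  define g where "g t = ennreal (weight \<alpha> (v, x) t) * (\<integral>\<^sup>+y. ennreal (V (max 0 t, y)) \<partial>q_jump S q x (max 0 t))" for t
  have g [measurable]: "g \<in> borel_measurable borel"
    unfolding g_def by measurable
  have "?L = (\<integral>\<^sup>+t\<in>{0..}. g (t + v) \<partial>lborel)"
  proof (intro nn_integral_cong)
    fix t :: real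
    have V': "(\<lambda>y. ennreal (V (max 0 (t + v), y))) \<in> borel_measurable (q_jump S q x (max 0 (t + v)))"
    proof -
      have "(\<lambda>y. ennreal (V (max 0 (t + v), y))) \<in> borel_measurable E" by measurable
      then show ?thesis by (simp cong: measurable_cong_sets add: sets_q_jump)
    qed
    have "exp (- \<alpha> * t - (LBINT s:{0..t}. q_rate q x (s + v))) = weight \<alpha> (v, x) (t + v)"
      using LBINT_shift[of t "q_rate q x" v] v by (simp add: weight_def LBINT_q_rate_max)
    moreover have "(\<integral>\<^sup>+y. ennreal (V (t + v, y)) * ennreal (weight \<alpha> (v, x) (t + v)) \<partial>q_jump S q x (t + v)) = g (t + v)"
      if "0 \<le> t"
    proof -
      have "max 0 (t + v) = t + v" using that v by simp
      then show ?thesis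
        using nn_integral_multc[OF V', of "ennreal (weight \<alpha> (v, x) (t + v))"] by (simp add: g_def mult.commute)
    qed
    ultimately show "(\<integral>\<^sup>+y. ennreal (V (t + v, y)) * ennreal (exp (- \<alpha> * t - (LBINT s:{0..t}. q_rate q x (s + v)))) \<partial>q_jump S q x (t + v)) * indicator {0..} t
      = g (t + v) * indicator {0..} t"
      by (cases "0 \<le> t") simp_all
  qed
  also have "\<dots> = (\<integral>\<^sup>+t\<in>{v..}. g t \<partial>lborel)"
    by (subst (2) nn_integral_real_affine[where c=1 and t=v])
       (auto intro!: nn_integral_cong simp: indicator_def add.commute)
  also have "\<dots> = (\<integral>\<^sup>+t\<in>{v<..}. g t \<partial>lborel)"
    using AE_lborel_singleton[of v] by (intro nn_integral_cong_AE) (auto simp: indicator_def elim!: eventually_mono)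
  also have "\<dots> = (\<integral>\<^sup>+y. ennreal (V y) \<partial>jump \<alpha> (v, x))"
    by (subst nn_integral_jump_max[OF z]) (simp_all add: g_def)
  finally show ?thesis .
qed

end

section \<open>The law of the jump chain\<close>

context Ionescu_Tulcea
begin

text \<open>\<open>CI\<close> projects the chain run up to \<open>up_to\<close> of the index set;
  for an initial segment nothing is projected away.\<close>

lemma CI_atLeastLessThan: "CI {0..<n} = C 0 n (\<lambda>_. undefined)"
proof -
  have "up_to {0..<n} = n"
    using up_to_iff_Ico[of "{0..<n}" n] up_to[of "{0..<n}"] by (cases n) auto
  then show ?thesis
    using distr_C[of n n "\<lambda>_. undefined" 0] by (simp add: CI_def)
qed

lemma nn_integral_lim:
  assumes f: "f \<in> borel_measurable (PiM {0..<n} M)"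
  shows "(\<integral>\<^sup>+\<omega>. f (restrict \<omega> {0..<n}) \<partial>PF.lim) = (\<integral>\<^sup>+\<omega>. f \<omega> \<partial>C 0 n (\<lambda>_. undefined))"
proof -
  have "(\<integral>\<^sup>+\<omega>. f \<omega> \<partial>C 0 n (\<lambda>_. undefined)) = (\<integral>\<^sup>+\<omega>. f \<omega> \<partial>distr PF.lim (PiM {0..<n} M) (\<lambda>x. restrict x {0..<n}))"
    by (simp add: distr_lim CI_atLeastLessThan)
  also have "\<dots> = (\<integral>\<^sup>+\<omega>. f (restrict \<omega> {0..<n}) \<partial>PF.lim)"
    using f by (intro nn_integral_distr) (auto simp: measurable_cong_sets[OF PF.sets_lim refl] intro!: measurable_restrict)
  finally show ?thesis by (rule sym)
qed

lemma prob_space_lim: "prob_space PF.lim"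
proof (rule prob_spaceI)
  have "prob_space (C 0 0 (\<lambda>_. undefined))"
    by (rule prob_space_C) (simp add: space_PiM)
  then show "emeasure PF.lim (space PF.lim) = 1"
    using nn_integral_lim[of "\<lambda>_. 1" 0] by (simp add: prob_space.emeasure_space_1 del: C.simps)
qed

text \<open>The tower rule: the law of the first \<open>Suc n\<close> coordinates is the bind of
  that of the first \<open>n\<close> with the one-step extension, so the last coordinate can be
  integrated out under \<open>P n\<close>.\<close>

lemma nn_integral_lim_Suc:
  assumes f: "f \<in> borel_measurable (PiM {0..<Suc n} M)"
  shows "(\<integral>\<^sup>+\<omega>. f (restrict \<omega> {0..<Suc n}) \<partial>PF.lim) =
    (\<integral>\<^sup>+\<omega>. (\<integral>\<^sup>+y. f (fun_upd (restrict \<omega> {0..<n}) n y) \<partial>P n (restrict \<omega> {0..<n})) \<partial>PF.lim)"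
proof -
  let ?u = "\<lambda>_::nat. undefined :: 'a"
  have u: "?u \<in> space (PiM {0..<0} M)" by (simp add: space_PiM)
  have sp: "space (C 0 n ?u) = space (PiM {0..<n} M)"
    using space_C[OF u, of n] by simp
  have "(\<integral>\<^sup>+\<omega>. f (restrict \<omega> {0..<Suc n}) \<partial>PF.lim) = (\<integral>\<^sup>+\<omega>. f \<omega> \<partial>(C 0 n ?u \<bind> eP n))"
    by (simp add: nn_integral_lim[OF f])
  also have "\<dots> = (\<integral>\<^sup>+\<omega>. \<integral>\<^sup>+\<omega>'. f \<omega>' \<partial>eP n \<omega> \<partial>C 0 n ?u)"
    using measurable_eP[of n] sets_C[OF u, of n]
    by (intro nn_integral_bind[OF f]) (simp cong: measurable_cong_sets)
  also have "\<dots> = (\<integral>\<^sup>+\<omega>. \<integral>\<^sup>+y. f (fun_upd \<omega> n y) \<partial>P n \<omega> \<partial>C 0 n ?u)"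
    by (intro nn_integral_cong nn_integral_eP f) (simp add: sp)
  also have "\<dots> = (\<integral>\<^sup>+\<omega>. (\<integral>\<^sup>+y. f (fun_upd (restrict \<omega> {0..<n}) n y) \<partial>P n (restrict \<omega> {0..<n})) \<partial>PF.lim)"
  proof (rule nn_integral_lim[symmetric])
    have "(\<lambda>\<omega>. \<integral>\<^sup>+\<omega>'. f \<omega>' \<partial>eP n \<omega>) \<in> borel_measurable (PiM {0..<n} M)"
      by (rule measurable_compose[OF measurable_eP nn_integral_measurable_subprob_algebra[OF f]])
    then show "(\<lambda>\<omega>. \<integral>\<^sup>+y. f (fun_upd \<omega> n y) \<partial>P n \<omega>) \<in> borel_measurable (PiM {0..<n} M)"
      by (rule measurable_cong[THEN iffD1, rotated]) (simp add: nn_integral_eP[OF _ f])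
  qed
  finally show ?thesis .
qed

end

text \<open>\<open>lim\<close> is a definite description, so all divergent sequences share one
  unspecified value. With that value as a constant, \<open>lim\<close> is a measurable case
  distinction on liminf and limsup. This is required because jump times converge almost surely, not
  at every point of the sequence space.\<close>

lemma pred_lim_eq_PInf:
  assumes [measurable]: "\<And>n. (\<lambda>\<omega>. u \<omega> n) \<in> borel_measurable M"
  shows "Measurable.pred M (\<lambda>\<omega>. lim (u \<omega>) = (\<infinity> :: ereal))"
proof -
  have lim: "lim X = (if liminf X = limsup X then liminf X else (THE L. False))" for X :: "nat \<Rightarrow> ereal"
  proof (cases "liminf X = limsup X")
    case True
    then have "X \<longlonglongrightarrow> liminf X" by (simp add: tendsto_iff_Liminf_eq_Limsup)
    then show ?thesis using True by (simp add: limI)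
  next
    case False
    then have "\<not> X \<longlonglongrightarrow> L" for L
      by (auto simp: tendsto_iff_Liminf_eq_Limsup)
    then show ?thesis using False by (simp add: lim_def)
  qed
  show ?thesis
    unfolding lim by measurable
qed

section \<open>The Markov chain of jump times and states\<close>

context Q_kernel
begin

abbreviation J where "J \<equiv> jump_states S"

lemma space_J [simp]: "space J = insert None (Some ` ({0..} \<times> S))"
  by (simp add: jump_states_def)

lemma measurable_J_iff: "f \<in> J \<rightarrow>\<^sub>M L \<longleftrightarrow> f None \<in> space L \<and> (\<lambda>z. f (Some z)) \<in> B \<rightarrow>\<^sub>M L"
  by (simp add: jump_states_def measurable_with_cemetery_iff)

lemma measurable_jump_kernel: "jump_kernel S q \<in> J \<rightarrow>\<^sub>M prob_algebra J"
  unfolding measurable_J_iff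
proof
  have "prob_space (return J (None :: (real \<times> 'a) option))"
    by (rule prob_space_return) simp
  then show "jump_kernel S q None \<in> space (prob_algebra J)"
    by (simp add: jump_kernel_def space_prob_algebra)
  have "(\<lambda>z. with_cemetery (jump 0 z) (1 - emeasure (jump 0 z) (space (jump 0 z)))) \<in> B \<rightarrow>\<^sub>M prob_algebra J"
    unfolding jump_states_def by (intro measurable_with_cemetery_kernel measurable_jump) simp
  then show "(\<lambda>z. jump_kernel S q (Some z)) \<in> B \<rightarrow>\<^sub>M prob_algebra J"
    by (rule measurable_cong[THEN iffD1, rotated]) (metis jump_kernel_Some space_B)
qed

lemma sets_jump_kernel:
  assumes "z \<in> space J" shows "sets (jump_kernel S q z) = sets J"
  using measurable_space[OF measurable_jump_kernel assms] by (auto simp: space_prob_algebra)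

lemma Ionescu_Tulcea_jump_chain:
  assumes x: "x \<in> S" shows "Ionescu_Tulcea (jump_chain_step S q x) (\<lambda>_. J)"
proof -
  have x': "Some (0, x) \<in> space J" using x by auto
  have step: "jump_chain_step S q x n \<in> PiM {0..<n} (\<lambda>_. J) \<rightarrow>\<^sub>M prob_algebra J" for n
  proof (cases n)
    case 0
    then have "jump_chain_step S q x n = (\<lambda>_. return J (Some (0, x)))"
      by (simp add: jump_chain_step_def fun_eq_iff)
    moreover have "return J (Some (0, x)) \<in> space (prob_algebra J)"
      using prob_space_return[OF x'] by (simp add: space_prob_algebra)
    ultimately show ?thesis by (simp add: measurable_const)
  next
    case (Suc m)
    then have "jump_chain_step S q x n = (\<lambda>\<omega>. jump_kernel S q (\<omega> m))"
      by (simp add: jump_chain_step_def fun_eq_iff)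
    then show ?thesis
      using Suc by (simp add: measurable_compose[OF _ measurable_jump_kernel])
  qed
  show ?thesis
  proof (rule Ionescu_Tulcea.intro)
    show "jump_chain_step S q x n \<in> PiM {0..<n} (\<lambda>_. J) \<rightarrow>\<^sub>M subprob_algebra J" for n
      by (rule measurable_prob_algebraD[OF step])
    show "prob_space (jump_chain_step S q x n \<omega>)" if "\<omega> \<in> space (PiM {0..<n} (\<lambda>_. J))" for n \<omega>
      using measurable_space[OF step that] by (simp add: space_prob_algebra)
  qed
qed

context
  fixes x :: 'a assumes x: "x \<in> S"
begin

interpretation IT: Ionescu_Tulcea "jump_chain_step S q x" "\<lambda>_. J"
  by (rule Ionescu_Tulcea_jump_chain[OF x])

lemma jump_law_eq: "jump_law S q x = IT.PF.lim"
  by (simp add: jump_law_def)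

lemma sets_jump_law [measurable_cong]: "sets (jump_law S q x) = sets (PiM UNIV (\<lambda>_. J))"
  by (simp add: jump_law_eq)

lemma prob_space_jump_law: "prob_space (jump_law S q x)"
  unfolding jump_law_eq by (rule IT.prob_space_lim)

lemma measurable_coordinate [measurable]: "(\<lambda>\<omega>. \<omega> n) \<in> jump_law S q x \<rightarrow>\<^sub>M J"
  by measurable

lemma nn_integral_jump_law_0:
  assumes g: "g \<in> borel_measurable J"
  shows "(\<integral>\<^sup>+\<omega>. g (\<omega> 0) \<partial>jump_law S q x) = g (Some (0, x))"
proof -
  have "(\<lambda>\<omega>. g (\<omega> 0)) \<in> borel_measurable (PiM {0..<Suc 0} (\<lambda>_. J))"
    by (rule measurable_compose[OF _ g]) simp
  from IT.nn_integral_lim_Suc[OF this]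
  have "(\<integral>\<^sup>+\<omega>. g (\<omega> 0) \<partial>jump_law S q x) = (\<integral>\<^sup>+\<omega>. (\<integral>\<^sup>+y. g y \<partial>return J (Some (0, x))) \<partial>jump_law S q x)"
    by (simp add: jump_law_eq jump_chain_step_def)
  also have "\<dots> = g (Some (0, x))"
    using x g prob_space.emeasure_space_1[OF prob_space_jump_law] by (simp add: nn_integral_return)
  finally show ?thesis .
qed

text \<open>\<open>jump_chain_step\<close> reads only the last coordinate of the history, so the
  tower rule closes on the pair of consecutive coordinates.\<close>

lemma nn_integral_jump_law_Suc:
  assumes g: "g \<in> borel_measurable (J \<Otimes>\<^sub>M J)"
  shows "(\<integral>\<^sup>+\<omega>. g (\<omega> n, \<omega> (Suc n)) \<partial>jump_law S q x) = (\<integral>\<^sup>+\<omega>. (\<integral>\<^sup>+y. g (\<omega> n, y) \<partial>jump_kernel S q (\<omega> n)) \<partial>jump_law S q x)"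
proof -
  have "(\<lambda>\<omega>. g (\<omega> n, \<omega> (Suc n))) \<in> borel_measurable (PiM {0..<Suc (Suc n)} (\<lambda>_. J))"
    by (rule measurable_compose[OF _ g]) (auto intro!: measurable_Pair measurable_component_singleton)
  from IT.nn_integral_lim_Suc[OF this] show ?thesis
    by (simp add: jump_law_eq jump_chain_step_def)
qed

end

section \<open>Discounted expectations and the criterion for nonexplosion\<close>

definition step :: "real \<Rightarrow> (real \<times> 'a \<Rightarrow> ennreal) \<Rightarrow> real \<times> 'a \<Rightarrow> ennreal" where
  "step \<alpha> f z = (\<integral>\<^sup>+y. f y \<partial>jump \<alpha> z)"

text \<open>The value 0 at the cemetery matches its time \<infinity>: with \<open>f = 1\<close> this
  is \<open>exp (- \<alpha> t)\<close> on every state.\<close>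

definition disc :: "real \<Rightarrow> (real \<times> 'a \<Rightarrow> ennreal) \<Rightarrow> (real \<times> 'a) option \<Rightarrow> ennreal" where
  "disc \<alpha> f z = (case z of None \<Rightarrow> 0 | Some y \<Rightarrow> ennreal (exp (- \<alpha> * fst y)) * f y)"

lemma disc_simps [simp]: "disc \<alpha> f None = 0" "disc \<alpha> f (Some y) = ennreal (exp (- \<alpha> * fst y)) * f y"
  by (simp_all add: disc_def)

lemma borel_measurable_step: "0 \<le> \<alpha> \<Longrightarrow> f \<in> borel_measurable B \<Longrightarrow> step \<alpha> f \<in> borel_measurable B"
  unfolding step_def[abs_def] by (rule borel_measurable_nn_integral_jump)

lemma borel_measurable_step_funpow:
  "0 \<le> \<alpha> \<Longrightarrow> f \<in> borel_measurable B \<Longrightarrow> (step \<alpha> ^^ n) f \<in> borel_measurable B"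
  by (induction n) (auto intro: borel_measurable_step)

lemma borel_measurable_disc: "f \<in> borel_measurable B \<Longrightarrow> disc \<alpha> f \<in> borel_measurable J"
  by (simp add: measurable_J_iff)

lemma nn_integral_jump_kernel:
  assumes z: "z \<in> {0..} \<times> S" and g: "g \<in> borel_measurable J" "g None = 0"
  shows "(\<integral>\<^sup>+y. g y \<partial>jump_kernel S q (Some z)) = (\<integral>\<^sup>+y. g (Some y) \<partial>jump 0 z)"
proof -
  have "g \<in> borel_measurable (jump_kernel S q (Some z))"
    using g(1) sets_jump_kernel[of "Some z"] z by (auto cong: measurable_cong_sets)
  then show ?thesis
    using g(2) by (simp add: jump_kernel_Some[OF z] nn_integral_with_cemetery)
qed

lemma nn_integral_jump_kernel_disc:
  assumes z: "z \<in> space J" and f: "f \<in> borel_measurable B"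
  shows "(\<integral>\<^sup>+y. disc \<alpha> f y \<partial>jump_kernel S q z) = disc \<alpha> (step \<alpha> f) z"
proof (cases z)
  case None
  then show ?thesis
    using borel_measurable_disc[OF f] by (simp add: jump_kernel_def nn_integral_return)
next
  case (Some y)
  then have y: "y \<in> {0..} \<times> S" using z by auto
  show ?thesis
    using nn_integral_jump_kernel[OF y borel_measurable_disc[OF f, of \<alpha>]] nn_integral_jump_discount[OF y f]
    by (simp add: Some step_def)
qed

context
  fixes x :: 'a assumes x: "x \<in> S"
begin

interpretation prob_space "jump_law S q x"
  by (rule prob_space_jump_law[OF x])

lemma coordinate_space: "\<omega> \<in> space (jump_law S q x) \<Longrightarrow> \<omega> n \<in> space J"
  by (rule measurable_space[OF measurable_coordinate[OF x]])

text \<open>Conditioning on coordinate \<open>n\<close> replaces \<open>disc \<alpha> f\<close> by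
  \<open>disc \<alpha> (step \<alpha> f)\<close>; at coordinate 0 the time is 0 and the discount is
  1.\<close>

lemma nn_integral_disc_coordinate:
  assumes \<alpha>: "0 \<le> \<alpha>" and f: "f \<in> borel_measurable B"
  shows "(\<integral>\<^sup>+\<omega>. disc \<alpha> f (\<omega> n) \<partial>jump_law S q x) = (step \<alpha> ^^ n) f (0, x)"
  using f
proof (induction n arbitrary: f)
  case 0
  then show ?case
    using nn_integral_jump_law_0[OF x borel_measurable_disc] by simp
next
  case (Suc n)
  have "(\<lambda>p. disc \<alpha> f (snd p)) \<in> borel_measurable (J \<Otimes>\<^sub>M J)"
    by (rule measurable_compose[OF measurable_snd borel_measurable_disc[OF Suc.prems]])
  from nn_integral_jump_law_Suc[OF x this, of n]
  have "(\<integral>\<^sup>+\<omega>. disc \<alpha> f (\<omega> (Suc n)) \<partial>jump_law S q x)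
    = (\<integral>\<^sup>+\<omega>. (\<integral>\<^sup>+y. disc \<alpha> f y \<partial>jump_kernel S q (\<omega> n)) \<partial>jump_law S q x)"
    by simp
  also have "\<dots> = (\<integral>\<^sup>+\<omega>. disc \<alpha> (step \<alpha> f) (\<omega> n) \<partial>jump_law S q x)"
    by (intro nn_integral_cong nn_integral_jump_kernel_disc coordinate_space Suc.prems)
  also have "\<dots> = (step \<alpha> ^^ n) (step \<alpha> f) (0, x)"
    by (rule Suc.IH[OF borel_measurable_step[OF \<alpha> Suc.prems]])
  finally show ?case by (simp add: funpow_swap1)
qed

definition time :: "(real \<times> 'a) option \<Rightarrow> ereal" where
  "time z = (case z of None \<Rightarrow> \<infinity> | Some (t, y) \<Rightarrow> ereal t)"

lemma borel_measurable_time [measurable]: "time \<in> borel_measurable J"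
  by (simp add: measurable_J_iff time_def split_beta')

lemma jump_time_eq: "jump_time \<omega> n = time (\<omega> n)"
  by (simp add: jump_time_def time_def)

text \<open>The sequence space imposes no order on times. From \<open>Some y\<close> the kernel
  charges only later times and the cemetery, and \<open>None\<close> is absorbing, so the marker
  \<open>g\<close> of a decrease has mean 0 at every step.\<close>

lemma AE_jump_time_mono: "AE \<omega> in jump_law S q x. incseq (jump_time \<omega>)"
proof -
  define g :: "(real \<times> 'a) option \<times> (real \<times> 'a) option \<Rightarrow> ennreal"
    where "g p = (if time (snd p) < time (fst p) then 1 else 0)" for p
  have g [measurable]: "g \<in> borel_measurable (J \<Otimes>\<^sub>M J)"
    unfolding g_def by measurable
  have 0: "(\<integral>\<^sup>+y. g (z, y) \<partial>jump_kernel S q z) = 0" if z: "z \<in> space J" for z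
  proof (cases z)
    case None
    have "(\<lambda>y. g (None, y)) \<in> borel_measurable J"
      using z None by measurable
    then show ?thesis
      by (simp add: None jump_kernel_def nn_integral_return) (simp add: g_def time_def)
  next
    case (Some y)
    then have y: "y \<in> {0..} \<times> S" using z by auto
    have meas: "(\<lambda>y. g (z, y)) \<in> borel_measurable J"
      using z by measurable
    have "(\<integral>\<^sup>+y. g (z, y) \<partial>jump_kernel S q z) = (\<integral>\<^sup>+w. g (z, Some w) \<partial>jump 0 y)"
      using nn_integral_jump_kernel[OF y meas] by (simp add: Some g_def time_def)
    also have "\<dots> = (\<integral>\<^sup>+t\<in>{fst y<..}. ennreal (weight 0 y t) * (\<integral>\<^sup>+w. g (z, Some (t, w)) \<partial>q_jump S q (snd y) t) \<partial>lborel)"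
      using meas by (intro nn_integral_jump[OF y]) (simp add: measurable_J_iff)
    also have "\<dots> = (\<integral>\<^sup>+t. 0 \<partial>(lborel :: real measure))"
      by (intro nn_integral_cong) (auto simp: Some g_def time_def indicator_def split: prod.splits)
    finally show ?thesis by simp
  qed
  have "AE \<omega> in jump_law S q x. g (\<omega> n, \<omega> (Suc n)) = 0" for n
  proof -
    have "(\<integral>\<^sup>+\<omega>. g (\<omega> n, \<omega> (Suc n)) \<partial>jump_law S q x) = (\<integral>\<^sup>+\<omega>. 0 \<partial>jump_law S q x)"
      unfolding nn_integral_jump_law_Suc[OF x g] by (intro nn_integral_cong 0 coordinate_space)
    moreover have "(\<lambda>\<omega>. g (\<omega> n, \<omega> (Suc n))) \<in> borel_measurable (jump_law S q x)"
      using measurable_coordinate[OF x] by measurable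
    ultimately show ?thesis
      by (simp add: nn_integral_0_iff_AE)
  qed
  then have "AE \<omega> in jump_law S q x. \<forall>n. g (\<omega> n, \<omega> (Suc n)) = 0"
    by (simp add: AE_all_countable)
  then show ?thesis
    by eventually_elim (auto intro!: incseq_SucI simp: jump_time_eq g_def not_less split: if_splits)
qed

text \<open>Along a nondecreasing sequence the explosion time is the supremum; the discount reverses
  order, and a finite upper bound \<open>b\<close> keeps it above
  \<open>exp (- \<alpha> * b) > 0\<close>.\<close>

lemma explosion_time_eq_PInf_iff:
  assumes \<alpha>: "0 < \<alpha>" and mono: "incseq (jump_time \<omega>)"
  shows "explosion_time \<omega> = \<infinity> \<longleftrightarrow> (INF n. disc \<alpha> (\<lambda>_. 1) (\<omega> n)) = 0"
proof -
  have lim: "explosion_time \<omega> = (SUP n. jump_time \<omega> n)"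
    unfolding explosion_time_def by (rule limI[OF LIMSEQ_SUP[OF mono]])
  show ?thesis
  proof
    assume inf: "explosion_time \<omega> = \<infinity>"
    have "(INF n. disc \<alpha> (\<lambda>_. 1) (\<omega> n)) \<le> 0"
    proof (rule ennreal_le_epsilon)
      fix e :: real assume e: "0 < e"
      \<comment> \<open>The time at which \<open>exp (- \<alpha> t)\<close> equals
        \<open>e\<close>.\<close>
      have "ereal (- ln e / \<alpha>) < (SUP n. jump_time \<omega> n)"
        using inf lim by simp
      then obtain n where n: "ereal (- ln e / \<alpha>) < jump_time \<omega> n"
        by (auto simp: less_SUP_iff)
      have "disc \<alpha> (\<lambda>_. 1) (\<omega> n) \<le> ennreal e"
      proof (cases "\<omega> n")
        case (Some y)
        then have "- ln e / \<alpha> < fst y"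
          using n by (simp add: jump_time_eq time_def split_beta')
        then have "- \<alpha> * fst y < ln e"
          using \<alpha> by (simp add: field_simps)
        then have "exp (- \<alpha> * fst y) < e"
          using e by (metis exp_less_mono exp_ln)
        then show ?thesis
          by (simp add: Some ennreal_leI less_imp_le)
      qed simp
      then show "(INF n. disc \<alpha> (\<lambda>_. 1) (\<omega> n)) \<le> 0 + ennreal e"
        by (auto intro: INF_lower2)
    qed
    then show "(INF n. disc \<alpha> (\<lambda>_. 1) (\<omega> n)) = 0" by simp
  next
    assume zero: "(INF n. disc \<alpha> (\<lambda>_. 1) (\<omega> n)) = 0"
    show "explosion_time \<omega> = \<infinity>"
    proof (rule ccontr)
      assume "explosion_time \<omega> \<noteq> \<infinity>"
      then have "(SUP n. jump_time \<omega> n) < \<infinity>"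
        using lim by (simp add: less_top[symmetric] top_ereal_def)
      then obtain b where b: "(SUP n. jump_time \<omega> n) < ereal b"
        using ereal_dense2 by blast
      have "ennreal (exp (- \<alpha> * b)) \<le> disc \<alpha> (\<lambda>_. 1) (\<omega> n)" for n
      proof -
        have "jump_time \<omega> n < ereal b"
          using b by (meson SUP_upper UNIV_I le_less_trans)
        then obtain y where "\<omega> n = Some y" "fst y < b"
          by (cases "\<omega> n") (auto simp: jump_time_eq time_def split_beta')
        then show ?thesis
          using \<alpha> by (auto intro!: ennreal_leI)
      qed
      then have "ennreal (exp (- \<alpha> * b)) \<le> (INF n. disc \<alpha> (\<lambda>_. 1) (\<omega> n))"
        by (intro INF_greatest)
      with zero show False by simp
    qed
  qed
qed

text \<open>A nonnegative function vanishes almost surely iff its integral is 0. The discounts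
  decrease almost surely and have finite integral at \<open>n = 0\<close>, so monotone convergence
  from above moves the infimum outside.\<close>

lemma prob_no_explosion_iff:
  assumes \<alpha>: "0 < \<alpha>"
  shows "prob {\<omega> \<in> space (jump_law S q x). explosion_time \<omega> = \<infinity>} = 1 \<longleftrightarrow>
    (INF n. (step \<alpha> ^^ n) (\<lambda>_. 1) (0, x)) = 0"
proof -
  note [measurable] = measurable_coordinate[OF x] borel_measurable_disc
  have meas: "(\<lambda>\<omega>. jump_time \<omega> n) \<in> borel_measurable (jump_law S q x)" for n
    unfolding jump_time_eq by measurable
  have "Measurable.pred (jump_law S q x) (\<lambda>\<omega>. explosion_time \<omega> = \<infinity>)"
    unfolding explosion_time_def by (rule pred_lim_eq_PInf[OF meas])
  then have "prob {\<omega> \<in> space (jump_law S q x). explosion_time \<omega> = \<infinity>} = 1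
    \<longleftrightarrow> (AE \<omega> in jump_law S q x. explosion_time \<omega> = \<infinity>)"
    by (intro prob_Collect_eq_1) (simp add: pred_def)
  also have "\<dots> \<longleftrightarrow> (AE \<omega> in jump_law S q x. (INF n. disc \<alpha> (\<lambda>_. 1) (\<omega> n)) = 0)"
  proof (rule eventually_subst)
    show "AE \<omega> in jump_law S q x. (explosion_time \<omega> = \<infinity>) = ((INF n. disc \<alpha> (\<lambda>_. 1) (\<omega> n)) = 0)"
      using AE_jump_time_mono by eventually_elim (rule explosion_time_eq_PInf_iff[OF \<alpha>])
  qed
  also have "\<dots> \<longleftrightarrow> (\<integral>\<^sup>+\<omega>. (INF n. disc \<alpha> (\<lambda>_. 1) (\<omega> n)) \<partial>jump_law S q x) = 0"
    by (intro nn_integral_0_iff_AE[symmetric]) measurable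
  also have "(\<integral>\<^sup>+\<omega>. (INF n. disc \<alpha> (\<lambda>_. 1) (\<omega> n)) \<partial>jump_law S q x)
    = (INF n. \<integral>\<^sup>+\<omega>. disc \<alpha> (\<lambda>_. 1) (\<omega> n) \<partial>jump_law S q x)"
  proof (rule nn_integral_monotone_convergence_INF_AE)
    show "AE \<omega> in jump_law S q x. disc \<alpha> (\<lambda>_. 1) (\<omega> (Suc n)) \<le> disc \<alpha> (\<lambda>_. 1) (\<omega> n)" for n
      using AE_jump_time_mono
    proof eventually_elim
      fix \<omega> :: "nat \<Rightarrow> (real \<times> 'a) option" assume "incseq (jump_time \<omega>)"
      then have "jump_time \<omega> n \<le> jump_time \<omega> (Suc n)" by (rule incseq_SucD)
      then show "disc \<alpha> (\<lambda>_. 1) (\<omega> (Suc n)) \<le> disc \<alpha> (\<lambda>_. 1) (\<omega> n)"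
        using \<alpha> by (cases "\<omega> n"; cases "\<omega> (Suc n)") (auto simp: jump_time_eq time_def intro!: ennreal_leI)
    qed
    show "(\<integral>\<^sup>+\<omega>. disc \<alpha> (\<lambda>_. 1) (\<omega> 0) \<partial>jump_law S q x) < \<infinity>"
      using \<alpha> by (subst nn_integral_disc_coordinate) auto
  qed measurable
  also have "(\<lambda>n. \<integral>\<^sup>+\<omega>. disc \<alpha> (\<lambda>_. 1) (\<omega> n) \<partial>jump_law S q x) = (\<lambda>n. (step \<alpha> ^^ n) (\<lambda>_. 1) (0, x))"
    using \<alpha> by (simp add: nn_integral_disc_coordinate)
  finally show ?thesis .
qed

end

lemma nonexplosive_iff:
  "0 < \<alpha> \<Longrightarrow> nonexplosive S q \<longleftrightarrow> (\<forall>x\<in>S. (INF n. (step \<alpha> ^^ n) (\<lambda>_. 1) (0, x)) = 0)"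
  using prob_no_explosion_iff by (simp add: nonexplosive_def)

end

section \<open>Drift implies nonexplosion\<close>

context Q_kernel
begin

lemma step_mono:
  "(\<And>z. z \<in> {0..} \<times> S \<Longrightarrow> f z \<le> g z) \<Longrightarrow> step \<alpha> f z \<le> step \<alpha> g z"
  unfolding step_def by (intro nn_integral_mono) auto

lemma step_cong:
  "(\<And>z. z \<in> {0..} \<times> S \<Longrightarrow> f z = g z) \<Longrightarrow> step \<alpha> f z = step \<alpha> g z"
  unfolding step_def by (intro nn_integral_cong) auto

lemma step_add:
  "f \<in> borel_measurable B \<Longrightarrow> g \<in> borel_measurable B \<Longrightarrow> step \<alpha> (\<lambda>z. f z + g z) z = step \<alpha> f z + step \<alpha> g z"
  unfolding step_def by (rule nn_integral_add) (simp_all cong: measurable_cong_sets add: sets_jump)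

lemma step_cmult: "f \<in> borel_measurable B \<Longrightarrow> step \<alpha> (\<lambda>z. c * f z) z = c * step \<alpha> f z"
  unfolding step_def by (rule nn_integral_cmult) (simp_all cong: measurable_cong_sets add: sets_jump)

lemma step_const: "step \<alpha> (\<lambda>_. c) z = c * emeasure (jump \<alpha> z) ({0..} \<times> S)"
  unfolding step_def by simp

lemma step_funpow_le_1:
  assumes "0 \<le> \<alpha>" "\<And>z. z \<in> {0..} \<times> S \<Longrightarrow> f z \<le> 1" "z \<in> {0..} \<times> S"
  shows "(step \<alpha> ^^ n) f z \<le> 1"
  using assms(3)
proof (induction n arbitrary: z)
  case 0
  then show ?case using assms by simp
next
  case (Suc n)
  then have "step \<alpha> ((step \<alpha> ^^ n) f) z \<le> step \<alpha> (\<lambda>_. 1) z"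
    by (intro step_mono)
  also have "\<dots> \<le> 1"
    using emeasure_jump_le_1[OF assms(1) Suc.prems] by (simp add: step_const)
  finally show ?case by simp
qed

lemma drift_conditionD:
  assumes "drift_condition S q St V"
  obtains \<alpha> where "0 < \<alpha>" "\<And>z. z \<in> {0..} \<times> S \<Longrightarrow> step \<alpha> (\<lambda>z. ennreal (V z)) z \<le> ennreal (V z)"
proof -
  have V: "V \<in> borel_measurable B"
    using assms by (simp add: drift_condition_def)
  obtain \<alpha> where \<alpha>: "0 < \<alpha>" and *: "\<And>x v. x \<in> S \<Longrightarrow> 0 \<le> v \<Longrightarrow>
        (\<integral>\<^sup>+t\<in>{0..}. (\<integral>\<^sup>+y. ennreal (V (t + v, y)) *
             ennreal (exp (- \<alpha> * t - (LBINT s:{0..t}. q_rate q x (s + v)))) \<partial>q_jump S q x (t + v)) \<partial>lborel)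
          \<le> ennreal (V (v, x))"
    using assms unfolding drift_condition_def by blast
  have "step \<alpha> (\<lambda>z. ennreal (V z)) z \<le> ennreal (V z)" if z: "z \<in> {0..} \<times> S" for z
  proof -
    obtain v x where vx: "z = (v, x)" by (cases z)
    then have "x \<in> S" "0 \<le> v" using z by auto
    from *[OF this] show ?thesis
      unfolding vx step_def drift_integral_eq[OF z[unfolded vx] V] .
  qed
  with \<alpha> that show ?thesis by blast
qed

lemma drift_imp_nonexplosive:
  assumes D: "drift_condition S q St V"
  shows "nonexplosive S q"
proof -
  obtain \<alpha> where \<alpha>: "0 < \<alpha>" and drift: "\<And>z. z \<in> {0..} \<times> S \<Longrightarrow> step \<alpha> (\<lambda>z. ennreal (V z)) z \<le> ennreal (V z)"
    using drift_conditionD[OF D] by blast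
  have V: "V \<in> borel_measurable B" and V_nonneg: "\<And>z. z \<in> {0..} \<times> S \<Longrightarrow> 0 \<le> V z"
    and rates: "\<And>n. (SUP (x, t)\<in>(snd ` St n) \<times> {0..}. ereal (q_rate q x t)) < \<infinity>"
    and lim: "(\<lambda>n. INF z\<in>{0..} \<times> S - St n. ereal (V z)) \<longlonglongrightarrow> \<infinity>"
    using D by (auto simp: drift_condition_def)
  have V': "(\<lambda>z. ennreal (V z)) \<in> borel_measurable B" using V by measurable
  have bound: "\<exists>r. 0 \<le> r \<and> r < 1 \<and> (\<forall>m. (step \<alpha> ^^ m) (\<lambda>_. 1) z \<le> ennreal (r ^ m) + ennreal e * ennreal (V z))"
    if z: "z \<in> {0..} \<times> S" and e: "0 < e" for z e
  proof -
    have "\<forall>\<^sub>F n in sequentially. ereal (1 / e) < (INF z\<in>{0..} \<times> S - St n. ereal (V z))"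
      using lim by (rule order_tendstoD) simp
    then obtain n where n: "ereal (1 / e) < (INF z\<in>{0..} \<times> S - St n. ereal (V z))"
      by (auto simp: eventually_sequentially)
    have outside: "1 \<le> ennreal e * ennreal (V z)" if "z \<in> {0..} \<times> S" "z \<notin> St n" for z
    proof -
      have "(INF z\<in>{0..} \<times> S - St n. ereal (V z)) \<le> ereal (V z)"
        using that by (intro INF_lower) auto
      with n have "1 / e < V z" by (metis less_le_trans ereal_less_eq(3) less_ereal.simps(1))
      then have "1 \<le> e * V z" using e by (simp add: field_simps)
      then show ?thesis using e V_nonneg[OF that(1)]
        by (simp add: ennreal_mult[symmetric] ennreal_ge_1)
    qed
    obtain k0 where k0: "(SUP (x, t)\<in>(snd ` St n) \<times> {0..}. ereal (q_rate q x t)) < ereal k0"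
      using ereal_dense2[OF rates[of n]] by blast
    \<comment> \<open>If \<open>St n\<close> is empty, the supremum is minus infinity and
      \<open>k0\<close> may be negative.\<close>
    define k where "k = max 0 k0"
    have k: "q_rate q (snd z) t \<le> k" if "z \<in> St n" "0 \<le> t" for z t
    proof -
      have "ereal (q_rate q (snd z) t) \<le> (SUP (x, t)\<in>(snd ` St n) \<times> {0..}. ereal (q_rate q x t))"
        using that by (intro SUP_upper2[of "(snd z, t)"]) auto
      from le_less_trans[OF this k0] show ?thesis by (simp add: k_def)
    qed
    define r where "r = k / (k + \<alpha>)"
    have r: "0 \<le> r" "r < 1"
      using \<alpha> by (auto simp: r_def k_def field_simps)
    have "(step \<alpha> ^^ m) (\<lambda>_. 1) z \<le> ennreal (r ^ m) + ennreal e * ennreal (V z)" if "z \<in> {0..} \<times> S" for m z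
      using that
    proof (induction m arbitrary: z)
      case (Suc m)
      show ?case
      proof (cases "z \<in> St n")
        case True
        have "(step \<alpha> ^^ Suc m) (\<lambda>_. 1) z = step \<alpha> ((step \<alpha> ^^ m) (\<lambda>_. 1)) z" by simp
        also have "\<dots> \<le> step \<alpha> (\<lambda>z. ennreal (r ^ m) + ennreal e * ennreal (V z)) z"
          by (intro step_mono Suc.IH)
        also have "\<dots> = ennreal (r ^ m) * emeasure (jump \<alpha> z) ({0..} \<times> S) + ennreal e * step \<alpha> (\<lambda>z. ennreal (V z)) z"
          using V' by (simp add: step_add step_const step_cmult)
        also have "\<dots> \<le> ennreal (r ^ m) * ennreal r + ennreal e * ennreal (V z)"
          unfolding r_def using \<alpha> k[OF True]
          by (intro add_mono mult_left_mono emeasure_jump_le_ratio drift Suc.prems) (auto simp: k_def)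
        also have "ennreal (r ^ m) * ennreal r = ennreal (r ^ Suc m)"
          using r by (simp add: ennreal_mult[symmetric] mult.commute)
        finally show ?thesis .
      next
        case False
        \<comment> \<open>Off \<open>St n\<close> the induction hypothesis is not consulted: the
          trivial bound 1 is already at most \<open>e * V z\<close>.\<close>
        have "(step \<alpha> ^^ Suc m) (\<lambda>_. 1) z \<le> 1"
          using \<alpha> Suc.prems by (intro step_funpow_le_1) auto
        also have "\<dots> \<le> ennreal (r ^ Suc m) + ennreal e * ennreal (V z)"
          using outside[OF Suc.prems False] by (metis add_increasing zero_le)
        finally show ?thesis .
      qed
    qed simp
    with r z show ?thesis by blast
  qed
  show ?thesis
    unfolding nonexplosive_iff[OF \<alpha>]
  proof
    fix x assume x: "x \<in> S"
    let ?h = "INF n. (step \<alpha> ^^ n) (\<lambda>_. 1) (0, x)"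
    have z: "(0::real, x) \<in> {0..} \<times> S" using x by simp
    have "?h \<le> 0"
    proof (rule ennreal_le_epsilon)
      fix d :: real assume d: "0 < d"
      \<comment> \<open>\<open>e\<close> makes the \<open>V\<close> term at most
        \<open>d / 2\<close>, and the added 1 covers \<open>V (0, x) = 0\<close>. Only then is
        \<open>r\<close> available, which depends on \<open>e\<close>, and \<open>m\<close> is
        chosen last.\<close>
      define e where "e = d / (2 * (V (0, x) + 1))"
      have e: "0 < e" "e * V (0, x) \<le> d / 2"
        using d V_nonneg[OF z] by (auto simp: e_def field_simps)
      obtain r where r: "0 \<le> r" "r < 1" "\<And>m. (step \<alpha> ^^ m) (\<lambda>_. 1) (0, x) \<le> ennreal (r ^ m) + ennreal e * ennreal (V (0, x))"
        using bound[OF z e(1)] by blast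
      obtain m where m: "r ^ m < d / 2"
        using real_arch_pow_inv[of "d / 2" r] d r by auto
      have "?h \<le> (step \<alpha> ^^ m) (\<lambda>_. 1) (0, x)" by (rule INF_lower) simp
      also have "\<dots> \<le> ennreal (r ^ m + e * V (0, x))"
        using r(3)[of m] r(1) e(1) V_nonneg[OF z] by (simp add: ennreal_mult ennreal_plus)
      also have "\<dots> \<le> ennreal d"
        using m e(2) by (intro ennreal_leI) simp
      finally show "?h \<le> 0 + ennreal d" by simp
    qed
    then show "?h = 0" by simp
  qed
qed

end

section \<open>Topological tools: Dini's theorem and compact exhaustions\<close>

lemma Dini_decreasing:
  fixes f :: "nat \<Rightarrow> 'a::metric_space \<Rightarrow> real"
  assumes K: "compact K" and cont: "\<And>n. continuous_on K (f n)"
    and dec: "\<And>m n z. z \<in> K \<Longrightarrow> m \<le> n \<Longrightarrow> f n z \<le> f m z"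
    and lim: "\<And>z. z \<in> K \<Longrightarrow> \<exists>n. f n z < e"
  shows "\<exists>n. \<forall>z\<in>K. f n z < e"
proof (rule ccontr)
  assume "\<not> ?thesis"
  then obtain w where w: "\<And>n. w n \<in> K" "\<And>n. e \<le> f n (w n)"
    by (metis not_less)
  \<comment> \<open>Accumulate the bad points \<open>w n\<close> at \<open>l\<close>. For the one
    index \<open>m\<close> with \<open>f m l < e\<close>, monotonicity gives
    \<open>f m \<ge> e\<close> along the tail, and continuity of \<open>f m\<close> carries this to
    \<open>l\<close>.\<close>
  obtain l r where l: "l \<in> K" and r: "strict_mono r" "(w \<circ> r) \<longlonglongrightarrow> l"
    using K w(1) by (auto simp: compact_def) metis
  obtain m where m: "f m l < e" using lim[OF l] by blast
  have "(\<lambda>k. f m ((w \<circ> r) k)) \<longlonglongrightarrow> f m l"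
    using w(1) by (intro continuous_on_tendsto_compose[OF cont r(2) l]) auto
  moreover have "\<forall>\<^sub>F k in sequentially. e \<le> f m ((w \<circ> r) k)"
  proof (rule eventually_sequentiallyI[of m])
    fix k assume "m \<le> k"
    then have "m \<le> r k" using seq_suble[OF r(1), of k] by simp
    then show "e \<le> f m ((w \<circ> r) k)"
      using order_trans[OF w(2)[of "r k"] dec[OF w(1)[of "r k"]]] by simp
  qed
  ultimately have "e \<le> f m l"
    by (rule tendsto_lowerbound) simp
  with m show False by simp
qed

text \<open>Lindelof reduces the relatively open sets \<open>u x\<close> with compact hulls
  \<open>v x\<close> to a sequence of centres \<open>c n\<close>. The next compact set joins the
  hulls of a finite cover of \<open>K n\<close> with \<open>v (c n)\<close>, which forces the sets
  to exhaust \<open>S\<close>; the finite cover itself is \<open>W n\<close>, the room in which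
  cutoffs are built later.\<close>

lemma locally_compact_exhaustion:
  fixes S :: "'a::{second_countable_topology, t2_space} set"
  assumes "locally compact S"
  obtains K :: "nat \<Rightarrow> 'a set" and W :: "nat \<Rightarrow> 'a set"
  where "\<And>n. compact (K n)" "\<And>n. K n \<subseteq> S" "\<And>n. openin (top_of_set S) (W n)"
    "\<And>n. K n \<subseteq> W n" "\<And>n. W n \<subseteq> K (Suc n)" "(\<Union>n. K n) = S"
proof (cases "S = {}")
  case True
  then show ?thesis by (intro that[of "\<lambda>_. {}" "\<lambda>_. {}"]) auto
next
  case False
  have "\<exists>u v. openin (top_of_set S) u \<and> compact v \<and> x \<in> u \<and> u \<subseteq> v \<and> v \<subseteq> S" if "x \<in> S" for x
    using assms that unfolding locally_def by (metis openin_subtopology_self)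
  then obtain u v where uv: "\<And>x. x \<in> S \<Longrightarrow> openin (top_of_set S) (u x)" "\<And>x. x \<in> S \<Longrightarrow> compact (v x)"
    "\<And>x. x \<in> S \<Longrightarrow> x \<in> u x" "\<And>x. x \<in> S \<Longrightarrow> u x \<subseteq> v x" "\<And>x. x \<in> S \<Longrightarrow> v x \<subseteq> S"
    by metis
  obtain F where F: "F \<subseteq> u ` S" "countable F" "\<Union>F = \<Union>(u ` S)"
    using Lindelof_openin[of "u ` S" S] uv(1) by blast
  obtain C where C: "C \<subseteq> S" "countable C" "F = u ` C"
    using F(1,2) by (metis countable_subset_image)
  have "(\<Union>x\<in>C. u x) = (\<Union>x\<in>S. u x)"
    using F(3) C(3) by simp
  moreover have "u x \<subseteq> S" if "x \<in> S" for x
    using uv(4,5)[OF that] by (rule order_trans)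
  ultimately have cover: "S = (\<Union>x\<in>C. u x)"
    using uv(3) by blast
  then have C_ne: "C \<noteq> {}" using False by auto
  define c where "c = from_nat_into C"
  have c: "c n \<in> S" for n
    using from_nat_into[OF C_ne] C(1) by (auto simp: c_def)
  have "\<exists>K W. \<forall>n. (compact (K n) \<and> K n \<subseteq> S) \<and> (openin (top_of_set S) (W n) \<and> K n \<subseteq> W n \<and> W n \<subseteq> K (Suc n) \<and> v (c n) \<subseteq> K (Suc n))"
  proof -
    have "\<exists>K. \<forall>n. (compact (K n) \<and> K n \<subseteq> S) \<and> (\<exists>W. openin (top_of_set S) W \<and> K n \<subseteq> W \<and> W \<subseteq> K (Suc n) \<and> v (c n) \<subseteq> K (Suc n))"
    proof (rule dependent_nat_choice)
      show "\<exists>K. compact K \<and> K \<subseteq> S" by (intro exI[of _ "{}"]) simp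
      fix K n assume K: "compact K \<and> K \<subseteq> S"
      \<comment> \<open>Compactness refers to open sets of the ambient type, so the relatively open
        \<open>u x\<close> are first lifted to such sets \<open>G x\<close>.\<close>
      have "\<forall>x\<in>C. \<exists>G. open G \<and> u x = S \<inter> G"
        using uv(1) C(1) by (meson openin_open subsetD)
      then obtain G where G: "\<And>x. x \<in> C \<Longrightarrow> open (G x)" "\<And>x. x \<in> C \<Longrightarrow> u x = S \<inter> G x"
        by metis
      have "K \<subseteq> (\<Union>x\<in>C. G x)"
      proof
        fix y assume "y \<in> K"
        then obtain x where "x \<in> C" "y \<in> u x" using K cover by blast
        then show "y \<in> (\<Union>x\<in>C. G x)" using G(2) by auto
      qed
      then obtain D where D': "D \<subseteq> C" "finite D" "K \<subseteq> (\<Union>x\<in>D. G x)"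
        using compactE_image[of K C G] K G(1) by metis
      have "K \<subseteq> (\<Union>x\<in>D. u x)"
      proof
        fix y assume "y \<in> K"
        then obtain x where "x \<in> D" "y \<in> G x" "y \<in> S" using D'(3) K by blast
        then show "y \<in> (\<Union>x\<in>D. u x)" using G(2) D'(1) by auto
      qed
      note D = D'(1,2) this
      have DS: "D \<subseteq> S" using D C by auto
      have "compact ((\<Union>x\<in>D. v x) \<union> v (c n))"
        using D DS uv(2) c by (intro compact_Un compact_UN) auto
      moreover have "(\<Union>x\<in>D. v x) \<union> v (c n) \<subseteq> S" using DS uv(5) c by blast
      moreover have "openin (top_of_set S) (\<Union>x\<in>D. u x)"
        using DS uv(1) by (intro openin_Union) auto
      moreover have "(\<Union>x\<in>D. u x) \<subseteq> (\<Union>x\<in>D. v x) \<union> v (c n)" using DS uv(4) by blast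
      ultimately show "\<exists>K'. (compact K' \<and> K' \<subseteq> S) \<and> (\<exists>W. openin (top_of_set S) W \<and> K \<subseteq> W \<and> W \<subseteq> K' \<and> v (c n) \<subseteq> K')"
        using D(3) by (intro exI[of _ "(\<Union>x\<in>D. v x) \<union> v (c n)"]) blast
    qed
    then show ?thesis by metis
  qed
  then obtain K W where KW: "\<And>n. compact (K n)" "\<And>n. K n \<subseteq> S" "\<And>n. openin (top_of_set S) (W n)"
    "\<And>n. K n \<subseteq> W n" "\<And>n. W n \<subseteq> K (Suc n)" "\<And>n. v (c n) \<subseteq> K (Suc n)"
    by blast
  have "S \<subseteq> (\<Union>n. K n)"
  proof
    fix y assume "y \<in> S"
    then obtain x where x: "x \<in> C" "y \<in> u x" using cover by blast
    then obtain n where "x = c n" using from_nat_into_surj[OF C(2)] by (metis c_def)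
    then have "y \<in> K (Suc n)" using x KW(6)[of n] uv(4)[OF c] by blast
    then show "y \<in> (\<Union>n. K n)" by blast
  qed
  then have "(\<Union>n. K n) = S" using KW(2) by blast
  with KW that show ?thesis by blast
qed

section \<open>Nonexplosion implies drift\<close>

lemma continuous_cutoff:
  fixes Z :: "'b::metric_space set"
  assumes "closed C" "openin (top_of_set Z) U" "C \<subseteq> U"
  obtains f :: "'b \<Rightarrow> real" where "continuous_on Z f" "\<And>z. f z \<in> {0..1}" "\<And>z. z \<in> C \<Longrightarrow> f z = 0"
    "\<And>z. z \<in> Z - U \<Longrightarrow> f z = 1"
proof -
  have "normal_space (top_of_set Z)"
    by (intro metrizable_imp_normal_space metrizable_space_subtopology metrizable_space_euclidean)
  moreover have "closedin (top_of_set Z) (Z \<inter> C)"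
    using assms(1) by (rule closedin_closed_Int)
  moreover have "closedin (top_of_set Z) (Z - U)"
    using assms(2) by (metis closedin_diff closedin_topspace topspace_euclidean_subtopology)
  moreover have "disjnt (Z \<inter> C) (Z - U)"
    using assms(3) by (auto simp: disjnt_def)
  ultimately obtain f where f: "continuous_map (top_of_set Z) euclideanreal f" "f ` (Z \<inter> C) \<subseteq> {0}" "f ` (Z - U) \<subseteq> {1}"
    by (rule Urysohn_lemma_alt)
  \<comment> \<open>Urysohn controls \<open>f\<close> on \<open>Z\<close> only. Truncating and
    setting the value 0 on \<open>C\<close> gives range and zeros at all points; on \<open>Z\<close>
    nothing changes at \<open>C\<close>, where \<open>f\<close> is 0 already, so continuity
    survives.\<close>
  define g where "g z = (if z \<in> C then 0 else max 0 (min 1 (f z)))" for z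
  have "continuous_on Z (\<lambda>z. max 0 (min 1 (f z)))"
    using f(1) by (intro continuous_intros) (simp add: continuous_map_iff_continuous)
  then have "continuous_on Z g"
    by (rule continuous_on_cong[THEN iffD1, rotated 2]) (use f(2) in \<open>auto simp: g_def\<close>)
  moreover have "g z \<in> {0..1}" for z by (auto simp: g_def)
  moreover have "g z = 0" if "z \<in> C" for z using that by (simp add: g_def)
  moreover have "g z = 1" if "z \<in> Z - U" for z using that f(3) assms(3) by (auto simp: g_def)
  ultimately show ?thesis by (rule that)
qed

context Q_kernel
begin

section \<open>Least majorants and pointwise decay of the iterates\<close>

lemma step_sum:
  "(\<And>i. i \<in> I \<Longrightarrow> g i \<in> borel_measurable B) \<Longrightarrow> step \<alpha> (\<lambda>z. \<Sum>i\<in>I. g i z) z = (\<Sum>i\<in>I. step \<alpha> (g i) z)"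
  unfolding step_def by (rule nn_integral_sum) (simp cong: measurable_cong_sets add: sets_jump)

context
  fixes \<alpha> :: real
  assumes \<alpha>: "0 < \<alpha>"
begin

text \<open>The least function that dominates \<open>f\<close> and does not increase under \<open>step \<alpha>\<close>; for the
  indicator of a set it is the probability of hitting that set before being killed.\<close>

primrec reduite_iter :: "(real \<times> 'a \<Rightarrow> ennreal) \<Rightarrow> nat \<Rightarrow> real \<times> 'a \<Rightarrow> ennreal" where
  "reduite_iter f 0 = f"
| "reduite_iter f (Suc n) = (\<lambda>z. max (f z) (step \<alpha> (reduite_iter f n) z))"

text \<open>Known as the reduced function in potential theory: the value of optimally stopping the
  killed chain with reward \<open>f\<close>, where \<open>reduite_iter f n\<close> allows at most
  \<open>n\<close> steps.\<close>

definition reduite :: "(real \<times> 'a \<Rightarrow> ennreal) \<Rightarrow> real \<times> 'a \<Rightarrow> ennreal" where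
  "reduite f z = (SUP n. reduite_iter f n z)"

lemma borel_measurable_reduite_iter:
  "f \<in> borel_measurable B \<Longrightarrow> reduite_iter f n \<in> borel_measurable B"
  using \<alpha> by (induction n) (auto intro!: borel_measurable_max borel_measurable_step)

lemma borel_measurable_reduite:
  "f \<in> borel_measurable B \<Longrightarrow> reduite f \<in> borel_measurable B"
  unfolding reduite_def[abs_def] by (intro borel_measurable_SUP borel_measurable_reduite_iter) auto

lemma incseq_reduite_iter: "incseq (reduite_iter f)"
proof (rule incseq_SucI)
  show "reduite_iter f n \<le> reduite_iter f (Suc n)" for n
  proof (induction n)
    case (Suc n)
    have "step \<alpha> (reduite_iter f n) z \<le> step \<alpha> (reduite_iter f (Suc n)) z" for z
      by (intro step_mono le_funD[OF Suc])
    then show ?case by (auto simp: le_fun_def intro: max.coboundedI2)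
  qed (auto simp: le_fun_def)
qed

lemma reduite_ge: "f z \<le> reduite f z"
  unfolding reduite_def by (rule SUP_upper2[of 0]) auto

lemma step_reduite:
  assumes "f \<in> borel_measurable B"
  shows "step \<alpha> (reduite f) z = (SUP n. step \<alpha> (reduite_iter f n) z)"
  unfolding step_def reduite_def
  by (intro nn_integral_monotone_convergence_SUP incseq_reduite_iter)
     (use borel_measurable_reduite_iter[OF assms] in \<open>simp cong: measurable_cong_sets add: sets_jump\<close>)

lemma step_reduite_le:
  assumes "f \<in> borel_measurable B" shows "step \<alpha> (reduite f) z \<le> reduite f z"
  unfolding step_reduite[OF assms]
proof (rule SUP_least)
  fix n
  have "step \<alpha> (reduite_iter f n) z \<le> reduite_iter f (Suc n) z" by simp
  also have "\<dots> \<le> reduite f z" unfolding reduite_def by (rule SUP_upper) simp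
  finally show "step \<alpha> (reduite_iter f n) z \<le> reduite f z" .
qed

text \<open>The maximum in the recursion is replaced by a sum. The bound is cruder, but
  \<open>step\<close> is additive, so it can be iterated.\<close>

lemma reduite_le:
  assumes "f \<in> borel_measurable B" shows "reduite f z \<le> f z + step \<alpha> (reduite f) z"
  unfolding reduite_def[of f z]
proof (rule SUP_least)
  fix n
  show "reduite_iter f n z \<le> f z + step \<alpha> (reduite f) z"
  proof (cases n)
    case (Suc m)
    have "step \<alpha> (reduite_iter f m) z \<le> step \<alpha> (reduite f) z"
      unfolding step_reduite[OF assms] by (rule SUP_upper) simp
    then show ?thesis
      using Suc by (auto simp: add_increasing intro: add_increasing2)
  qed simp
qed

lemma reduite_le_1:
  assumes "\<And>z. z \<in> {0..} \<times> S \<Longrightarrow> f z \<le> 1" "z \<in> {0..} \<times> S"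
  shows "reduite f z \<le> 1"
  unfolding reduite_def
proof (rule SUP_least)
  show "reduite_iter f n z \<le> 1" for n
    using assms(2)
  proof (induction n arbitrary: z)
    case (Suc n)
    have "step \<alpha> (reduite_iter f n) z \<le> step \<alpha> (\<lambda>_. 1) z"
      by (intro step_mono Suc.IH)
    also have "\<dots> \<le> 1"
      using emeasure_jump_le_1[OF _ Suc.prems] \<alpha> by (simp add: step_const)
    finally show ?case using assms(1)[OF Suc.prems] by simp
  qed (simp add: assms)
qed

text \<open>Hitting requires hitting within \<open>n\<close> steps or surviving \<open>n\<close> steps.\<close>

lemma reduite_le_sum:
  assumes f: "f \<in> borel_measurable B" "\<And>z. z \<in> {0..} \<times> S \<Longrightarrow> f z \<le> 1" and z: "z \<in> {0..} \<times> S"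
  shows "reduite f z \<le> (\<Sum>i<n. (step \<alpha> ^^ i) f z) + (step \<alpha> ^^ n) (\<lambda>_. 1) z"
  using z
proof (induction n arbitrary: z)
  case 0
  then show ?case using reduite_le_1[OF f(2)] by simp
next
  case (Suc n)
  have meas: "(step \<alpha> ^^ i) f \<in> borel_measurable B" "(step \<alpha> ^^ i) (\<lambda>_. 1) \<in> borel_measurable B" for i
    using \<alpha> f(1) by (auto intro: borel_measurable_step_funpow)
  have "reduite f z \<le> f z + step \<alpha> (\<lambda>z. (\<Sum>i<n. (step \<alpha> ^^ i) f z) + (step \<alpha> ^^ n) (\<lambda>_. 1) z) z"
    by (intro order_trans[OF reduite_le[OF f(1)]] add_left_mono step_mono Suc.IH)
  also have "\<dots> = f z + (step \<alpha> (\<lambda>z. \<Sum>i<n. (step \<alpha> ^^ i) f z) z + step \<alpha> ((step \<alpha> ^^ n) (\<lambda>_. 1)) z)"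
    using meas by (simp add: step_add)
  also have "step \<alpha> (\<lambda>z. \<Sum>i<n. (step \<alpha> ^^ i) f z) z = (\<Sum>i<n. step \<alpha> ((step \<alpha> ^^ i) f) z)"
    using meas by (intro step_sum)
  finally show ?case
    by (simp add: sum.lessThan_Suc_shift add.assoc del: sum.lessThan_Suc)
qed

text \<open>Monotone convergence from above, applied once per power; the bound 1 supplies finite
  integrals. Both claims are proved together because the limit at one level uses monotonicity at the
  level below.\<close>

lemma INF_step_funpow_eq_0:
  assumes f: "\<And>m. f m \<in> borel_measurable B" "\<And>m z. z \<in> {0..} \<times> S \<Longrightarrow> f m z \<le> 1"
    and dec: "\<And>m z. z \<in> {0..} \<times> S \<Longrightarrow> f (Suc m) z \<le> f m z"
    and lim: "\<And>z. z \<in> {0..} \<times> S \<Longrightarrow> (INF m. f m z) = 0" and z: "z \<in> {0..} \<times> S"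
  shows "(step \<alpha> ^^ i) (f (Suc m)) z \<le> (step \<alpha> ^^ i) (f m) z" "(INF m. (step \<alpha> ^^ i) (f m) z) = 0"
  using z
proof (induction i arbitrary: m z)
  case 0
  { case 1 then show ?case using dec by simp }
  { case 2 then show ?case using lim by simp }
next
  case (Suc i)
  { case 1
    then show ?case using Suc.IH(1) by (auto intro!: step_mono) }
  { case 2
    have meas: "(step \<alpha> ^^ i) (f m) \<in> borel_measurable (jump \<alpha> z)" for m
      using borel_measurable_step_funpow[of \<alpha> "f m" i] \<alpha> f(1)
      by (simp cong: measurable_cong_sets add: sets_jump)
    have "(\<integral>\<^sup>+y. (INF m. (step \<alpha> ^^ i) (f m) y) \<partial>jump \<alpha> z) = (INF m. \<integral>\<^sup>+y. (step \<alpha> ^^ i) (f m) y \<partial>jump \<alpha> z)"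
    proof (rule nn_integral_monotone_convergence_INF_AE)
      show "AE y in jump \<alpha> z. (step \<alpha> ^^ i) (f (Suc m)) y \<le> (step \<alpha> ^^ i) (f m) y" for m
        using Suc.IH(1) by (intro AE_I2) auto
      have "(\<integral>\<^sup>+y. (step \<alpha> ^^ i) (f 0) y \<partial>jump \<alpha> z) \<le> 1"
        using step_funpow_le_1[of \<alpha> "f 0" z "Suc i"] \<alpha> f(2) 2 by (simp add: step_def)
      also have "\<dots> < \<infinity>" by simp
      finally show "(\<integral>\<^sup>+y. (step \<alpha> ^^ i) (f 0) y \<partial>jump \<alpha> z) < \<infinity>" .
    qed (rule meas)
    moreover have "(\<integral>\<^sup>+y. (INF m. (step \<alpha> ^^ i) (f m) y) \<partial>jump \<alpha> z) = (\<integral>\<^sup>+y. 0 \<partial>jump \<alpha> z)"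
      using Suc.IH(2) by (intro nn_integral_cong) auto
    moreover have "(step \<alpha> ^^ Suc i) (f m) z = (\<integral>\<^sup>+y. (step \<alpha> ^^ i) (f m) y \<partial>jump \<alpha> z)" for m
      by (simp add: step_def[of \<alpha> "(step \<alpha> ^^ i) (f m)" z])
    ultimately show ?case by simp }
qed

lemma nonexplosive_imp_INF_step_0:
  assumes "nonexplosive S q" and z: "z \<in> {0..} \<times> S"
  shows "(INF n. (step \<alpha> ^^ n) (\<lambda>_. 1) z) = 0"
proof -
  obtain v x where vx: "z = (v, x)" "0 \<le> v" "x \<in> S" using z by (cases z) auto
  define c where "c = ennreal (weight \<alpha> (0, x) v)"
  have c: "0 < c" "c < top" by (simp_all add: c_def)
  have meas: "(step \<alpha> ^^ n) (\<lambda>_. 1) \<in> borel_measurable B" for n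
    using \<alpha> by (intro borel_measurable_step_funpow) auto
  have le: "c * (step \<alpha> ^^ Suc n) (\<lambda>_. 1) z \<le> (step \<alpha> ^^ Suc n) (\<lambda>_. 1) (0, x)" for n
    using nn_integral_jump_shift[OF z[unfolded vx(1)] meas, of \<alpha> n]
    by (simp add: c_def vx(1) step_def)
  have "c * (INF n. (step \<alpha> ^^ n) (\<lambda>_. 1) z) \<le> (step \<alpha> ^^ n) (\<lambda>_. 1) (0, x)" for n
  proof (cases n)
    \<comment> \<open>The comparison \<open>le\<close> needs a first jump and so covers successors
      only; here \<open>c \<le> 1\<close> and the trivial bound 1 suffice.\<close>
    case 0
    have "(INF n. (step \<alpha> ^^ n) (\<lambda>_. 1) z) \<le> (step \<alpha> ^^ 0) (\<lambda>_. 1) z" by (rule INF_lower) simp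
    moreover have "c \<le> 1"
    proof -
      have "0 \<le> (LBINT u:{0..v}. q_rate q x (max 0 u))"
        unfolding set_lebesgue_integral_def
        using q_rate_nonneg[OF vx(3)] by (intro integral_nonneg_AE) auto
      moreover have "0 \<le> \<alpha> * v" using \<alpha> vx(2) by simp
      ultimately have "0 \<le> \<alpha> * v + (LBINT u:{0..v}. q_rate q x (max 0 u))" by linarith
      then show ?thesis by (simp add: c_def weight_def)
    qed
    ultimately show ?thesis using 0 mult_mono[of c 1 "INF n. (step \<alpha> ^^ n) (\<lambda>_. 1) z" 1] by simp
  next
    case (Suc m)
    have "(INF n. (step \<alpha> ^^ n) (\<lambda>_. 1) z) \<le> (step \<alpha> ^^ Suc m) (\<lambda>_. 1) z" by (rule INF_lower) simp
    then show ?thesis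
      unfolding Suc by (intro order_trans[OF mult_left_mono le]) auto
  qed
  then have "c * (INF n. (step \<alpha> ^^ n) (\<lambda>_. 1) z) \<le> (INF n. (step \<alpha> ^^ n) (\<lambda>_. 1) (0, x))"
    by (intro INF_greatest)
  also have "\<dots> = 0"
    using assms(1) vx(3) by (simp add: nonexplosive_iff[OF \<alpha>])
  finally show ?thesis using c(1) by auto
qed

section \<open>Continuity of the iterates and uniform decay on compact sets\<close>

lemma step_1_decreasing:
  "z \<in> {0..} \<times> S \<Longrightarrow> (step \<alpha> ^^ Suc n) (\<lambda>_. 1) z \<le> (step \<alpha> ^^ n) (\<lambda>_. 1) z"
proof (induction n arbitrary: z)
  case 0
  then show ?case using emeasure_jump_le_1[of \<alpha> z] \<alpha> by (simp add: step_const)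
next
  case (Suc n)
  then show ?case unfolding funpow.simps(2)[of "Suc n"] funpow.simps(2)[of n] comp_def
    by (intro step_mono) simp
qed

text \<open>\<open>step\<close> works with extended values, continuity and the Feller property with
  real ones. The bound 1 makes the conversion lossless on the state space, and
  \<open>step \<alpha>\<close> preserves the class under the Feller hypothesis.\<close>

definition cont1 :: "(real \<times> 'a \<Rightarrow> ennreal) \<Rightarrow> bool" where
  "cont1 f \<longleftrightarrow> (\<forall>z\<in>{0..} \<times> S. f z \<le> 1) \<and> continuous_on ({0..} \<times> S) (\<lambda>z. enn2real (f z))"

lemma cont1_eq:
  assumes "cont1 f" "z \<in> {0..} \<times> S" shows "f z = ennreal (enn2real (f z))"
proof -
  have "f z \<le> 1" using assms by (auto simp: cont1_def)
  also have "\<dots> < top" by simp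
  finally show ?thesis by simp
qed

lemma borel_measurable_cont1:
  assumes "cont1 f" shows "f \<in> borel_measurable B"
proof -
  have "(\<lambda>z. ennreal (enn2real (f z))) \<in> borel_measurable B"
    using assms borel_measurable_continuous_on_restrict unfolding cont1_def by (intro measurable_compose[OF _ measurable_ennreal]) blast
  then show ?thesis
    by (rule measurable_cong[THEN iffD1, rotated]) (metis cont1_eq[OF assms] space_B)
qed

lemma cont1_step:
  assumes W: "weakly_Feller S (p_alpha S q \<alpha>)" and f: "cont1 f"
  shows "cont1 (step \<alpha> f)"
proof -
  have le1: "f z \<le> 1" if "z \<in> {0..} \<times> S" for z using f that by (auto simp: cont1_def)
  let ?f = "\<lambda>z. enn2real (f z)"
  have real_le1: "?f z \<le> 1" if "z \<in> {0..} \<times> S" for z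
    using enn2real_mono[OF le1[OF that]] by simp
  have cont: "continuous_on ({0..} \<times> S) ?f" using f by (simp add: cont1_def)
  moreover have "bounded (?f ` ({0..} \<times> S))"
    unfolding bounded_iff using real_le1 by (intro exI[of _ 1]) auto
  ultimately have int_cont: "continuous_on ({0..} \<times> S) (\<lambda>(v, x). LINT z:range Some|p_alpha S q \<alpha> (Some (v, x)). ?f (the z))"
    using W unfolding weakly_Feller_def by blast
  have int_eq: "(LINT z:range Some|p_alpha S q \<alpha> (Some (v, x)). ?f (the z)) = enn2real (step \<alpha> f (v, x))"
    if "(v, x) \<in> {0..} \<times> S" for v x
  proof -
    have "?f \<in> borel_measurable B"
      using cont by (rule borel_measurable_continuous_on_restrict)
    from set_integral_p_alpha[OF that this, of \<alpha>]
    have "(LINT z:range Some|p_alpha S q \<alpha> (Some (v, x)). ?f (the z)) = enn2real (step \<alpha> (\<lambda>z. ennreal (?f z)) (v, x))"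
      by (simp add: step_def)
    also have "step \<alpha> (\<lambda>z. ennreal (?f z)) (v, x) = step \<alpha> f (v, x)"
      using cont1_eq[OF f] by (intro step_cong) auto
    finally show ?thesis .
  qed
  have "continuous_on ({0..} \<times> S) (\<lambda>z. enn2real (step \<alpha> f z))"
    by (rule continuous_on_eq[OF int_cont]) (use int_eq in auto)
  moreover have "step \<alpha> f z \<le> 1" if "z \<in> {0..} \<times> S" for z
    using step_funpow_le_1[of \<alpha> f z 1] le1 that \<alpha> by simp
  ultimately show ?thesis by (simp add: cont1_def)
qed

lemma cont1_step_funpow:
  "weakly_Feller S (p_alpha S q \<alpha>) \<Longrightarrow> cont1 f \<Longrightarrow> cont1 ((step \<alpha> ^^ n) f)"
  by (induction n) (auto intro: cont1_step)

text \<open>Dini's theorem; monotonicity extends the bound to all later indices, so that several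
  such statements can be met by a common index.\<close>

lemma INF_0_uniform_on_compact:
  assumes f: "\<And>n. cont1 (f n)" and dec: "\<And>n z. z \<in> {0..} \<times> S \<Longrightarrow> f (Suc n) z \<le> f n z"
    and lim: "\<And>z. z \<in> {0..} \<times> S \<Longrightarrow> (INF n. f n z) = 0"
    and C: "compact C" "C \<subseteq> {0..} \<times> S" and e: "0 < e"
  shows "\<exists>n. \<forall>m\<ge>n. \<forall>z\<in>C. f m z \<le> ennreal e"
proof -
  have Z: "z \<in> {0..} \<times> S" if "z \<in> C" for z using C(2) that by blast
  have dec': "f n z \<le> f m z" if "m \<le> n" "z \<in> C" for m n z
    using that(1) dec[OF Z[OF that(2)]] by (rule lift_Suc_antimono_le[of "\<lambda>n. f n z", rotated])
  have fin: "f n z < top" if "z \<in> C" for n z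
    using cont1_eq[OF f Z[OF that], of n] by (metis ennreal_less_top)
  have "\<exists>n. \<forall>z\<in>C. enn2real (f n z) < e"
  proof (rule Dini_decreasing[OF C(1)])
    show "continuous_on C (\<lambda>z. enn2real (f n z))" for n
      using f[of n] C(2) unfolding cont1_def by (blast intro: continuous_on_subset)
    show "enn2real (f n z) \<le> enn2real (f m z)" if "z \<in> C" "m \<le> n" for m n z
      using dec'[OF that(2,1)] fin[OF that(1)] by (rule enn2real_mono)
    fix z assume z: "z \<in> C"
    have "(INF n. f n z) < ennreal e" using lim[OF Z[OF z]] e by simp
    then obtain n where "f n z < ennreal e" by (auto simp: INF_less_iff)
    then show "\<exists>n. enn2real (f n z) < e"
      using e by (metis cont1_eq[OF f Z[OF z]] enn2real_nonneg ennreal_less_iff)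
  qed
  then obtain n where n: "\<forall>z\<in>C. enn2real (f n z) < e" by blast
  have "f m z \<le> ennreal e" if "n \<le> m" "z \<in> C" for m z
  proof -
    have "f m z \<le> f n z" by (rule dec'[OF that])
    also have "\<dots> = ennreal (enn2real (f n z))" by (rule cont1_eq[OF f Z[OF that(2)]])
    also have "\<dots> \<le> ennreal e" using n that(2) by (intro ennreal_leI) (auto intro: less_imp_le)
    finally show ?thesis .
  qed
  then show ?thesis by blast
qed

text \<open>\<open>reduite\<close> is a supremum of iterates and need not be continuous, so Dini is
  applied to the finitely many terms of \<open>reduite_le_sum\<close>. The survival term fixes
  \<open>N\<close> first, independently of \<open>f\<close>; then the powers below \<open>N\<close>
  are made small through the index of \<open>f\<close>.\<close>

lemma reduite_small_on_compact:
  assumes W: "weakly_Feller S (p_alpha S q \<alpha>)" and ne: "nonexplosive S q"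
    and f: "\<And>n. cont1 (f n)" and dec: "\<And>n z. z \<in> {0..} \<times> S \<Longrightarrow> f (Suc n) z \<le> f n z"
    and lim: "\<And>z. z \<in> {0..} \<times> S \<Longrightarrow> (INF n. f n z) = 0"
    and C: "compact C" "C \<subseteq> {0..} \<times> S" and e: "0 < e"
  shows "\<exists>m. \<forall>z\<in>C. reduite (f m) z \<le> ennreal e"
proof -
  have one: "cont1 (\<lambda>_. 1)" by (simp add: cont1_def)
  have le1: "f n z \<le> 1" if "z \<in> {0..} \<times> S" for n z using f[of n] that by (auto simp: cont1_def)
  obtain N where N: "\<And>z. z \<in> C \<Longrightarrow> (step \<alpha> ^^ N) (\<lambda>_. 1) z \<le> ennreal (e / 2)"
    using INF_0_uniform_on_compact[OF cont1_step_funpow[OF W one] step_1_decreasing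
        nonexplosive_imp_INF_step_0[OF ne] C, of "e / 2"] e by auto
  \<comment> \<open>\<open>N\<close> terms of size \<open>d\<close> add up to at most
    \<open>e / 2\<close>; the added 1 keeps the denominator positive when
    \<open>N = 0\<close>.\<close>
  define d where "d = e / (2 * (real N + 1))"
  have d: "0 < d" using e by (simp add: d_def)
  have "\<exists>n. \<forall>m\<ge>n. \<forall>z\<in>C. (step \<alpha> ^^ i) (f m) z \<le> ennreal d" for i
    using INF_step_funpow_eq_0[OF borel_measurable_cont1[OF f] le1 dec lim]
    by (intro INF_0_uniform_on_compact[OF cont1_step_funpow[OF W f] _ _ C d]) blast+
  then obtain n where n: "\<And>i m z. n i \<le> m \<Longrightarrow> z \<in> C \<Longrightarrow> (step \<alpha> ^^ i) (f m) z \<le> ennreal d"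
    by metis
  \<comment> \<open>The sum dominates every \<open>n i\<close> with \<open>i < N\<close>.\<close>
  define m where "m = (\<Sum>i<N. n i)"
  have m: "n i \<le> m" if "i < N" for i
    unfolding m_def using that by (intro member_le_sum) auto
  have "reduite (f m) z \<le> ennreal e" if z: "z \<in> C" for z
  proof -
    have "reduite (f m) z \<le> (\<Sum>i<N. (step \<alpha> ^^ i) (f m) z) + (step \<alpha> ^^ N) (\<lambda>_. 1) z"
      using C(2) z by (intro reduite_le_sum borel_measurable_cont1 f le1) auto
    also have "\<dots> \<le> (\<Sum>i<N. ennreal d) + ennreal (e / 2)"
      using n m z N by (intro add_mono sum_mono) auto
    also have "\<dots> = ennreal (real N * d + e / 2)"
      using d e by (simp add: ennreal_of_nat_eq_real_of_nat ennreal_mult ennreal_plus)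
    also have "\<dots> \<le> ennreal e"
      using e by (intro ennreal_leI) (simp add: d_def field_simps)
    finally show ?thesis .
  qed
  then show ?thesis by blast
qed

lemma nonexplosive_imp_drift:
  assumes W: "weakly_Feller S (p_alpha S q \<alpha>)" and ne: "nonexplosive S q"
    and lc: "locally compact S"
    and rates: "\<And>\<Gamma>. \<Gamma> \<subseteq> S \<Longrightarrow> compact \<Gamma> \<Longrightarrow> (SUP (x, t)\<in>\<Gamma> \<times> {0..}. ereal (q_rate q x t)) < \<infinity>"
  shows "\<exists>T K V. (\<forall>n. T n \<subseteq> {0..} \<and> compact (T n) \<and> K n \<subseteq> S \<and> compact (K n)) \<and>
        drift_condition S q (\<lambda>n. T n \<times> K n) V \<and>
        (\<forall>n. (SUP z\<in>T n \<times> K n. ereal (V z)) < \<infinity>)"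
proof -
  obtain K U where K: "\<And>n. compact (K n)" "\<And>n. K n \<subseteq> S" "\<And>n. openin (top_of_set S) (U n)"
    "\<And>n. K n \<subseteq> U n" "\<And>n. U n \<subseteq> K (Suc n)" "(\<Union>n. K n) = S"
    using locally_compact_exhaustion[OF lc] by metis
  define T where "T n = {0..real n}" for n
  define C where "C n = T n \<times> K n" for n
  have compact_C: "compact (C n)" and C_sub: "C n \<subseteq> {0..} \<times> S" for n
    using K(1,2) by (auto simp: C_def T_def intro: compact_Times)
  have inc_K: "incseq K"
    using K(4,5) by (intro incseq_SucI) (rule order_trans)
  have "C i \<subseteq> C j" if "i \<le> j" for i j
    using incseqD[OF inc_K that] that by (auto simp: C_def T_def)
  then have inc_C: "incseq C" by (rule monoI)
  have C_UN: "(\<Union>n. C n) = {0..} \<times> S"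
  proof (intro equalityI subsetI)
    fix z :: "real \<times> 'a" assume "z \<in> {0..} \<times> S"
    then obtain t x where tx: "z = (t, x)" "0 \<le> t" "x \<in> S" by auto
    obtain m where m: "x \<in> K m" using tx(3) K(6) by blast
    obtain n where n: "t \<le> real n" using real_arch_simple by blast
    have "z \<in> C (max m n)"
      using tx m n incseqD[OF inc_K, of m "max m n"] by (auto simp: C_def T_def)
    then show "z \<in> (\<Union>n. C n)" by blast
  qed (use C_sub in blast)
  have in_C: "\<exists>n. z \<in> C n" if "z \<in> {0..} \<times> S" for z
  proof -
    have "z \<in> (\<Union>n. C n)" using that by (simp only: C_UN)
    then show ?thesis by simp
  qed
  have "\<exists>f :: real \<times> 'a \<Rightarrow> real. continuous_on ({0..} \<times> S) f \<and> (\<forall>z. f z \<in> {0..1}) \<and> (\<forall>z\<in>C n. f z = 0) \<and>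
    (\<forall>z\<in>{0..} \<times> S - C (Suc n). f z = 1)" for n
  proof -
    \<comment> \<open>The relatively open rectangle with time bound \<open>n + 1\<close> lies
      between \<open>C n\<close> and \<open>C (Suc n)\<close>.\<close>
    have "openin (top_of_set {0..}) ({0..} \<inter> {..<real n + 1})"
      by (intro openin_open_Int) simp
    from openin_Times[OF this K(3)[of n]]
    have "openin (top_of_set ({0..} \<times> S)) (({0..} \<inter> {..<real n + 1}) \<times> U n)" .
    moreover have "C n \<subseteq> ({0..} \<inter> {..<real n + 1}) \<times> U n"
      using K(4)[of n] by (auto simp: C_def T_def)
    ultimately obtain f :: "real \<times> 'a \<Rightarrow> real" where f: "continuous_on ({0..} \<times> S) f" "\<And>z. f z \<in> {0..1}" "\<And>z. z \<in> C n \<Longrightarrow> f z = 0"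
      "\<And>z. z \<in> {0..} \<times> S - ({0..} \<inter> {..<real n + 1}) \<times> U n \<Longrightarrow> f z = 1"
      using continuous_cutoff[OF compact_imp_closed[OF compact_C[of n]]] by blast
    moreover have "({0..} \<inter> {..<real n + 1}) \<times> U n \<subseteq> C (Suc n)"
      using K(5)[of n] by (auto simp: C_def T_def)
    ultimately show ?thesis by blast
  qed
  then obtain f :: "nat \<Rightarrow> real \<times> 'a \<Rightarrow> real" where f: "\<And>n. continuous_on ({0..} \<times> S) (f n)" "\<And>n z. f n z \<in> {0..1}"
    "\<And>n z. z \<in> C n \<Longrightarrow> f n z = 0" "\<And>n z. z \<in> {0..} \<times> S - C (Suc n) \<Longrightarrow> f n z = 1"
    by metis
  define \<phi> where "\<phi> n z = ennreal (f n z)" for n z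
  have \<phi>: "cont1 (\<phi> n)" for n
    using f(1,2)[of n] by (auto simp: cont1_def \<phi>_def ennreal_le_1)
  \<comment> \<open>Where the later cutoff is nonzero, outside \<open>C (Suc n)\<close>, the earlier
    one already equals 1.\<close>
  have \<phi>_dec: "\<phi> (Suc n) z \<le> \<phi> n z" if "z \<in> {0..} \<times> S" for n z
  proof (cases "z \<in> C (Suc n)")
    case True
    then show ?thesis by (simp add: \<phi>_def f(3))
  next
    case False
    then have "f n z = 1" using that by (intro f(4)) simp
    then show ?thesis using f(2)[of "Suc n" z] by (simp add: \<phi>_def ennreal_le_1)
  qed
  have \<phi>_lim: "(INF n. \<phi> n z) = 0" if z: "z \<in> {0..} \<times> S" for z
  proof -
    obtain n where "z \<in> C n" using in_C[OF z] by (rule exE)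
    then have "\<phi> n z = 0" by (simp add: \<phi>_def f(3))
    moreover have "(INF n. \<phi> n z) \<le> \<phi> n z" by (rule INF_lower) simp
    ultimately show ?thesis by simp
  qed
  have "\<exists>m. \<forall>z\<in>C k. reduite (\<phi> m) z \<le> ennreal ((1 / 2) ^ k)" for k
    by (rule reduite_small_on_compact[OF W ne \<phi> \<phi>_dec \<phi>_lim compact_C C_sub]) simp_all
  then obtain m where m: "\<And>k z. z \<in> C k \<Longrightarrow> reduite (\<phi> (m k)) z \<le> ennreal ((1 / 2) ^ k)"
    by metis
  define R where "R k = reduite (\<phi> (m k))" for k
  have R_meas: "R k \<in> borel_measurable B" for k
    unfolding R_def by (rule borel_measurable_reduite[OF borel_measurable_cont1[OF \<phi>]])
  have R_le_1: "R k z \<le> 1" if "z \<in> {0..} \<times> S" for k z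
    unfolding R_def using that \<phi>[of "m k"] by (intro reduite_le_1) (auto simp: cont1_def)
  have R_one: "1 \<le> R k z" if "z \<in> {0..} \<times> S - C (Suc (m k))" for k z
    using reduite_ge[of "\<phi> (m k)" z] f(4)[OF that] by (simp add: R_def \<phi>_def)
  define G where "G z = (\<Sum>k. R k z)" for z
  have G_meas: "G \<in> borel_measurable B"
    unfolding G_def using R_meas by measurable
  have G_bound: "G z \<le> ennreal (real n + 2)" if z: "z \<in> C n" for n z
  proof -
    have zZ: "z \<in> {0..} \<times> S" using z C_sub by blast
    \<comment> \<open>A point of \<open>C n\<close> lies in \<open>C k\<close> for
      \<open>k \<ge> n\<close>, where the geometric bound holds; the other \<open>n\<close> terms
      are at most 1. The total is \<open>n\<close> plus the geometric sum 2.\<close>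
    have "R k z \<le> ennreal ((if k < n then 1 else 0) + (1 / 2) ^ k)" for k
    proof (cases "k < n")
      case True
      have "R k z \<le> ennreal 1" using R_le_1[OF zZ] by simp
      also have "\<dots> \<le> ennreal ((if k < n then 1 else 0) + (1 / 2) ^ k)" using True by (intro ennreal_leI) simp
      finally show ?thesis .
    next
      case False
      then have "z \<in> C k" using z incseqD[OF inc_C, of n k] by auto
      from m[OF this] False show ?thesis by (simp add: R_def)
    qed
    then have "G z \<le> (\<Sum>k. ennreal ((if k < n then 1 else 0) + (1 / 2) ^ k))"
      unfolding G_def by (intro suminf_le) auto
    also have "\<dots> = ennreal (real n + 2)"
    proof (rule suminf_ennreal_eq)
      have "(\<lambda>k. if k \<in> {..<n} then 1 else 0 :: real) sums (\<Sum>k<n. 1)"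
        by (rule sums_If_finite_set) simp
      then have "(\<lambda>k. if k < n then 1 else 0 :: real) sums real n" by simp
      moreover have "(\<lambda>k. (1 / 2) ^ k) sums (2 :: real)"
        using geometric_sums[of "1 / 2 :: real"] by simp
      ultimately show "(\<lambda>k. (if k < n then 1 else 0) + (1 / 2) ^ k) sums (real n + 2)"
        by (rule sums_add)
    qed simp
    finally show ?thesis .
  qed
  have G_step: "step \<alpha> G z \<le> G z" for z
  proof -
    have "step \<alpha> G z = (\<Sum>k. step \<alpha> (R k) z)"
      unfolding step_def G_def
      by (intro nn_integral_suminf) (use R_meas in \<open>simp cong: measurable_cong_sets add: sets_jump\<close>)
    also have "\<dots> \<le> G z"
      unfolding G_def R_def by (intro suminf_le step_reduite_le borel_measurable_cont1 \<phi>) auto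
    finally show ?thesis .
  qed
  \<comment> \<open>The sum of the \<open>Suc (m i)\<close> bounds each of these indices, so outside
    that compact set each of the first \<open>k\<close> summands is at least 1.\<close>
  have G_large: "ennreal (real k) \<le> G z" if z: "z \<in> {0..} \<times> S - C (\<Sum>i<k. Suc (m i))" for k z
  proof -
    have "1 \<le> R i z" if "i < k" for i
    proof (rule R_one)
      have "Suc (m i) \<le> (\<Sum>i<k. Suc (m i))"
        using that by (intro member_le_sum) auto
      from incseqD[OF inc_C this] z show "z \<in> {0..} \<times> S - C (Suc (m i))" by blast
    qed
    then have "(\<Sum>i<k. 1) \<le> (\<Sum>i<k. R i z)" by (intro sum_mono) simp
    also have "\<dots> \<le> G z" unfolding G_def by (intro sum_le_suminf) auto
    finally show ?thesis by (simp add: ennreal_of_nat_eq_real_of_nat)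
  qed
  define V where "V z = enn2real (G z)" for z
  have V: "ennreal (V z) = G z" if z: "z \<in> {0..} \<times> S" for z
  proof -
    obtain n where "z \<in> C n" using in_C[OF z] by (rule exE)
    from G_bound[OF this] have "G z < top" by (rule le_less_trans) simp
    then show ?thesis by (simp add: V_def)
  qed
  have V_bound: "V z \<le> real n + 2" if "z \<in> C n" for n z
    unfolding V_def by (rule enn2real_leI[OF _ G_bound[OF that]]) simp
  have V_nonneg: "0 \<le> V z" for z
    by (simp add: V_def)
  have V_large: "real k \<le> V z" if "z \<in> {0..} \<times> S - C (\<Sum>i<k. Suc (m i))" for k z
  proof -
    have "ennreal (real k) \<le> ennreal (V z)"
      using G_large[OF that] V[of z] that by simp
    then show ?thesis by (simp only: ennreal_le_iff[OF V_nonneg])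
  qed
  have V_meas: "V \<in> borel_measurable B"
    unfolding V_def using G_meas by measurable
  have INF_inc: "incseq (\<lambda>n. INF z\<in>{0..} \<times> S - C n. ereal (V z))"
    using incseqD[OF inc_C] by (intro monoI INF_superset_mono) auto
  have "drift_condition S q C V"
    unfolding drift_condition_def
  proof (intro conjI allI)
    show "C n \<in> sets B" for n
    proof -
      have "C n \<in> sets borel" by (rule borel_compact[OF compact_C])
      moreover have "{0::real..} \<times> S \<in> sets borel"
        using S by (intro borel_Times) auto
      ultimately show ?thesis using C_sub by (simp add: sets_restrict_space_iff)
    qed
    show "(SUP (x, t)\<in>(snd ` C n) \<times> {0..}. ereal (q_rate q x t)) < \<infinity>" for n
    proof -
      have "(SUP (x, t)\<in>(snd ` C n) \<times> {0..}. ereal (q_rate q x t)) \<le> (SUP (x, t)\<in>K n \<times> {0..}. ereal (q_rate q x t))"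
        by (rule SUP_subset_mono) (auto simp: C_def)
      also have "\<dots> < \<infinity>" by (rule rates[OF K(2,1)])
      finally show ?thesis .
    qed
    show "(\<lambda>n. INF z\<in>{0..} \<times> S - C n. ereal (V z)) \<longlonglongrightarrow> \<infinity>"
      unfolding tendsto_PInfty
    proof
      fix r :: real
      obtain k where k: "r < real k" using reals_Archimedean2 by blast
      let ?n = "\<Sum>i<k. Suc (m i)"
      have "ereal r < (INF z\<in>{0..} \<times> S - C n. ereal (V z))" if "?n \<le> n" for n
      proof -
        have "ereal r < ereal (real k)" using k by simp
        also have "\<dots> \<le> (INF z\<in>{0..} \<times> S - C ?n. ereal (V z))"
          using V_large by (intro INF_greatest) simp
        also have "\<dots> \<le> (INF z\<in>{0..} \<times> S - C n. ereal (V z))"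
          by (rule incseqD[OF INF_inc that])
        finally show ?thesis .
      qed
      then show "\<forall>\<^sub>F n in sequentially. ereal r < (INF z\<in>{0..} \<times> S - C n. ereal (V z))"
        by (auto simp: eventually_sequentially)
    qed
    \<comment> \<open>The drift constant is the \<alpha> of the Feller hypothesis, for which
      \<open>G\<close> was built.\<close>
    show "\<exists>\<alpha>>0. \<forall>x\<in>S. \<forall>v\<ge>0.
        (\<integral>\<^sup>+t\<in>{0..}. (\<integral>\<^sup>+y. ennreal (V (t + v, y)) *
             ennreal (exp (- \<alpha> * t - (LBINT s:{0..t}. q_rate q x (s + v)))) \<partial>q_jump S q x (t + v)) \<partial>lborel)
          \<le> ennreal (V (v, x))"
    proof (intro exI[of _ \<alpha>] conjI ballI allI impI)
      fix x v assume "x \<in> S" "0 \<le> (v :: real)"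
      then have z: "(v, x) \<in> {0..} \<times> S" by simp
      have "step \<alpha> (\<lambda>z. ennreal (V z)) (v, x) = step \<alpha> G (v, x)"
        by (intro step_cong V)
      also have "\<dots> \<le> ennreal (V (v, x))"
        using G_step V[OF z] by simp
      finally show "(\<integral>\<^sup>+t\<in>{0..}. (\<integral>\<^sup>+y. ennreal (V (t + v, y)) *
             ennreal (exp (- \<alpha> * t - (LBINT s:{0..t}. q_rate q x (s + v)))) \<partial>q_jump S q x (t + v)) \<partial>lborel)
          \<le> ennreal (V (v, x))"
        unfolding drift_integral_eq[OF z V_meas] step_def .
    qed (rule \<alpha>)
  qed (use inc_C C_UN V_meas INF_inc in \<open>simp_all add: V_nonneg\<close>)
  moreover have "(SUP z\<in>C n. ereal (V z)) < \<infinity>" for n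
  proof -
    have "(SUP z\<in>C n. ereal (V z)) \<le> ereal (real n + 2)"
      using V_bound by (intro SUP_least) simp
    also have "\<dots> < \<infinity>" by simp
    finally show ?thesis .
  qed
  ultimately show ?thesis
    using K(1,2) by (intro exI[of _ T] exI[of _ K] exI[of _ V]) (auto simp: C_def[abs_def] T_def)
qed

end

end

theorem theorem3p2:
  fixes S :: "'a::polish_space set" and q :: "'a \<Rightarrow> real \<Rightarrow> 'a set \<Rightarrow> real"
  assumes "S \<in> sets borel" and "S \<noteq> {}" and "Q_function S q"
  shows "((\<exists>St V. drift_condition S q St V) \<longrightarrow> nonexplosive S q) \<and>
    (locally compact S \<and>
      (\<forall>\<Gamma>\<subseteq>S. compact \<Gamma> \<longrightarrow> (SUP (x, t)\<in>\<Gamma> \<times> {0..}. ereal (q_rate q x t)) < \<infinity>) \<and>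
      (\<exists>\<alpha>>0. weakly_Feller S (p_alpha S q \<alpha>)) \<and>
      nonexplosive S q \<longrightarrow>
      (\<exists>T K V. (\<forall>n. T n \<subseteq> {0..} \<and> compact (T n) \<and> K n \<subseteq> S \<and> compact (K n)) \<and>
        drift_condition S q (\<lambda>n. T n \<times> K n) V \<and>
        (\<forall>n. (SUP z\<in>T n \<times> K n. ereal (V z)) < \<infinity>)))"
proof -
  interpret Q_kernel S q
    using assms by unfold_locales
  show ?thesis
    using drift_imp_nonexplosive nonexplosive_imp_drift by blast
qed

end
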